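(* Let $p\ge 1$ and let $0 =: k_0 < k_1 < \cdots < k_p < k_{p+1} := n$ be integers, set $n_{i+1} := k_{i+1}-k_i$ for $i=0,\dots,p$, let $a_1,\dots,a_{p+1}\in\mathbb{R}$ be distinct, and let $\Lambda_a:=\operatorname{diag}(a_1I_{n_1},\dots,a_{p+1}I_{n_{p+1}})$. Let $\operatorname{SO}_n(\mathbb{R})/\operatorname{S}(\operatorname{O}_{n_1}(\mathbb{R})\times\cdots\times\operatorname{O}_{n_{p+1}}(\mathbb{R}))$ and $\operatorname{Flag}_{a_1,\dots,a_{p+1}}(k_1,\dots,k_p,n)$ be equipped with the Riemannian metrics $\mathsf{g}_a$ and $\mathsf{g}'$ respectively. Then the map $$\varphi_5^{-1}:\operatorname{SO}_n(\mathbb{R})/\operatorname{S}(\operatorname{O}_{n_1}(\mathbb{R})\times\cdots\times\operatorname{O}_{n_{p+1}}(\mathbb{R}))\to\operatorname{Flag}_{a_1,\dots,a_{p+1}}(k_1,\dots,k_p,n),\qquad [\![Q]\!]\mapsto Q\Lambda_aQ^{\mathsf T},$$ is an isometric $\operatorname{SO}_n(\mathbb{R})$-equivariant diffeomorphism.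
   Context: $H:=\operatorname{S}(\operatorname{O}_{n_1}(\mathbb{R})\times\cdots\times\operatorname{O}_{n_{p+1}}(\mathbb{R}))$ is the group of block diagonal matrices $\operatorname{diag}(X_1,\dots,X_{p+1})$ with $X_i\in\operatorname{O}_{n_i}(\mathbb{R})$ and $\det(X_1)\cdots\det(X_{p+1})=1$; $[\![Q]\!]$ is the coset $QH$. The isospectral model is $\operatorname{Flag}_{a_1,\dots,a_{p+1}}(k_1,\dots,k_p,n):=\{Q\Lambda_aQ^{\mathsf T}:Q\in\operatorname{SO}_n(\mathbb{R})\}$, a submanifold of the space $\mathsf{S}^2(\mathbb{R}^n)$ of real symmetric matrices, with action $Q\cdot X:=QXQ^{\mathsf T}$; $\operatorname{SO}_n(\mathbb{R})$ acts on the quotient by left translation. Metric $\mathsf{g}'$: the restriction to the isospectral model of the Euclidean inner product $\operatorname{tr}(XY)$ on $\mathsf{S}^2(\mathbb{R}^n)$. Metric $\mathsf{g}_a$: the Lie algebra $\mathsf{\Lambda}^2(\mathbb{R}^n)$ of skew-symmetric matrices decomposes as $\mathsf{\Lambda}^2(\mathbb{R}^{n_1})\oplus\cdots\oplus\mathsf{\Lambda}^2(\mathbb{R}^{n_{p+1}})\oplus\mathfrak{m}$, where the first summands form the block diagonal Lie algebra of $H$, and $$\mathfrak{m}=\{(B_{ij})_{i,j=1}^{p+1}\in\mathbb{R}^{n\times n}:B_{ij}=-B_{ji}^{\mathsf T}\in\mathbb{R}^{n_i\times n_j},\ B_{ii}=0\}$$ is invariant under conjugation by $H$. It is identified with the tangent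 space of the quotient at $[\![I]\!]$ via $B\mapsto\frac{d}{ds}\big|_{s=0}[\![\exp(sB)]\!]$. $\mathsf{g}_a$ is the $\operatorname{SO}_n(\mathbb{R})$-invariant Riemannian metric on the quotient whose value at $[\![I]\!]$ is the $H$-invariant inner product on $\mathfrak{m}$ $$\langle B,C\rangle:=2\sum_{1\le i<j\le p+1}(a_i-a_j)^2\operatorname{tr}(B_{ij}^{\mathsf T}C_{ij}).$$ *)

theory Defs
  imports "HOL-Analysis.Analysis"
begin

section \<open>Smooth maps between subsets of Euclidean spaces\<close>

text \<open>\<^term>\<open>C_on r U f\<close> is only meaningful for open \<^term>\<open>U\<close>.\<close>

primrec C_on ::
  "nat \<Rightarrow> 'x::euclidean_space set \<Rightarrow> ('x \<Rightarrow> 'y::euclidean_space) \<Rightarrow> bool"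
where
  "C_on 0 U f \<longleftrightarrow> continuous_on U f"
| "C_on (Suc r) U f \<longleftrightarrow>
     (\<forall>x\<in>U. f differentiable (at x)) \<and> (\<forall>v. C_on r U (\<lambda>x. frechet_derivative f (at x) v))"

text \<open>On an arbitrary subset of a Euclidean space, smooth means: locally the restriction of a
  \<open>C\<^sup>\<infinity>\<close> map defined on an open set. For open sets this is the usual notion, and for relatively
  open subsets of a linear subspace it is smoothness in linear coordinates of that subspace.\<close>

definition smooth_on :: "'x::euclidean_space set \<Rightarrow> ('x \<Rightarrow> 'y::euclidean_space) \<Rightarrow> bool" where
  "smooth_on S f \<longleftrightarrow>
     (\<forall>x\<in>S. \<exists>U g. open U \<and> x \<in> U \<and> (\<forall>r. C_on r U g) \<and> (\<forall>y\<in>S \<inter> U. g y = f y))"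


section \<open>Smooth manifolds\<close>

text \<open>A chart is a pair of its domain and its coordinate map. Coordinates take values in a linear
  subspace \<open>V\<close> of a Euclidean space, so that the dimension of a manifold is \<^term>\<open>dim V\<close> and is not
  tied to a type.\<close>

type_synonym ('p, 'e) chart = "'p set \<times> ('p \<Rightarrow> 'e)"

definition atlas_topology :: "'e::euclidean_space set \<Rightarrow> ('p, 'e) chart set \<Rightarrow> 'p topology" where
  "atlas_topology V A = topology (\<lambda>W. W \<subseteq> \<Union>(fst ` A) \<and>
     (\<forall>(U, c)\<in>A. openin (top_of_set V) (c ` (W \<inter> U))))"

definition smooth_manifold ::
  "'e::euclidean_space set \<Rightarrow> 'p set \<Rightarrow> ('p, 'e) chart set \<Rightarrow> bool"
where
  "smooth_manifold V M A \<longleftrightarrow>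
     subspace V \<and> \<Union>(fst ` A) = M \<and>
     (\<forall>(U, c)\<in>A. inj_on c U \<and> openin (top_of_set V) (c ` U)) \<and>
     (\<forall>(U, c)\<in>A. \<forall>(U', c')\<in>A. openin (top_of_set V) (c ` (U \<inter> U')) \<and>
        smooth_on (c ` (U \<inter> U')) (c' \<circ> inv_into U c)) \<and>
     Hausdorff_space (atlas_topology V A) \<and> second_countable (atlas_topology V A)"

definition smooth_mapping ::
  "'p set \<Rightarrow> ('p, 'e::euclidean_space) chart set \<Rightarrow> ('q, 'f::euclidean_space) chart set \<Rightarrow>
    ('p \<Rightarrow> 'q) \<Rightarrow> bool"
where
  "smooth_mapping M A B f \<longleftrightarrow>
     (\<forall>x\<in>M. \<exists>(U, c)\<in>A. \<exists>(U', c')\<in>B. x \<in> U \<and> f ` U \<subseteq> U' \<and>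
        smooth_on (c ` U) (c' \<circ> f \<circ> inv_into U c))"

definition diffeomorphism ::
  "'p set \<Rightarrow> ('p, 'e::euclidean_space) chart set \<Rightarrow>
   'q set \<Rightarrow> ('q, 'f::euclidean_space) chart set \<Rightarrow> ('p \<Rightarrow> 'q) \<Rightarrow> bool"
where
  "diffeomorphism M A N B f \<longleftrightarrow>
     bij_betw f M N \<and> smooth_mapping M A B f \<and> smooth_mapping N B A (inv_into M f)"


section \<open>Tangent vectors and Riemannian metrics\<close>

text \<open>Tangent vectors are equivalence classes of curves, the base point being the value at 0. Only
  the germ of a curve at 0 matters.\<close>

definition smooth_curve :: "('p, 'e::euclidean_space) chart set \<Rightarrow> (real \<Rightarrow> 'p) \<Rightarrow> bool" where
  "smooth_curve A \<gamma> \<longleftrightarrow>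
     (\<exists>(U, c)\<in>A. \<exists>e>0. \<gamma> ` {-e<..<e} \<subseteq> U \<and> smooth_on {-e<..<e} (c \<circ> \<gamma>))"

definition velocity ::
  "('p, 'e::euclidean_space) chart set \<Rightarrow> (real \<Rightarrow> 'p) \<Rightarrow> (real \<Rightarrow> 'p) set"
where
  "velocity A \<gamma> = {\<delta>. smooth_curve A \<delta> \<and> \<delta> 0 = \<gamma> 0 \<and>
     (\<forall>(U, c)\<in>A. \<gamma> 0 \<in> U \<longrightarrow>
        vector_derivative (c \<circ> \<delta>) (at 0) = vector_derivative (c \<circ> \<gamma>) (at 0))}"

definition tangent_space ::
  "('p, 'e::euclidean_space) chart set \<Rightarrow> 'p \<Rightarrow> (real \<Rightarrow> 'p) set set"
where
  "tangent_space A x = {velocity A \<gamma> | \<gamma>. smooth_curve A \<gamma> \<and> \<gamma> 0 = x}"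

text \<open>The differential of \<open>f\<close>, sending the class of \<open>\<gamma>\<close> to the class of \<open>f \<circ> \<gamma>\<close>;
  for smooth \<open>f\<close> all the sets in the union coincide. The atlas is that of the target.\<close>

definition differential ::
  "('q, 'f::euclidean_space) chart set \<Rightarrow> ('p \<Rightarrow> 'q) \<Rightarrow> (real \<Rightarrow> 'p) set \<Rightarrow> (real \<Rightarrow> 'q) set"
where
  "differential B f v = (\<Union>\<gamma>\<in>v. velocity B (f \<circ> \<gamma>))"

type_synonym 'p metric_field = "'p \<Rightarrow> (real \<Rightarrow> 'p) set \<Rightarrow> (real \<Rightarrow> 'p) set \<Rightarrow> real"

text \<open>\<open>coord_metric A g (U, c) u v w\<close> is the value of \<open>g\<close>, at the point with coordinates \<open>u\<close>,
  on the coordinate tangent vectors in the directions \<open>v\<close> and \<open>w\<close>.\<close>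

definition coord_metric ::
  "('p, 'e::euclidean_space) chart set \<Rightarrow> 'p metric_field \<Rightarrow> ('p, 'e) chart \<Rightarrow>
     'e \<Rightarrow> 'e \<Rightarrow> 'e \<Rightarrow> real"
where
  "coord_metric A g = (\<lambda>(U, c) u v w.
     g (inv_into U c u) (velocity A (\<lambda>s. inv_into U c (u + s *\<^sub>R v)))
                        (velocity A (\<lambda>s. inv_into U c (u + s *\<^sub>R w))))"

definition riemannian_metric ::
  "'e::euclidean_space set \<Rightarrow> ('p, 'e) chart set \<Rightarrow> 'p metric_field \<Rightarrow> bool"
where
  "riemannian_metric V A g \<longleftrightarrow> (\<forall>(U, c)\<in>A. let G = coord_metric A g (U, c) in
     (\<forall>u\<in>c ` U. \<forall>v\<in>V. \<forall>w\<in>V.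
        G u v w = G u w v \<and>
        (\<forall>v'\<in>V. \<forall>r. G u (r *\<^sub>R v + v') w = r * G u v w + G u v' w) \<and>
        (v \<noteq> 0 \<longrightarrow> G u v v > 0)) \<and>
     (\<forall>v\<in>V. \<forall>w\<in>V. smooth_on (c ` U) (\<lambda>u. G u v w)))"

definition riemannian_manifold ::
  "'e::euclidean_space set \<Rightarrow> 'p set \<Rightarrow> ('p, 'e) chart set \<Rightarrow> 'p metric_field \<Rightarrow> bool"
where
  "riemannian_manifold V M A g \<longleftrightarrow> smooth_manifold V M A \<and> riemannian_metric V A g"

definition isometric ::
  "'p set \<Rightarrow> ('p, 'e::euclidean_space) chart set \<Rightarrow> 'p metric_field \<Rightarrow>
   ('q, 'f::euclidean_space) chart set \<Rightarrow> 'q metric_field \<Rightarrow> ('p \<Rightarrow> 'q) \<Rightarrow> bool"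
where
  "isometric M A g B h f \<longleftrightarrow>
     (\<forall>x\<in>M. \<forall>v\<in>tangent_space A x. \<forall>w\<in>tangent_space A x.
        h (f x) (differential B f v) (differential B f w) = g x v w)"

text \<open>The charts of a subset of a Euclidean space: all diffeomorphisms from relatively open subsets
  onto relatively open subsets of \<open>V\<close>. The subset is an embedded submanifold of dimension
  \<^term>\<open>dim V\<close> iff these charts cover it.\<close>

definition submanifold_atlas ::
  "'e::euclidean_space set \<Rightarrow> 'x::euclidean_space set \<Rightarrow> ('x, 'e) chart set"
where
  "submanifold_atlas V S = {(U, c).
     openin (top_of_set S) U \<and> openin (top_of_set V) (c ` U) \<and> inj_on c U \<and>
     smooth_on U c \<and> smooth_on (c ` U) (inv_into U c)}"


section \<open>Block matrices\<close>

type_synonym 'n sqmat = "real^'n^'n"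

text \<open>The index type \<open>'n\<close> is linearly ordered, and the 0-based position of \<open>r\<close> is
  \<^term>\<open>card {..<r}\<close>. The \<open>i\<close>-th block (with \<open>i\<close> starting from 1) consists of the positions
  \<open>k\<^sub>i\<^sub>-\<^sub>1, \<dots>, k\<^sub>i - 1\<close>.\<close>

definition block :: "(nat \<Rightarrow> nat) \<Rightarrow> nat \<Rightarrow> 'n::{finite,linorder} set" where
  "block k i = {r. k (i - 1) \<le> card {..<r} \<and> card {..<r} < k i}"

text \<open>The block \<open>B\<^sub>i\<^sub>j\<close>, padded by zeros to an \<open>n \<times> n\<close> matrix. Padding is compatible with
  transposes, products and traces of blocks.\<close>

definition block_part ::
  "(nat \<Rightarrow> nat) \<Rightarrow> nat \<Rightarrow> nat \<Rightarrow> 'n::{finite,linorder} sqmat \<Rightarrow> 'n sqmat"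
where
  "block_part k i j B = (\<chi> r s. if r \<in> block k i \<and> s \<in> block k j then B $ r $ s else 0)"

text \<open>The determinant of the diagonal block \<open>X\<^sub>i\<^sub>i\<close>, computed after completing this block by an
  identity matrix to an \<open>n \<times> n\<close> matrix.\<close>

definition block_det :: "(nat \<Rightarrow> nat) \<Rightarrow> nat \<Rightarrow> 'n::{finite,linorder} sqmat \<Rightarrow> real" where
  "block_det k i X = det (block_part k i i X + (mat 1 - block_part k i i (mat 1)))"

definition matrix_exp :: "'n::finite sqmat \<Rightarrow> 'n sqmat" where
  "matrix_exp B = (\<Sum>m. (1 / fact m) *\<^sub>R (((**) B ^^ m) (mat 1)))"


section \<open>The homogeneous space\<close>

definition SO :: "'n::finite sqmat set" where
  "SO = {Q. rotation_matrix Q}"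

definition SO_blocks :: "nat \<Rightarrow> (nat \<Rightarrow> nat) \<Rightarrow> 'n::{finite,linorder} sqmat set" where
  "SO_blocks p k = {X.
     (\<forall>i\<in>{1..p+1}. \<forall>j\<in>{1..p+1}. i \<noteq> j \<longrightarrow> block_part k i j X = 0) \<and>
     (\<forall>i\<in>{1..p+1}. transpose (block_part k i i X) ** block_part k i i X
                       = block_part k i i (mat 1)) \<and>
     (\<Prod>i\<in>{1..p+1}. block_det k i X) = 1}"

definition flag_coset ::
  "nat \<Rightarrow> (nat \<Rightarrow> nat) \<Rightarrow> 'n::{finite,linorder} sqmat \<Rightarrow> 'n sqmat set"
where
  "flag_coset p k Q = (**) Q ` SO_blocks p k"

definition flag_quotient ::
  "nat \<Rightarrow> (nat \<Rightarrow> nat) \<Rightarrow> 'n::{finite,linorder} sqmat set set"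
where
  "flag_quotient p k = flag_coset p k ` SO"

definition flag_m :: "nat \<Rightarrow> (nat \<Rightarrow> nat) \<Rightarrow> 'n::{finite,linorder} sqmat set" where
  "flag_m p k = {B. transpose B = - B \<and> (\<forall>i\<in>{1..p+1}. block_part k i i B = 0)}"

text \<open>The maximal atlas of the unique smooth structure on the quotient for which the projection
  from \<^term>\<open>SO\<close> is smooth and has smooth local sections (equivalently, is a submersion).
  The preimage of a set \<open>U\<close> of cosets under the projection is \<open>\<Union>U\<close>.\<close>

definition flag_quotient_atlas ::
  "nat \<Rightarrow> (nat \<Rightarrow> nat) \<Rightarrow>
     ('n::{finite,linorder} sqmat set, 'n::{finite,linorder} sqmat) chart set"
where
  "flag_quotient_atlas p k = {(U, c).
     U \<subseteq> flag_quotient p k \<and> openin (top_of_set SO) (\<Union>U) \<and>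
     inj_on c U \<and> openin (top_of_set (flag_m p k)) (c ` U) \<and>
     smooth_on (\<Union>U) (\<lambda>Q. c (flag_coset p k Q)) \<and>
     (\<forall>x\<in>U. \<exists>W \<sigma>. openin (top_of_set (flag_m p k)) W \<and> c x \<in> W \<and> W \<subseteq> c ` U \<and>
        smooth_on W \<sigma> \<and> (\<forall>w\<in>W. \<sigma> w \<in> \<Union>U \<and> c (flag_coset p k (\<sigma> w)) = w))}"

definition flag_m_inner ::
  "nat \<Rightarrow> (nat \<Rightarrow> nat) \<Rightarrow> (nat \<Rightarrow> real) \<Rightarrow>
     'n::{finite,linorder} sqmat \<Rightarrow> 'n sqmat \<Rightarrow> real"
where
  "flag_m_inner p k a B C =
     2 * (\<Sum>j\<in>{1..p+1}. \<Sum>i\<in>{1..<j}.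
            (a i - a j)^2 * trace (transpose (block_part k i j B) ** block_part k i j C))"

text \<open>The two last conditions characterise an invariant metric only on the tangent spaces of the
  quotient; the normalisation to 0 elsewhere makes the description definite.\<close>

definition flag_quotient_metric ::
  "nat \<Rightarrow> (nat \<Rightarrow> nat) \<Rightarrow> (nat \<Rightarrow> real) \<Rightarrow> 'n::{finite,linorder} sqmat set metric_field"
where
  "flag_quotient_metric p k a = (THE g.
     (let M = flag_quotient p k; A = flag_quotient_atlas p k; T = tangent_space A in
       (\<forall>x v w. \<not> (x \<in> M \<and> v \<in> T x \<and> w \<in> T x) \<longrightarrow> g x v w = 0) \<and>
       riemannian_metric (flag_m p k) A g \<and>
       (\<forall>Q\<in>SO. isometric M A g A g ((`) ((**) Q))) \<and>
       (\<forall>B\<in>flag_m p k. \<forall>C\<in>flag_m p k.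
          g (flag_coset p k (mat 1))
            (velocity A (\<lambda>s. flag_coset p k (matrix_exp (s *\<^sub>R B))))
            (velocity A (\<lambda>s. flag_coset p k (matrix_exp (s *\<^sub>R C))))
          = flag_m_inner p k a B C)))"


section \<open>The isospectral model\<close>

definition flag_Lambda ::
  "nat \<Rightarrow> (nat \<Rightarrow> nat) \<Rightarrow> (nat \<Rightarrow> real) \<Rightarrow> 'n::{finite,linorder} sqmat"
where
  "flag_Lambda p k a = (\<Sum>i\<in>{1..p+1}. a i *\<^sub>R block_part k i i (mat 1))"

definition isospectral_flag ::
  "nat \<Rightarrow> (nat \<Rightarrow> nat) \<Rightarrow> (nat \<Rightarrow> real) \<Rightarrow> 'n::{finite,linorder} sqmat set"
where
  "isospectral_flag p k a = {Q ** flag_Lambda p k a ** transpose Q | Q. Q \<in> SO}"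

text \<open>\<^term>\<open>flag_m p k\<close> serves here merely as a vector space of the right dimension.\<close>

definition isospectral_atlas ::
  "nat \<Rightarrow> (nat \<Rightarrow> nat) \<Rightarrow> (nat \<Rightarrow> real) \<Rightarrow>
     ('n::{finite,linorder} sqmat, 'n::{finite,linorder} sqmat) chart set"
where
  "isospectral_atlas p k a = submanifold_atlas (flag_m p k) (isospectral_flag p k a)"

text \<open>The restriction of \<open>tr(XY)\<close>, where the class of \<open>\<gamma>\<close> is identified with the ambient
  derivative of \<open>\<gamma>\<close> at 0.\<close>

definition isospectral_metric :: "'n::finite sqmat metric_field" where
  "isospectral_metric x v w = (THE r. \<exists>\<gamma>\<in>v. \<exists>\<delta>\<in>w.
     r = trace (vector_derivative \<gamma> (at 0) ** vector_derivative \<delta> (at 0)))"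

definition flag_map ::
  "nat \<Rightarrow> (nat \<Rightarrow> nat) \<Rightarrow> (nat \<Rightarrow> real) \<Rightarrow>
     'n::{finite,linorder} sqmat set \<Rightarrow> 'n sqmat"
where
  "flag_map p k a x = (THE X. \<exists>Q\<in>SO. x = flag_coset p k Q \<and>
     X = Q ** flag_Lambda p k a ** transpose Q)"

end

theory Submission
  imports Defs
begin

text \<open>Write \<open>\<Lambda>\<close> for the diagonal matrix with the given eigenvalues. A rotation commutes with \<open>\<Lambda>\<close> iff it is
  block diagonal, so the cosets \<open>QH\<close> are exactly the fibres of \<open>Q \<mapsto> Q \<Lambda> Q\<^sup>T\<close> and the quotient
  is in bijection with the orbit of \<open>\<Lambda>\<close>. The bijection is equivariant by construction, and the
  theorem says that smooth structures and metrics correspond under it.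

  The analytic core is a slice for the conjugation action at \<open>\<Lambda>\<close>
  (\<open>orbit_chart_with_section_at_Lam\<close>). The differential of the orbit map at the identity is
  \<open>B \<mapsto> [B, \<Lambda>]\<close>, which maps the skew-symmetric matrices with zero diagonal blocks isomorphically
  onto the symmetric ones with zero diagonal blocks, because the eigenvalues of distinct blocks
  differ. Hence \<open>(B, D) \<mapsto> R(B) (\<Lambda> + D) R(B)\<^sup>T\<close>, with \<open>R\<close> the Cayley transform and \<open>D\<close> in a
  complement, is a local diffeomorphism of the space of all matrices
  (\<open>smooth_inverse_function\<close>). A point of the orbit near \<open>\<Lambda>\<close> has \<open>D = 0\<close>: \<open>\<Lambda> + D\<close> is then symmetric
  and block diagonal with the spectrum of \<open>\<Lambda>\<close>, and a small block diagonal perturbation other than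
  \<open>0\<close> changes the spectrum (\<open>block_perturbation_in_orbit_eq_0\<close>). So \<open>B\<close> is a chart of the orbit, and \<open>R(B)\<close> is at the
  same time a smooth local section of the orbit map. By conjugation both exist at every point.

  Local sections make the charts of the quotient, which are defined by smoothness upstairs, the
  same as the charts of the orbit as a submanifold (\<open>atlas_iso_flag_map\<close>). All statements about
  manifolds can then be proved on the orbit and transported: the manifold axioms come from the
  ambient space, and the trace form is definite on symmetric matrices.

  It remains to see that the metric on the quotient is the pullback of the trace metric
  (\<open>flag_quotient_metric_eq\<close>). The pullback is invariant, since conjugation by rotations preserves
  traces, and at the base point it is \<open>tr([B, \<Lambda>] [C, \<Lambda>])\<close>, which is the prescribed inner product
  (\<open>flag_m_inner_eq\<close>). An invariant metric is determined by its values at the base point, where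
  every tangent vector is the velocity of a one-parameter group: a curve in the orbit lifts to
  rotations through a local section, and the diagonal blocks of the velocity of the lift do not
  contribute (\<open>tangent_space_base\<close>).\<close>

section \<open>Calculus of smooth maps\<close>

lemma C_on_cong:
  assumes "open U" "\<And>x. x \<in> U \<Longrightarrow> f x = g x"
  shows "C_on r U f \<longleftrightarrow> C_on r U g"
  using assms(2)
proof (induction r arbitrary: f g)
  case 0
  then show ?case by (simp cong: continuous_on_cong)
next
  case (Suc r)
  have ev: "\<forall>\<^sub>F y in nhds x. f y = g y" if "x \<in> U" for x
    using that Suc.prems assms(1) eventually_nhds by blast
  have D: "(f has_derivative D) (at x) \<longleftrightarrow> (g has_derivative D) (at x)" if "x \<in> U" for x D
    using has_derivative_transform_within_open[OF _ assms(1) that, of f D UNIV g]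
      has_derivative_transform_within_open[OF _ assms(1) that, of g D UNIV f] Suc.prems by auto
  have "frechet_derivative f (at x) v = frechet_derivative g (at x) v" if "x \<in> U" for x v
    by (simp add: frechet_derivative_def D[OF that])
  then have "C_on r U (\<lambda>x. frechet_derivative f (at x) v)
      = C_on r U (\<lambda>x. frechet_derivative g (at x) v)" for v
    by (intro Suc.IH) auto
  then show ?case
    using D by (auto simp: differentiable_def)
qed

lemma C_on_subset: "C_on r U f \<Longrightarrow> U' \<subseteq> U \<Longrightarrow> C_on r U' f"
  by (induction r arbitrary: f) (auto intro: continuous_on_subset)

lemma C_on_imp_continuous: "C_on r U f \<Longrightarrow> continuous_on U f"
  by (cases r) (simp_all add: continuous_at_imp_continuous_on differentiable_imp_continuous_within)

lemma C_on_Suc_imp: "C_on (Suc r) U f \<Longrightarrow> C_on r U f"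
proof (induction r arbitrary: f)
  case 0
  then show ?case using C_on_imp_continuous[OF 0] by simp
next
  case (Suc r)
  then show ?case by (metis C_on.simps(2))
qed

text \<open>Any explicit formula for the derivative may replace the Frechet derivative of the recursive
  definition, since both agree on the open set.\<close>

lemma C_on_SucI:
  assumes "open U" "\<And>x. x \<in> U \<Longrightarrow> (f has_derivative f' x) (at x)"
    and "\<And>v. C_on r U (\<lambda>x. f' x v)"
  shows "C_on (Suc r) U f"
proof -
  have "frechet_derivative f (at x) = f' x" if "x \<in> U" for x
    using assms(2)[OF that] frechet_derivative_at by metis
  then have "C_on r U (\<lambda>x. frechet_derivative f (at x) v)" for v
    using C_on_cong[OF assms(1), of "\<lambda>x. frechet_derivative f (at x) v" "\<lambda>x. f' x v"] assms(3)
    by simp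
  then show ?thesis using assms(2) by (auto simp: differentiable_def)
qed

lemma C_on_Suc_derivative:
  assumes "C_on (Suc r) U f" "x \<in> U"
  shows "(f has_derivative frechet_derivative f (at x)) (at x)"
  using assms by (simp add: frechet_derivative_works)

lemma C_on_const: "C_on r U (\<lambda>x. c)"
  by (induction r arbitrary: c) auto

lemma C_on_linear: "linear f \<Longrightarrow> C_on r U f"
proof (cases r)
  case (Suc n)
  assume "linear f"
  then have "(f has_derivative f) (at x)" for x
    by (simp add: linear_imp_has_derivative)
  then have "frechet_derivative f (at x) = f" for x
    using frechet_derivative_at by metis
  then show ?thesis using \<open>linear f\<close>
    by (simp add: Suc C_on_const linear_imp_differentiable)
qed (simp add: linear_continuous_on linear_conv_bounded_linear)

lemma C_on_id: "C_on r U (\<lambda>x. x)"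
  by (rule C_on_linear) (simp add: linear_iff)

lemma C_on_add:
  assumes "open U" "C_on r U f" "C_on r U g"
  shows "C_on r U (\<lambda>x. f x + g x)"
  using assms(2,3)
proof (induction r arbitrary: f g)
  case (Suc r)
  have "C_on r U (\<lambda>x. frechet_derivative f (at x) v + frechet_derivative g (at x) v)" for v
    using Suc by simp
  then show ?case
    by (intro C_on_SucI[OF assms(1)
          has_derivative_add[OF C_on_Suc_derivative[OF Suc.prems(1)]
            C_on_Suc_derivative[OF Suc.prems(2)]]])
qed (auto intro: continuous_on_add)

lemma C_on_bilinear:
  assumes "open U" "bounded_bilinear h" "C_on r U f" "C_on r U g"
  shows "C_on r U (\<lambda>x. h (f x) (g x))"
  using assms(3,4)
proof (induction r arbitrary: f g)
  case 0
  then show ?case using bounded_bilinear.continuous_on[OF assms(2)] by auto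
next
  case (Suc r)
  have fg: "C_on r U f" "C_on r U g" using Suc.prems C_on_Suc_imp by blast+
  have "C_on r U (\<lambda>x. h (f x) (frechet_derivative g (at x) v)
      + h (frechet_derivative f (at x) v) (g x))" for v
    by (intro C_on_add[OF assms(1)] Suc.IH fg; use Suc.prems in simp)
  then show ?case
    by (intro C_on_SucI[OF assms(1)
          bounded_bilinear.FDERIV[OF assms(2) C_on_Suc_derivative[OF Suc.prems(1)]
            C_on_Suc_derivative[OF Suc.prems(2)]]])
qed

lemma C_on_sum:
  assumes "open U" "\<And>i. i \<in> I \<Longrightarrow> C_on r U (f i)"
  shows "C_on r U (\<lambda>x. \<Sum>i\<in>I. f i x)"
  using assms(2)
  by (induction I rule: infinite_finite_induct) (auto intro: C_on_add[OF assms(1)] C_on_const)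

lemma C_on_prod:
  fixes f :: "'i \<Rightarrow> 'x::euclidean_space \<Rightarrow> real"
  assumes "open U" "\<And>i. i \<in> I \<Longrightarrow> C_on r U (f i)"
  shows "C_on r U (\<lambda>x. \<Prod>i\<in>I. f i x)"
  using assms(2)
  by (induction I rule: infinite_finite_induct)
    (auto intro: C_on_bilinear[OF assms(1) bounded_bilinear_mult] C_on_const)

text \<open>The chain rule applies a derivative that varies with the point to a vector that varies with the
  point. Expanding the vector in a basis turns this into a sum of products, each of which is
  covered by the induction hypothesis.\<close>

lemma C_on_compose:
  fixes f :: "'x::euclidean_space \<Rightarrow> 'y::euclidean_space" and g :: "'y \<Rightarrow> 'z::euclidean_space"
  assumes "open U" "open V" "f ` U \<subseteq> V" "C_on r U f" "C_on r V g"
  shows "C_on r U (\<lambda>x. g (f x))"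
  using assms(4,5)
proof (induction r arbitrary: g)
  case 0
  then show ?case using assms(3) by (auto intro: continuous_on_compose2)
next
  case (Suc r)
  let ?f' = "\<lambda>x. frechet_derivative f (at x)" and ?g' = "\<lambda>y. frechet_derivative g (at y)"
  have f: "C_on r U f" using Suc.prems C_on_Suc_imp by blast
  have lin: "linear (?g' y)" if "y \<in> V" for y
    using C_on_Suc_derivative[OF Suc.prems(2) that] has_derivative_linear by blast
  have fV: "f x \<in> V" if "x \<in> U" for x using assms(3) that by auto
  have "C_on r U (\<lambda>x. ?g' (f x) b)" for b
    using Suc.prems(2) by (intro Suc.IH[OF f]) auto
  then have "C_on r U (\<lambda>x. \<Sum>b\<in>Basis. (?f' x v \<bullet> b) *\<^sub>R ?g' (f x) b)" for v
    using Suc.prems(1)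
    by (intro C_on_sum C_on_bilinear[OF assms(1) bounded_bilinear_scaleR]
        C_on_bilinear[OF assms(1) bounded_bilinear_inner] C_on_const assms(1)) auto
  moreover have "(\<Sum>b\<in>Basis. (?f' x v \<bullet> b) *\<^sub>R ?g' (f x) b) = (?g' (f x) \<circ> ?f' x) v" if "x \<in> U" for x v
    using linear_sum[OF lin[OF fV[OF that]]] linear_cmul[OF lin[OF fV[OF that]]]
    by (metis (no_types, lifting) comp_apply euclidean_representation sum.cong)
  ultimately have "C_on r U (\<lambda>x. (?g' (f x) \<circ> ?f' x) v)" for v
    using C_on_cong[OF assms(1), of "\<lambda>x. \<Sum>b\<in>Basis. (?f' x v \<bullet> b) *\<^sub>R ?g' (f x) b"
        "\<lambda>x. (?g' (f x) \<circ> ?f' x) v" for v] by blast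
  then have "C_on (Suc r) U (g \<circ> f)"
    by (intro C_on_SucI[OF assms(1)
          diff_chain_at[OF C_on_Suc_derivative[OF Suc.prems(1)]
            C_on_Suc_derivative[OF Suc.prems(2) fV]]])
  then show ?case by (simp add: o_def del: C_on.simps)
qed

lemma C_on_linear_compose:
  assumes "open U" "linear L" "C_on r U f"
  shows "C_on r U (\<lambda>x. L (f x))"
  using C_on_compose[OF assms(1) open_UNIV _ assms(3) C_on_linear[OF assms(2)]] by auto

lemma C_on_inverse:
  fixes f :: "'x::euclidean_space \<Rightarrow> real"
  assumes "open U" "C_on r U f" "\<And>x. x \<in> U \<Longrightarrow> f x \<noteq> 0"
  shows "C_on r U (\<lambda>x. inverse (f x))"
proof -
  have "C_on r (- {0::real}) inverse"
  proof (induction r)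
    case 0
    show ?case by (auto intro!: continuous_on_inverse)
  next
    case (Suc r)
    have o: "open (- {0::real})" by auto
    show ?case
      by (rule C_on_SucI[OF o has_derivative_inverse'])
        (auto intro!: C_on_bilinear[OF o bounded_bilinear_mult] C_on_const Suc
          C_on_linear_compose[OF o linear_uminus])
  qed
  then show ?thesis
    by (intro C_on_compose[OF assms(1) _ _ assms(2)]) (use assms in auto)
qed

lemma C_on_vec:
  fixes f :: "'x::euclidean_space \<Rightarrow> 'y::euclidean_space ^ 'm"
  assumes "open U" "\<And>i. C_on r U (\<lambda>x. f x $ i)"
  shows "C_on r U f"
proof -
  have "C_on r U (\<lambda>x. \<Sum>i\<in>UNIV. axis i (f x $ i))"
    by (intro C_on_sum assms(1), rule C_on_linear_compose[where L="axis _", OF assms(1) _ assms(2)])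
      (simp add: linear_iff axis_def vec_eq_iff)
  moreover have "(\<Sum>i\<in>UNIV. axis i (f x $ i)) = f x" for x
    by (simp add: vec_eq_iff axis_def if_distrib cong: if_cong)
  ultimately show ?thesis by simp
qed

lemma C_on_nth:
  fixes f :: "'x::euclidean_space \<Rightarrow> 'y::euclidean_space ^ 'm"
  assumes "open U" "C_on r U f"
  shows "C_on r U (\<lambda>x. f x $ i)"
  using C_on_linear_compose[OF assms(1) _ assms(2), of "\<lambda>v. v $ i"] by (simp add: linear_iff)

lemma C_on_det:
  fixes A :: "'x::euclidean_space \<Rightarrow> real^'m^'m"
  assumes "open U" "\<And>i j. C_on r U (\<lambda>x. A x $ i $ j)"
  shows "C_on r U (\<lambda>x. det (A x))"
  unfolding det_def
  by (intro C_on_sum C_on_bilinear[OF assms(1) bounded_bilinear_mult] C_on_const C_on_prod assms)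

text \<open>Cramer's rule writes the solution of a linear system as a quotient of determinants, so it
  depends on the coefficients as smoothly as they vary.\<close>

lemma C_on_cramer:
  fixes A :: "'x::euclidean_space \<Rightarrow> real^'m^'m" and b w :: "'x \<Rightarrow> real^'m"
  assumes "open U" "\<And>i j. C_on r U (\<lambda>x. A x $ i $ j)" "\<And>i. C_on r U (\<lambda>x. b x $ i)"
    and "\<And>x. x \<in> U \<Longrightarrow> det (A x) \<noteq> 0" "\<And>x. x \<in> U \<Longrightarrow> A x *v w x = b x"
  shows "C_on r U w"
proof -
  let ?N = "\<lambda>k x. det (\<chi> i j. if j = k then b x $ i else A x $ i $ j)"
  have "C_on r U (\<lambda>x. (\<chi> i j. if j = k then b x $ i else A x $ i $ j) $ i $ j)" for i j k
    using assms(2,3) by (cases "j = k") simp_all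
  then have "C_on r U (?N k)" for k by (rule C_on_det[OF assms(1)])
  then have "C_on r U (\<lambda>x. ?N k x * inverse (det (A x)))" for k
    by (rule C_on_bilinear[OF assms(1) bounded_bilinear_mult])
      (rule C_on_inverse[OF assms(1) C_on_det[OF assms(1,2)] assms(4)])
  then have "C_on r U (\<lambda>x. \<chi> k. ?N k x * inverse (det (A x)))"
    by (intro C_on_vec[OF assms(1)]) simp
  moreover have *: "(\<chi> k. ?N k x * inverse (det (A x))) = w x" if "x \<in> U" for x
    using cramer[OF assms(4)[OF that], of "w x" "b x"] assms(5)[OF that]
    by (simp add: vec_eq_iff divide_inverse)
  ultimately show ?thesis using C_on_cong[of U _ w r, OF assms(1) *] by blast
qed

text \<open>The coordinates \<open>J\<close> only serve to turn operators into matrices.\<close>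

lemma C_on_linear_inverse:
  fixes A :: "'x::euclidean_space \<Rightarrow> 'a::euclidean_space \<Rightarrow> 'a" and J :: "'a \<Rightarrow> real^'m"
  assumes U: "open U" and J: "linear J" "linear J'" "\<And>v. J' (J v) = v" "\<And>z. J (J' z) = z"
    and A: "\<And>v. C_on r U (\<lambda>x. A x v)" "\<And>x. x \<in> U \<Longrightarrow> linear (A x)" "\<And>x. x \<in> U \<Longrightarrow> bij (A x)"
  shows "C_on r U (\<lambda>x. inv (A x) v)"
proof -
  let ?M = "\<lambda>x. matrix (J \<circ> A x \<circ> J')"
  have lin: "linear (J \<circ> A x \<circ> J')" if "x \<in> U" for x
    using J A(2)[OF that] linear_compose by metis
  have M: "?M x *v J (inv (A x) v) = J v" if "x \<in> U" for x
    using fun_cong[OF matrix_vector_mul(2)[OF lin[OF that]], of "J (inv (A x) v)"] A(3)[OF that]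
    by (simp add: J bij_is_surj surj_f_inv_f)
  have "inj (J \<circ> A x \<circ> J')" if "x \<in> U" for x
    using A(3)[OF that] J(3,4) by (intro inj_compose) (auto intro: bij_is_inj inj_on_inverseI)
  then have det: "det (?M x) \<noteq> 0" if "x \<in> U" for x
    using that lin det_nz_iff_inj by blast
  have "C_on r U (\<lambda>x. ?M x $ i $ j)" for i j
    using C_on_nth[OF U C_on_linear_compose[OF U J(1) A(1)[of "J' (axis j 1)"]], of i]
    by (simp add: matrix_def)
  then have "C_on r U (\<lambda>x. J (inv (A x) v))"
    by (rule C_on_cramer[OF U _ C_on_const det M])
  from C_on_linear_compose[OF U J(2) this] show ?thesis by (simp add: J)
qed

text \<open>The inverse of a continuously differentiable local bijection has derivative
  \<open>(D f (g y))\<^sup>-\<^sup>1\<close>, so each order of smoothness of \<open>g\<close> yields the next one.\<close>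

theorem smooth_inverse_function:
  fixes f :: "'a::euclidean_space \<Rightarrow> 'a" and J :: "'a \<Rightarrow> real^'m"
  assumes U: "open U" "x0 \<in> U" and f: "\<And>r. C_on r U f"
    and D: "(f has_derivative (\<lambda>v. v)) (at x0)"
    and J: "linear J" "linear J'" "\<And>v. J' (J v) = v" "\<And>z. J (J' z) = z"
  obtains U' V g where "open U'" "U' \<subseteq> U" "x0 \<in> U'" "open V" "f x0 \<in> V" "homeomorphism U' V f g"
    "\<And>r. C_on r V g"
proof -
  let ?f' = "\<lambda>x. Blinfun (frechet_derivative f (at x))"
  have der: "(f has_derivative frechet_derivative f (at x)) (at x)" if "x \<in> U" for x
    using C_on_Suc_derivative f that by blast
  then have bl: "blinfun_apply (?f' x) = frechet_derivative f (at x)" if "x \<in> U" for x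
    using that by (intro bounded_linear_Blinfun_apply) (rule has_derivative_bounded_linear)
  have "continuous_on U (\<lambda>x. frechet_derivative f (at x) v)" for v
    using f[of "Suc 0"] by simp
  then have cont: "continuous_on U ?f'"
    by (intro continuous_on_blinfun_componentwise) (simp add: bl cong: continuous_on_cong)
  have "frechet_derivative f (at x0) = (\<lambda>v. v)" using D frechet_derivative_at by metis
  then have id: "id_blinfun o\<^sub>L ?f' x0 = id_blinfun"
    using bl[OF U(2)] by (intro blinfun_eqI) simp
  obtain U' V g g' where *: "open U'" "U' \<subseteq> U" "x0 \<in> U'" "open V" "f x0 \<in> V"
    "homeomorphism U' V f g" and g: "\<And>y. y \<in> V \<Longrightarrow> (g has_derivative (g' y)) (at y)"
    "\<And>y. y \<in> V \<Longrightarrow> g' y = inv (blinfun_apply (?f'(g y)))"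
    "\<And>y. y \<in> V \<Longrightarrow> bij (blinfun_apply (?f'(g y)))"
    using inverse_function_theorem[OF U(1) _ cont U(2) id] der bl by (metis (no_types, lifting))
  have gV: "g ` V \<subseteq> U" using * by (auto simp: homeomorphism_def)
  then have gU: "g y \<in> U" if "y \<in> V" for y using that by blast
  have "C_on r V g" for r
  proof (induction r)
    case 0
    show ?case using *(6) by (simp add: homeomorphism_def)
  next
    case (Suc r)
    have "C_on r U (\<lambda>x. frechet_derivative f (at x) v)" for v using f[of "Suc r"] by simp
    then have "C_on r V (\<lambda>y. frechet_derivative f (at (g y)) v)" for v
      by (rule C_on_compose[OF *(4) U(1) gV Suc])
    then have "C_on r V (\<lambda>y. inv (frechet_derivative f (at (g y))) v)" for v
      by (rule C_on_linear_inverse[OF *(4) J])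
        (use g(3) bl has_derivative_linear[OF der] gU in \<open>simp_all\<close>)
    then have "C_on r V (\<lambda>y. g' y v)" for v
      using C_on_cong[OF *(4), of "\<lambda>y. g' y v" "\<lambda>y. inv (frechet_derivative f (at (g y))) v" r]
        g(2) bl gU by simp
    then show ?case by (intro C_on_SucI[OF *(4) g(1)])
  qed
  then show thesis using that * by blast
qed

lemma smooth_onE:
  assumes "smooth_on S f" "x \<in> S"
  obtains U g where "open U" "x \<in> U" "\<And>r. C_on r U g" "\<And>y. y \<in> S \<Longrightarrow> y \<in> U \<Longrightarrow> g y = f y"
proof -
  from bspec[OF assms(1)[unfolded smooth_on_def] assms(2)]
  obtain U g where "open U \<and> x \<in> U \<and> (\<forall>r. C_on r U g) \<and> (\<forall>y\<in>S \<inter> U. g y = f y)"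
    by (elim exE)
  then show thesis by (intro that[of U g]) auto
qed

lemma smooth_onI:
  assumes "\<And>x. x \<in> S \<Longrightarrow> \<exists>U g. open U \<and> x \<in> U \<and> (\<forall>r. C_on r U g) \<and> (\<forall>y\<in>S \<inter> U. g y = f y)"
  shows "smooth_on S f"
  unfolding smooth_on_def using assms by (rule ballI)

lemma C_on_imp_smooth_on: "open U \<Longrightarrow> S \<subseteq> U \<Longrightarrow> (\<And>r. C_on r U f) \<Longrightarrow> smooth_on S f"
  by (rule smooth_onI) blast

lemma smooth_on_linear: "linear f \<Longrightarrow> smooth_on S f"
  using C_on_imp_smooth_on[of UNIV] C_on_linear by blast

lemma smooth_on_cong: "(\<And>x. x \<in> S \<Longrightarrow> f x = g x) \<Longrightarrow> smooth_on S f \<longleftrightarrow> smooth_on S g"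
  unfolding smooth_on_def by simp

lemma smooth_on_subset: "smooth_on S f \<Longrightarrow> T \<subseteq> S \<Longrightarrow> smooth_on T f"
proof (rule smooth_onI)
  fix x assume S: "smooth_on S f" "T \<subseteq> S" "x \<in> T"
  then have "x \<in> S" by blast
  then obtain U g where "open U" "x \<in> U" "\<And>r. C_on r U g" "\<And>y. y \<in> S \<Longrightarrow> y \<in> U \<Longrightarrow> g y = f y"
    using smooth_onE[OF S(1)] by metis
  then show "\<exists>U g. open U \<and> x \<in> U \<and> (\<forall>r. C_on r U g) \<and> (\<forall>y\<in>T \<inter> U. g y = f y)"
    using S(2) by (intro exI[of _ U] exI[of _ g]) auto
qed

lemma smooth_on_local:
  assumes "\<And>x. x \<in> S \<Longrightarrow> \<exists>U. openin (top_of_set S) U \<and> x \<in> U \<and> smooth_on U f"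
  shows "smooth_on S f"
proof (rule smooth_onI)
  fix x assume x: "x \<in> S"
  then obtain T where T: "open T" "x \<in> T" "smooth_on (S \<inter> T) f"
    using assms[OF x] unfolding openin_open by blast
  obtain U g where "open U" "x \<in> U" "\<And>r. C_on r U g" "\<And>y. y \<in> S \<inter> T \<Longrightarrow> y \<in> U \<Longrightarrow> g y = f y"
    using smooth_onE[OF T(3), of x] x T by auto
  then show "\<exists>U g. open U \<and> x \<in> U \<and> (\<forall>r. C_on r U g) \<and> (\<forall>y\<in>S \<inter> U. g y = f y)"
    using T by (intro exI[of _ "U \<inter> T"] exI[of _ g]) (auto intro: C_on_subset)
qed

lemma smooth_on_imp_continuous: "smooth_on S f \<Longrightarrow> continuous_on S f"
proof (rule continuous_on_eq_continuous_within[THEN iffD2], rule)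
  fix x assume "smooth_on S f" "x \<in> S"
  then obtain U g where U: "open U" "x \<in> U" "\<And>r. C_on r U g"
    "\<And>y. y \<in> S \<Longrightarrow> y \<in> U \<Longrightarrow> g y = f y" using smooth_onE by metis
  then have "continuous (at x within S) g"
    using C_on_imp_continuous[OF U(3)] continuous_on_eq_continuous_at continuous_at_imp_continuous_at_within
    by blast
  then show "continuous (at x within S) f"
    by (rule continuous_transform_within_openin[of x S g "S \<inter> U" f])
      (use U \<open>x \<in> S\<close> in \<open>auto simp: openin_open\<close>)
qed

lemma smooth_on_compose:
  assumes "smooth_on S f" "smooth_on T g" "f ` S \<subseteq> T"
  shows "smooth_on S (\<lambda>x. g (f x))"
proof (rule smooth_onI)
  fix x assume x: "x \<in> S"
  obtain U F where F: "open U" "x \<in> U" "\<And>r. C_on r U F" "\<And>y. y \<in> S \<Longrightarrow> y \<in> U \<Longrightarrow> F y = f y"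
    using smooth_onE[OF assms(1) x] by metis
  have "f x \<in> T" using assms(3) x by auto
  then obtain W G where G: "open W" "f x \<in> W" "\<And>r. C_on r W G" "\<And>y. y \<in> T \<Longrightarrow> y \<in> W \<Longrightarrow> G y = g y"
    using smooth_onE[OF assms(2)] by metis
  let ?U = "U \<inter> F -` W"
  have o: "open ?U"
    using F(1) G(1) C_on_imp_continuous[OF F(3)] continuous_open_preimage by blast
  moreover have "\<forall>r. C_on r ?U (\<lambda>y. G (F y))"
    by (auto intro!: C_on_compose[OF o G(1) _ _ G(3)] intro: C_on_subset[OF F(3)])
  ultimately show "\<exists>U h. open U \<and> x \<in> U \<and> (\<forall>r. C_on r U h) \<and> (\<forall>y\<in>S \<inter> U. h y = g (f y))"
    using F G x assms(3)
    by (intro exI[of _ ?U] exI[of _ "\<lambda>y. G (F y)"]) auto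
qed

lemma smooth_on_bilinear:
  assumes "bounded_bilinear h" "smooth_on S f" "smooth_on S g"
  shows "smooth_on S (\<lambda>x. h (f x) (g x))"
proof (rule smooth_onI)
  fix x assume x: "x \<in> S"
  obtain U F where F: "open U" "x \<in> U" "\<And>r. C_on r U F" "\<And>y. y \<in> S \<Longrightarrow> y \<in> U \<Longrightarrow> F y = f y"
    using smooth_onE[OF assms(2) x] by metis
  obtain W G where G: "open W" "x \<in> W" "\<And>r. C_on r W G" "\<And>y. y \<in> S \<Longrightarrow> y \<in> W \<Longrightarrow> G y = g y"
    using smooth_onE[OF assms(3) x] by metis
  have "\<forall>r. C_on r (U \<inter> W) (\<lambda>y. h (F y) (G y))"
    using F G by (auto intro!: C_on_bilinear[OF _ assms(1)] intro: C_on_subset)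
  then show "\<exists>U k. open U \<and> x \<in> U \<and> (\<forall>r. C_on r U k) \<and> (\<forall>y\<in>S \<inter> U. k y = h (f y) (g y))"
    using F G by (intro exI[of _ "U \<inter> W"] exI[of _ "\<lambda>y. h (F y) (G y)"]) auto
qed

section \<open>Curves and their velocities\<close>

lemma has_vector_derivative_cong_nhds:
  assumes "\<forall>\<^sub>F s in nhds (0::real). f s = g s"
  shows "(f has_vector_derivative d) (at 0) \<longleftrightarrow> (g has_vector_derivative d) (at 0)"
proof (rule has_vector_derivative_cong_ev)
  show "\<forall>\<^sub>F s in nhds 0. s \<in> UNIV \<longrightarrow> f s = g s" using assms by simp
  show "f 0 = g 0" using eventually_nhds_x_imp_x[OF assms] .
qed

lemma vector_derivative_cong_nhds:
  assumes "\<forall>\<^sub>F s in nhds (0::real). f s = g s"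
  shows "vector_derivative f (at 0) = vector_derivative g (at 0)"
  by (simp add: vector_derivative_def has_vector_derivative_cong_nhds[OF assms])

text \<open>The map \<open>D\<close> is chosen before the curve: a smooth map on an arbitrary set acts on the velocities of
  all curves in that set through one linear map, the derivative of a smooth extension.\<close>

lemma smooth_on_curve_derivative:
  fixes g :: "'x::euclidean_space \<Rightarrow> 'y::euclidean_space"
  assumes "smooth_on T g" "x \<in> T"
  obtains D where "linear D"
    "\<And>\<gamma> v. \<gamma> 0 = x \<Longrightarrow> (\<gamma> has_vector_derivative v) (at (0::real)) \<Longrightarrow>
       (\<forall>\<^sub>F s in nhds 0. \<gamma> s \<in> T) \<Longrightarrow> ((\<lambda>s. g (\<gamma> s)) has_vector_derivative D v) (at 0)"
proof -
  obtain U G where U: "open U" "x \<in> U" "\<And>r. C_on r U G" "\<And>y. y \<in> T \<Longrightarrow> y \<in> U \<Longrightarrow> G y = g y"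
    using smooth_onE[OF assms] by metis
  let ?D = "frechet_derivative G (at x)"
  have D: "(G has_derivative ?D) (at x)" by (rule C_on_Suc_derivative[OF U(3,2)])
  show thesis
  proof (rule that)
    show lin: "linear ?D" using D by (rule has_derivative_linear)
    fix \<gamma> v assume \<gamma>: "\<gamma> 0 = x" "(\<gamma> has_vector_derivative v) (at (0::real))"
      "\<forall>\<^sub>F s in nhds 0. \<gamma> s \<in> T"
    have "((G \<circ> \<gamma>) has_derivative (?D \<circ> (\<lambda>t. t *\<^sub>R v))) (at 0)"
      using \<gamma> D by (intro diff_chain_at) (simp_all add: has_vector_derivative_def)
    then have *: "((G \<circ> \<gamma>) has_vector_derivative ?D v) (at 0)"
      by (simp add: has_vector_derivative_def o_def linear_cmul[OF lin])
    have "isCont \<gamma> 0" using \<gamma>(2) has_vector_derivative_continuous by blast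
    then have "\<forall>\<^sub>F s in nhds 0. \<gamma> s \<in> U"
      using \<gamma>(1) U(1,2) by (metis continuous_within eventually_nhds_conv_at topological_tendstoD)
    with \<gamma>(3) have "\<forall>\<^sub>F s in nhds 0. (G \<circ> \<gamma>) s = g (\<gamma> s)"
      by eventually_elim (simp add: U)
    then show "((\<lambda>s. g (\<gamma> s)) has_vector_derivative ?D v) (at 0)"
      using * has_vector_derivative_cong_nhds[of "G \<circ> \<gamma>" "\<lambda>s. g (\<gamma> s)"] by blast
  qed
qed

lemma smooth_on_has_vector_derivative:
  fixes \<gamma> :: "real \<Rightarrow> 'x::euclidean_space"
  assumes "smooth_on {-e<..<e} \<gamma>" "e > 0"
  shows "(\<gamma> has_vector_derivative vector_derivative \<gamma> (at 0)) (at 0)"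
proof -
  have "0 \<in> {-e<..<e}" using assms(2) by simp
  then obtain D where D: "\<And>c v. c 0 = 0 \<Longrightarrow> (c has_vector_derivative v) (at (0::real)) \<Longrightarrow>
       (\<forall>\<^sub>F s in nhds 0. c s \<in> {-e<..<e}) \<Longrightarrow> ((\<lambda>s. \<gamma> (c s)) has_vector_derivative D v) (at 0)"
    using smooth_on_curve_derivative[OF assms(1)] by metis
  have "(\<gamma> has_vector_derivative D 1) (at 0)"
    using D[of "\<lambda>s. s" 1] assms(2) eventually_nhds_in_open[of "{-e<..<e}" 0]
    by (auto intro: derivative_eq_intros)
  then show ?thesis using vector_derivative_at by metis
qed

lemma eventually_nhds_0_iff: "(\<forall>\<^sub>F s in nhds (0::real). P s) \<longleftrightarrow> (\<exists>e>0. \<forall>s\<in>{-e<..<e}. P s)"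
proof -
  have "{-e<..<e} = {s. dist s 0 < e}" for e :: real by auto
  then show ?thesis unfolding eventually_nhds_metric by auto
qed

text \<open>Unlike membership in a velocity class, this relation also compares curves that are merely
  differentiable at \<open>0\<close>. One-parameter groups can then be replaced by curves whose smoothness is
  easier to see.\<close>

definition same_velocity :: "('p, 'e::euclidean_space) chart set \<Rightarrow> (real \<Rightarrow> 'p) \<Rightarrow> (real \<Rightarrow> 'p) \<Rightarrow> bool"
where
  "same_velocity A \<gamma> \<delta> \<longleftrightarrow> \<gamma> 0 = \<delta> 0 \<and> (\<forall>(U, c)\<in>A. \<gamma> 0 \<in> U \<longrightarrow>
     vector_derivative (c \<circ> \<gamma>) (at 0) = vector_derivative (c \<circ> \<delta>) (at 0))"

lemma velocity_iff: "\<delta> \<in> velocity A \<gamma> \<longleftrightarrow> smooth_curve A \<delta> \<and> same_velocity A \<gamma> \<delta>"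
  unfolding velocity_def same_velocity_def by (auto split: prod.splits)

lemma same_velocity_cong: "\<forall>\<^sub>F s in nhds 0. \<gamma> s = \<delta> s \<Longrightarrow> same_velocity A \<gamma> \<delta>"
  unfolding same_velocity_def
  by (auto intro!: vector_derivative_cong_nhds dest: eventually_nhds_x_imp_x elim: eventually_mono)

lemma same_velocity_sym: "same_velocity A \<gamma> \<delta> \<Longrightarrow> same_velocity A \<delta> \<gamma>"
  unfolding same_velocity_def by auto

lemma same_velocity_trans: "same_velocity A \<gamma> \<delta> \<Longrightarrow> same_velocity A \<delta> \<epsilon> \<Longrightarrow> same_velocity A \<gamma> \<epsilon>"
  unfolding same_velocity_def by (auto split: prod.splits)

lemma same_velocity_imp_velocity_eq: "same_velocity A \<gamma> \<delta> \<Longrightarrow> velocity A \<gamma> = velocity A \<delta>"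
  unfolding set_eq_iff velocity_iff by (blast intro: same_velocity_trans same_velocity_sym)

lemma velocity_refl: "smooth_curve A \<gamma> \<Longrightarrow> \<gamma> \<in> velocity A \<gamma>"
  by (simp add: velocity_iff same_velocity_def)

lemma velocity_in_tangent_space: "smooth_curve A \<gamma> \<Longrightarrow> velocity A \<gamma> \<in> tangent_space A (\<gamma> 0)"
  unfolding tangent_space_def by blast

lemma tangent_spaceE:
  assumes "v \<in> tangent_space A x"
  obtains \<gamma> where "smooth_curve A \<gamma>" "\<gamma> 0 = x" "v = velocity A \<gamma>"
  using assms unfolding tangent_space_def by blast

lemma openin_subspace_line:
  fixes V :: "'e::euclidean_space set"
  assumes "subspace V" "openin (top_of_set V) W" "u \<in> W" "v \<in> V"
  shows "\<forall>\<^sub>F s in nhds (0::real). u + s *\<^sub>R v \<in> W"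
proof -
  obtain T where T: "open T" "W = V \<inter> T" using assms(2) openin_open by metis
  have "((\<lambda>s. u + s *\<^sub>R v) \<longlongrightarrow> u + 0 *\<^sub>R v) (nhds 0)"
    by (intro tendsto_intros filterlim_ident)
  then have "\<forall>\<^sub>F s in nhds 0. u + s *\<^sub>R v \<in> T"
    using T assms(3) by (intro topological_tendstoD) auto
  moreover have "u + s *\<^sub>R v \<in> V" for s
    using assms T by (auto intro: subspace_add subspace_scale)
  ultimately show ?thesis using T by simp
qed

text \<open>Coordinate tangent vectors are velocities of smooth curves, although these curves are meaningful only as
  long as the line stays in the image of the chart.\<close>

lemma smooth_curve_chart_line:
  fixes V :: "'e::euclidean_space set"
  assumes "subspace V" "(U, c) \<in> A" "openin (top_of_set V) (c ` U)" "u \<in> c ` U" "v \<in> V"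
  shows "smooth_curve A (\<lambda>s. inv_into U c (u + s *\<^sub>R v))"
proof -
  obtain e where e: "e > 0" "\<And>s. s \<in> {-e<..<e} \<Longrightarrow> u + s *\<^sub>R v \<in> c ` U"
    using openin_subspace_line[OF assms(1,3-5)] unfolding eventually_nhds_0_iff by blast
  have "C_on r UNIV (\<lambda>s::real. u + s *\<^sub>R v)" for r
    by (intro C_on_add C_on_const C_on_linear open_UNIV) (simp add: linear_iff algebra_simps)
  then have "smooth_on {-e<..<e} (\<lambda>s. u + s *\<^sub>R v)"
    by (intro C_on_imp_smooth_on[of UNIV]) auto
  then have "smooth_on {-e<..<e} (c \<circ> (\<lambda>s. inv_into U c (u + s *\<^sub>R v)))"
    using smooth_on_cong[of "{-e<..<e}" "c \<circ> (\<lambda>s. inv_into U c (u + s *\<^sub>R v))" "\<lambda>s. u + s *\<^sub>R v"]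
      f_inv_into_f[OF e(2)] by simp
  moreover have "(\<lambda>s. inv_into U c (u + s *\<^sub>R v)) ` {-e<..<e} \<subseteq> U"
    using inv_into_into[OF e(2)] by blast
  ultimately show ?thesis
    unfolding smooth_curve_def using assms(2) e(1) by blast
qed

section \<open>Submanifolds of Euclidean spaces\<close>

lemma submanifold_atlasD:
  assumes "(U, c) \<in> submanifold_atlas V S"
  shows "openin (top_of_set S) U" "openin (top_of_set V) (c ` U)" "inj_on c U"
    "smooth_on U c" "smooth_on (c ` U) (inv_into U c)" "U \<subseteq> S"
  using assms openin_imp_subset unfolding submanifold_atlas_def by auto

lemma openin_atlas_topology:
  assumes "\<And>U c. (U, c) \<in> A \<Longrightarrow> inj_on c U"
  shows "openin (atlas_topology V A) W \<longleftrightarrow>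
    W \<subseteq> \<Union>(fst ` A) \<and> (\<forall>(U, c)\<in>A. openin (top_of_set V) (c ` (W \<inter> U)))"
proof -
  have "istopology (\<lambda>W. W \<subseteq> \<Union>(fst ` A) \<and> (\<forall>(U, c)\<in>A. openin (top_of_set V) (c ` (W \<inter> U))))"
    unfolding istopology_def
  proof (intro conjI allI impI ballI, goal_cases)
    case (2 S T)
    have "c ` (S \<inter> T \<inter> U) = c ` (S \<inter> U) \<inter> c ` (T \<inter> U)" if "(U, c) \<in> A" for U c
      using inj_on_image_Int[OF assms[OF that], of "S \<inter> U" "T \<inter> U"]
      by (simp add: Int_ac)
    then show ?case using 2 by (fastforce intro: openin_Int)
  next
    case (4 K)
    have "openin (top_of_set V) (c ` (\<Union>K \<inter> U))" if "(U, c) \<in> A" for U c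
    proof -
      have "openin (top_of_set V) (\<Union>S\<in>K. c ` (S \<inter> U))"
        using 4 that by (intro openin_Union) auto
      moreover have "c ` (\<Union>K \<inter> U) = (\<Union>S\<in>K. c ` (S \<inter> U))" by auto
      ultimately show ?thesis by simp
    qed
    then show ?case using 4 by blast
  qed auto
  then show ?thesis unfolding atlas_topology_def by (simp add: topology_inverse')
qed

lemma submanifold_chart_homeomorphism:
  assumes "(U, c) \<in> submanifold_atlas V S"
  shows "homeomorphism U (c ` U) c (inv_into U c)"
  using submanifold_atlasD[OF assms]
  by (auto simp: homeomorphism_def smooth_on_imp_continuous f_inv_into_f inv_into_f_f)

text \<open>The charts are homeomorphisms onto relatively open sets, hence the topology that they generate is
  the subspace topology. Separation and countability are inherited from the ambient space.\<close>

lemma atlas_topology_submanifold: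
  assumes "\<Union>(fst ` submanifold_atlas V S) = S"
  shows "atlas_topology V (submanifold_atlas V S) = top_of_set S"
proof (rule topology_eq[THEN iffD2], rule allI)
  fix W
  let ?A = "submanifold_atlas V S"
  have "openin (top_of_set S) W" if W: "W \<subseteq> S" "\<forall>(U, c)\<in>?A. openin (top_of_set V) (c ` (W \<inter> U))"
  proof (rule openin_subopen[THEN iffD2], rule ballI)
    fix x assume "x \<in> W"
    then obtain U c where U: "(U, c) \<in> ?A" "x \<in> U" using assms W(1) by fastforce
    have "openin (top_of_set (c ` U)) (c ` (W \<inter> U))"
      using W(2) U openin_subset_trans[of V "c ` (W \<inter> U)" "c ` U"] openin_imp_subset
        submanifold_atlasD(2)[OF U(1)] by blast
    then have "openin (top_of_set U) (W \<inter> U)"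
      using homeomorphism_imp_open_map[OF homeomorphism_sym[THEN iffD2,
            OF submanifold_chart_homeomorphism[OF U(1)]], of "c ` (W \<inter> U)"]
        inv_into_image_cancel[OF submanifold_atlasD(3)[OF U(1)], of "W \<inter> U"] by auto
    then have "openin (top_of_set S) (W \<inter> U)"
      using openin_trans submanifold_atlasD(1)[OF U(1)] by blast
    then show "\<exists>T. openin (top_of_set S) T \<and> x \<in> T \<and> T \<subseteq> W"
      using U(2) \<open>x \<in> W\<close> by blast
  qed
  moreover have "openin (top_of_set V) (c ` (W \<inter> U))"
    if W: "openin (top_of_set S) W" and U: "(U, c) \<in> ?A" for U c
  proof -
    have "openin (top_of_set U) (W \<inter> U)"
      using W submanifold_atlasD(6)[OF U]
      by (metis Int_commute openin_subtopology_Int2 inf.absorb_iff2 subtopology_subtopology)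
    then have "openin (top_of_set (c ` U)) (c ` (W \<inter> U))"
      using homeomorphism_imp_open_map[OF submanifold_chart_homeomorphism[OF U]] by blast
    then show ?thesis using openin_trans submanifold_atlasD(2)[OF U] by blast
  qed
  moreover have "openin (atlas_topology V ?A) W \<longleftrightarrow>
      W \<subseteq> S \<and> (\<forall>(U, c)\<in>?A. openin (top_of_set V) (c ` (W \<inter> U)))"
    using openin_atlas_topology[of ?A V W] submanifold_atlasD(3) unfolding assms by blast
  ultimately show "openin (atlas_topology V ?A) W \<longleftrightarrow> openin (top_of_set S) W"
    using openin_imp_subset by blast
qed

theorem smooth_manifold_submanifold:
  fixes V :: "'e::euclidean_space set" and S :: "'x::euclidean_space set"
  assumes V: "subspace V" and cov: "\<Union>(fst ` submanifold_atlas V S) = S"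
  shows "smooth_manifold V S (submanifold_atlas V S)"
  unfolding smooth_manifold_def
proof (intro conjI V cov)
  let ?A = "submanifold_atlas V S"
  show "Hausdorff_space (atlas_topology V ?A)"
    by (simp add: atlas_topology_submanifold[OF cov] Hausdorff_space_subtopology)
  obtain B :: "'x set set" where B: "countable B" "\<And>C. C \<in> B \<Longrightarrow> open C"
    "\<And>S. open S \<Longrightarrow> \<exists>U. U \<subseteq> B \<and> S = \<Union>U"
    using univ_second_countable by metis
  have "\<exists>W\<in>B. x \<in> W \<and> W \<subseteq> U" if U: "open U" "x \<in> U" for U x
    using B(3)[OF U(1)] U(2) by blast
  then have "second_countable (euclidean :: 'x topology)"
    unfolding second_countable_def using B(1,2) by (intro exI[of _ B]) auto
  then show "second_countable (atlas_topology V ?A)"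
    unfolding atlas_topology_submanifold[OF cov] by (rule second_countable_subtopology)
  show "\<forall>(U, c)\<in>?A. inj_on c U \<and> openin (top_of_set V) (c ` U)"
    using submanifold_atlasD(2,3) by blast
  show "\<forall>(U, c)\<in>?A. \<forall>(U', c')\<in>?A. openin (top_of_set V) (c ` (U \<inter> U')) \<and>
        smooth_on (c ` (U \<inter> U')) (c' \<circ> inv_into U c)"
  proof (clarify, intro conjI)
    fix U c U' c' assume *: "(U, c) \<in> ?A" "(U', c') \<in> ?A"
    have "openin (atlas_topology V ?A) U'"
      using submanifold_atlasD(1)[OF *(2)] by (simp add: atlas_topology_submanifold[OF cov])
    then show "openin (top_of_set V) (c ` (U \<inter> U'))"
      using openin_atlas_topology[of ?A V U', OF submanifold_atlasD(3)] *(1)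
      by (auto simp: Int_commute)
    have "inv_into U c ` c ` (U \<inter> U') \<subseteq> U'"
      using inv_into_image_cancel[OF submanifold_atlasD(3)[OF *(1)], of "U \<inter> U'"] by auto
    then show "smooth_on (c ` (U \<inter> U')) (c' \<circ> inv_into U c)"
      using smooth_on_compose[OF smooth_on_subset[OF submanifold_atlasD(5)[OF *(1)]]
          submanifold_atlasD(4)[OF *(2)], of "c ` (U \<inter> U')"] image_mono[of "U \<inter> U'" U c]
      by (simp add: o_def)
  qed
qed

lemma smooth_curve_submanifoldD:
  assumes "smooth_curve (submanifold_atlas V S) \<gamma>"
  obtains e where "e > 0" "smooth_on {-e<..<e} \<gamma>" "\<gamma> ` {-e<..<e} \<subseteq> S"
proof -
  obtain U c e where *: "(U, c) \<in> submanifold_atlas V S" "e > 0" "\<gamma> ` {-e<..<e} \<subseteq> U"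
    "smooth_on {-e<..<e} (c \<circ> \<gamma>)"
    using assms unfolding smooth_curve_def by blast
  have "smooth_on {-e<..<e} (\<lambda>s. inv_into U c ((c \<circ> \<gamma>) s))"
    using *(3) by (intro smooth_on_compose[OF *(4) submanifold_atlasD(5)[OF *(1)]]) auto
  moreover have "inv_into U c ((c \<circ> \<gamma>) s) = \<gamma> s" if "s \<in> {-e<..<e}" for s
    using *(3) that submanifold_atlasD(3)[OF *(1)] by (simp add: image_subset_iff)
  ultimately have "smooth_on {-e<..<e} \<gamma>"
    using smooth_on_cong[of "{-e<..<e}" "\<lambda>s. inv_into U c ((c \<circ> \<gamma>) s)" \<gamma>] by blast
  then show thesis using that * submanifold_atlasD(6)[OF *(1)] by blast
qed

lemma eventually_in_relatively_open:
  fixes \<gamma> :: "real \<Rightarrow> 'x::euclidean_space"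
  assumes "openin (top_of_set S) U" "\<gamma> 0 \<in> U" "isCont \<gamma> 0" "\<forall>\<^sub>F s in nhds 0. \<gamma> s \<in> S"
  shows "\<forall>\<^sub>F s in nhds 0. \<gamma> s \<in> U"
proof -
  obtain T where T: "open T" "U = S \<inter> T" using assms(1) openin_open by metis
  then have "\<forall>\<^sub>F s in nhds 0. \<gamma> s \<in> T"
    using assms(2,3) by (metis IntD2 continuous_within eventually_nhds_conv_at topological_tendstoD)
  with assms(4) show ?thesis by eventually_elim (simp add: T)
qed

lemma smooth_curve_submanifoldI:
  assumes "smooth_on {-e<..<e} \<gamma>" "e > 0" "\<gamma> ` {-e<..<e} \<subseteq> S"
    and cov: "\<Union>(fst ` submanifold_atlas V S) = S"
  shows "smooth_curve (submanifold_atlas V S) \<gamma>"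
proof -
  have "\<gamma> 0 \<in> S" using assms(2,3) by auto
  then obtain U c where U: "(U, c) \<in> submanifold_atlas V S" "\<gamma> 0 \<in> U" using cov by fastforce
  have "isCont \<gamma> 0"
    using smooth_on_has_vector_derivative[OF assms(1,2)] has_vector_derivative_continuous by blast
  then have "\<forall>\<^sub>F s in nhds 0. \<gamma> s \<in> U"
    using assms(2,3) by (intro eventually_in_relatively_open[where \<gamma>=\<gamma>, OF submanifold_atlasD(1)[OF U(1)] U(2)])
      (auto simp: eventually_nhds_0_iff)
  then obtain d where d: "d > 0" "\<And>s. s \<in> {-d<..<d} \<Longrightarrow> \<gamma> s \<in> U"
    unfolding eventually_nhds_0_iff by blast
  let ?e = "min d e"
  have sub: "{-?e<..<?e} \<subseteq> {-e<..<e}" "\<gamma> ` {-?e<..<?e} \<subseteq> U" using d(2) by auto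
  have "smooth_on {-?e<..<?e} (c \<circ> \<gamma>)"
    using smooth_on_compose[OF smooth_on_subset[OF assms(1) sub(1)] submanifold_atlasD(4)[OF U(1)] sub(2)]
    by (simp add: o_def)
  then show ?thesis
    unfolding smooth_curve_def using U(1) sub(2) d(1) assms(2)
    by (intro bexI[of _ "(U, c)"]) (auto intro!: exI[of _ ?e] simp del: min_less_iff_conj)
qed

text \<open>The two following lemmas identify tangent vectors with ambient derivatives: coordinates and
  ambient derivatives determine each other through the derivatives of a chart and of its
  inverse.\<close>

lemma same_velocity_submanifoldI:
  fixes S :: "'x::euclidean_space set"
  assumes "\<gamma> 0 = \<delta> 0" "(\<gamma> has_vector_derivative v) (at 0)" "(\<delta> has_vector_derivative v) (at 0)"
    "\<forall>\<^sub>F s in nhds 0. \<gamma> s \<in> S" "\<forall>\<^sub>F s in nhds 0. \<delta> s \<in> S"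
  shows "same_velocity (submanifold_atlas V S) \<gamma> \<delta>"
  unfolding same_velocity_def
proof (intro conjI assms(1) ballI, clarify)
  fix U c assume U: "(U, c) \<in> submanifold_atlas V S" "\<gamma> 0 \<in> U"
  obtain D where D: "\<And>\<epsilon> v. \<epsilon> 0 = \<gamma> 0 \<Longrightarrow> (\<epsilon> has_vector_derivative v) (at (0::real)) \<Longrightarrow>
       (\<forall>\<^sub>F s in nhds 0. \<epsilon> s \<in> U) \<Longrightarrow> ((\<lambda>s. c (\<epsilon> s)) has_vector_derivative D v) (at 0)"
    using smooth_on_curve_derivative[OF submanifold_atlasD(4)[OF U(1)] U(2)] by metis
  have "((\<lambda>s. c (\<epsilon> s)) has_vector_derivative D v) (at 0)" if "\<epsilon> \<in> {\<gamma>, \<delta>}" for \<epsilon>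
  proof -
    have "\<epsilon> 0 = \<gamma> 0" "(\<epsilon> has_vector_derivative v) (at 0)" "\<forall>\<^sub>F s in nhds 0. \<epsilon> s \<in> S"
      using that assms by auto
    then show ?thesis using U has_vector_derivative_continuous
      by (intro D eventually_in_relatively_open[OF submanifold_atlasD(1)[OF U(1)]]) auto
  qed
  from this[of \<gamma>] this[of \<delta>]
  show "vector_derivative (c \<circ> \<gamma>) (at 0) = vector_derivative (c \<circ> \<delta>) (at 0)"
    by (simp add: o_def vector_derivative_at)
qed

lemma same_velocity_submanifoldD:
  assumes "same_velocity (submanifold_atlas V S) \<gamma> \<delta>"
    "smooth_curve (submanifold_atlas V S) \<gamma>" "smooth_curve (submanifold_atlas V S) \<delta>"
    and cov: "\<Union>(fst ` submanifold_atlas V S) = S"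
  shows "vector_derivative \<gamma> (at 0) = vector_derivative \<delta> (at 0)"
proof -
  obtain e where "e > 0" "\<gamma> ` {-e<..<e} \<subseteq> S"
    using smooth_curve_submanifoldD[OF assms(2)] by metis
  then have "\<gamma> 0 \<in> S" by auto
  then obtain U c where U: "(U, c) \<in> submanifold_atlas V S" "\<gamma> 0 \<in> U" using cov by fastforce
  obtain D where D: "\<And>\<epsilon> v. \<epsilon> 0 = c (\<gamma> 0) \<Longrightarrow> (\<epsilon> has_vector_derivative v) (at (0::real)) \<Longrightarrow>
       (\<forall>\<^sub>F s in nhds 0. \<epsilon> s \<in> c ` U) \<Longrightarrow>
       ((\<lambda>s. inv_into U c (\<epsilon> s)) has_vector_derivative D v) (at 0)"
    using smooth_on_curve_derivative[OF submanifold_atlasD(5)[OF U(1)]] U(2) by (metis imageI)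
  obtain D' where D': "\<And>\<epsilon> v. \<epsilon> 0 = \<gamma> 0 \<Longrightarrow> (\<epsilon> has_vector_derivative v) (at (0::real)) \<Longrightarrow>
       (\<forall>\<^sub>F s in nhds 0. \<epsilon> s \<in> U) \<Longrightarrow> ((\<lambda>s. c (\<epsilon> s)) has_vector_derivative D' v) (at 0)"
    using smooth_on_curve_derivative[OF submanifold_atlasD(4)[OF U(1)] U(2)] by metis
  have "vector_derivative \<epsilon> (at 0) = D (vector_derivative (c \<circ> \<epsilon>) (at 0))"
    if eps: "\<epsilon> 0 = \<gamma> 0" "smooth_curve (submanifold_atlas V S) \<epsilon>" for \<epsilon> :: "real \<Rightarrow> _"
  proof -
    obtain e where e: "e > 0" "smooth_on {-e<..<e} \<epsilon>" "\<epsilon> ` {-e<..<e} \<subseteq> S"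
      using smooth_curve_submanifoldD[OF eps(2)] by metis
    note der = smooth_on_has_vector_derivative[OF e(2,1)]
    have ev: "\<forall>\<^sub>F s in nhds 0. \<epsilon> s \<in> U"
      using eps(1) U(2) e has_vector_derivative_continuous[OF der]
      by (intro eventually_in_relatively_open[OF submanifold_atlasD(1)[OF U(1)]])
        (auto simp: eventually_nhds_0_iff)
    have c: "((\<lambda>s. c (\<epsilon> s)) has_vector_derivative vector_derivative (c \<circ> \<epsilon>) (at 0)) (at 0)"
      using D'[OF eps(1) der ev] by (simp add: o_def vector_derivative_at)
    have "\<forall>\<^sub>F s in nhds 0. c (\<epsilon> s) \<in> c ` U" using ev by eventually_elim simp
    from D[OF _ c this] eps(1)
    have 1: "vector_derivative (\<lambda>s. inv_into U c (c (\<epsilon> s))) (at 0) = D (vector_derivative (c \<circ> \<epsilon>) (at 0))"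
      by (simp add: vector_derivative_at)
    have "\<forall>\<^sub>F s in nhds 0. inv_into U c (c (\<epsilon> s)) = \<epsilon> s"
      using ev by eventually_elim (simp add: submanifold_atlasD(3)[OF U(1)])
    from vector_derivative_cong_nhds[OF this] 1 show ?thesis by simp
  qed
  note * = this
  have "vector_derivative (c \<circ> \<gamma>) (at 0) = vector_derivative (c \<circ> \<delta>) (at 0)" "\<delta> 0 = \<gamma> 0"
    using assms(1) U unfolding same_velocity_def by auto
  then show ?thesis using *[of \<gamma>] *[of \<delta>] assms(2,3) by simp
qed

section \<open>The trace metric on a submanifold of symmetric matrices\<close>

lemma trace_mult_eq: "trace (X ** Y) = (\<Sum>i\<in>UNIV. \<Sum>k\<in>UNIV. X $ i $ k * Y $ k $ i)"
  for X Y :: "real^'n^'n"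
  by (simp add: trace_def matrix_matrix_mult_def)

lemma bounded_bilinear_trace_mult: "bounded_bilinear (\<lambda>X Y :: real^'n^'n. trace (X ** Y))"
  unfolding bilinear_conv_bounded_bilinear[symmetric] bilinear_def
  by (auto simp: linear_iff trace_mult_eq algebra_simps sum.distrib sum_distrib_left)

lemma linear_transpose: "linear (transpose :: real^'n^'m \<Rightarrow> real^'m^'n)"
  by (simp add: linear_iff transpose_def vec_eq_iff)

lemma isospectral_metric_velocity:
  assumes cov: "\<Union>(fst ` submanifold_atlas V S) = S"
    and "smooth_curve (submanifold_atlas V S) \<gamma>" "smooth_curve (submanifold_atlas V S) \<delta>"
  shows "isospectral_metric x (velocity (submanifold_atlas V S) \<gamma>) (velocity (submanifold_atlas V S) \<delta>)
    = trace (vector_derivative \<gamma> (at 0) ** vector_derivative \<delta> (at 0))"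
  unfolding isospectral_metric_def
proof (rule the_equality)
  show "\<exists>\<gamma>'\<in>velocity (submanifold_atlas V S) \<gamma>. \<exists>\<delta>'\<in>velocity (submanifold_atlas V S) \<delta>.
     trace (vector_derivative \<gamma> (at 0) ** vector_derivative \<delta> (at 0)) =
     trace (vector_derivative \<gamma>' (at 0) ** vector_derivative \<delta>' (at 0))"
    using velocity_refl assms by blast
next
  fix r assume "\<exists>\<gamma>'\<in>velocity (submanifold_atlas V S) \<gamma>. \<exists>\<delta>'\<in>velocity (submanifold_atlas V S) \<delta>.
     r = trace (vector_derivative \<gamma>' (at 0) ** vector_derivative \<delta>' (at 0))"
  then show "r = trace (vector_derivative \<gamma> (at 0) ** vector_derivative \<delta> (at 0))"
    using same_velocity_submanifoldD[OF _ assms(2) _ cov] same_velocity_submanifoldD[OF _ assms(3) _ cov]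
    by (metis velocity_iff)
qed

lemma chart_line_has_vector_derivative:
  fixes V :: "'e::euclidean_space set" and S :: "'x::euclidean_space set"
  assumes V: "subspace V" "v \<in> V" and U: "(U, c) \<in> submanifold_atlas V S" and u: "u \<in> c ` U" "u \<in> W"
    and g: "open W" "\<And>r. C_on r W g" "\<And>y. y \<in> c ` U \<Longrightarrow> y \<in> W \<Longrightarrow> g y = inv_into U c y"
  shows "((\<lambda>s. inv_into U c (u + s *\<^sub>R v)) has_vector_derivative frechet_derivative g (at u) v) (at 0)"
proof -
  let ?D = "frechet_derivative g (at u)"
  have D: "(g has_derivative ?D) (at u)" by (rule C_on_Suc_derivative[OF g(2) u(2)])
  have "((g \<circ> (\<lambda>s. u + s *\<^sub>R v)) has_derivative (?D \<circ> (\<lambda>s. s *\<^sub>R v))) (at 0)"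
    using D by (intro diff_chain_at) (auto intro!: derivative_eq_intros)
  then have *: "((\<lambda>s. g (u + s *\<^sub>R v)) has_vector_derivative ?D v) (at 0)"
    by (simp add: has_vector_derivative_def o_def linear_cmul[OF has_derivative_linear[OF D]])
  have "\<forall>\<^sub>F s in nhds (0::real). u + s *\<^sub>R v \<in> c ` U \<inter> W"
    using U u g(1) V by (intro openin_subspace_line[OF V(1)] openin_Int_open submanifold_atlasD(2)) auto
  then have "\<forall>\<^sub>F s in nhds (0::real). inv_into U c (u + s *\<^sub>R v) = g (u + s *\<^sub>R v)"
    by eventually_elim (simp add: g)
  from has_vector_derivative_cong_nhds[OF this] * show ?thesis by blast
qed

text \<open>For symmetric matrices \<open>tr(X\<^sup>2)\<close> is the sum of the squares of the entries, which makes
  the metric definite; smoothness holds since the coordinate tangent vectors are derivatives of a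
  smooth parametrisation.\<close>

theorem riemannian_metric_trace:
  fixes V :: "'e::euclidean_space set" and S :: "(real^'n^'n) set"
  assumes V: "subspace V" and cov: "\<Union>(fst ` submanifold_atlas V S) = S"
    and sym: "\<And>X. X \<in> S \<Longrightarrow> transpose X = X"
  shows "riemannian_metric V (submanifold_atlas V S) isospectral_metric"
  unfolding riemannian_metric_def
proof (clarify, unfold Let_def, intro conjI)
  fix U c assume U: "(U, c) \<in> submanifold_atlas V S"
  let ?A = "submanifold_atlas V S" and ?l = "\<lambda>u v s. inv_into U c (u + s *\<^sub>R v)"
  let ?G = "coord_metric ?A isospectral_metric (U, c)"
  have curve: "smooth_curve ?A (?l u v)" if "u \<in> c ` U" "v \<in> V" for u v
    using smooth_curve_chart_line[OF V U submanifold_atlasD(2)[OF U] that] .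
  have G: "?G u v w = trace (frechet_derivative g (at u) v ** frechet_derivative g (at u) w)"
    if "open W" "\<And>r. C_on r W g" "\<And>y. y \<in> c ` U \<Longrightarrow> y \<in> W \<Longrightarrow> g y = inv_into U c y"
      "u \<in> c ` U" "u \<in> W" "v \<in> V" "w \<in> V" for W g u v w
    using vector_derivative_at[OF chart_line_has_vector_derivative[OF V that(6) U that(4,5,1-3)]]
      vector_derivative_at[OF chart_line_has_vector_derivative[OF V that(7) U that(4,5,1-3)]]
    by (simp add: coord_metric_def isospectral_metric_velocity[OF cov curve curve] that)
  show "\<forall>v\<in>V. \<forall>w\<in>V. smooth_on (c ` U) (\<lambda>u. ?G u v w)"
  proof (intro ballI smooth_onI)
    fix v w u assume *: "v \<in> V" "w \<in> V" "u \<in> c ` U"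
    obtain W g where W: "open W" "u \<in> W" "\<And>r. C_on r W g"
      "\<And>y. y \<in> c ` U \<Longrightarrow> y \<in> W \<Longrightarrow> g y = inv_into U c y"
      using smooth_onE[OF submanifold_atlasD(5)[OF U] *(3)] by metis
    let ?h = "\<lambda>u. trace (frechet_derivative g (at u) v ** frechet_derivative g (at u) w)"
    have "C_on r W (\<lambda>u. frechet_derivative g (at u) v)" for r v
      using W(3)[of "Suc r"] by simp
    then have "\<forall>r. C_on r W ?h"
      by (intro allI C_on_bilinear[OF W(1) bounded_bilinear_trace_mult])
    moreover have "\<forall>y\<in>c ` U \<inter> W. ?h y = ?G y v w" using G[OF W(1,3,4)] * by simp
    ultimately show "\<exists>W h. open W \<and> u \<in> W \<and> (\<forall>r. C_on r W h) \<and> (\<forall>y\<in>c ` U \<inter> W. h y = ?G y v w)"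
      using W(1,2) by (intro exI[of _ W] exI[of _ ?h]) auto
  qed
  show "\<forall>u\<in>c ` U. \<forall>v\<in>V. \<forall>w\<in>V. ?G u v w = ?G u w v \<and>
      (\<forall>v'\<in>V. \<forall>r. ?G u (r *\<^sub>R v + v') w = r * ?G u v w + ?G u v' w) \<and> (v \<noteq> 0 \<longrightarrow> ?G u v v > 0)"
  proof (intro ballI)
    fix u v w assume *: "u \<in> c ` U" "v \<in> V" "w \<in> V"
    obtain W g where W: "open W" "u \<in> W" "\<And>r. C_on r W g"
      "\<And>y. y \<in> c ` U \<Longrightarrow> y \<in> W \<Longrightarrow> g y = inv_into U c y"
      using smooth_onE[OF submanifold_atlasD(5)[OF U] *(1)] by metis
    let ?D = "frechet_derivative g (at u)"
    have lin: "linear ?D"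
      using C_on_Suc_derivative[OF W(3,2)] has_derivative_linear by blast
    note G = G[OF W(1,3,4) *(1) W(2)]
    have "?G u v w = ?G u w v"
      using G *(2,3) trace_mul_sym by simp
    moreover have "\<forall>v'\<in>V. \<forall>r. ?G u (r *\<^sub>R v + v') w = r * ?G u v w + ?G u v' w"
    proof (intro ballI allI)
      fix v' r assume v': "v' \<in> V"
      interpret bounded_bilinear "\<lambda>X Y :: real^'n^'n. trace (X ** Y)"
        by (rule bounded_bilinear_trace_mult)
      have "r *\<^sub>R v + v' \<in> V" using * v' V by (intro subspace_add subspace_scale)
      then show "?G u (r *\<^sub>R v + v') w = r * ?G u v w + ?G u v' w"
        using G *(2,3) v' by (simp add: linear_add[OF lin] linear_cmul[OF lin] add_left scaleR_left)
    qed
    moreover have "?G u v v > 0" if "v \<noteq> 0"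
    proof -
      have d: "(?l u v has_vector_derivative ?D v) (at 0)"
        by (rule chart_line_has_vector_derivative[OF V *(2) U *(1) W(2,1,3)]) (rule W(4))
      have ev: "\<forall>\<^sub>F s in nhds (0::real). u + s *\<^sub>R v \<in> c ` U"
        by (rule openin_subspace_line[OF V submanifold_atlasD(2)[OF U] *(1,2)])
      then have "\<forall>\<^sub>F s in nhds 0. ?l u v s \<in> S"
        by eventually_elim (rule subsetD[OF submanifold_atlasD(6)[OF U] inv_into_into])
      then have tr: "\<forall>\<^sub>F s in nhds 0. ?l u v s = transpose (?l u v s)"
        by eventually_elim (simp add: sym)
      have "((\<lambda>s. transpose (?l u v s)) has_vector_derivative transpose (?D v)) (at 0)"
        using bounded_linear.has_vector_derivative[OF _ d] linear_transpose linear_conv_bounded_linear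
        by blast
      with d have "transpose (?D v) = ?D v"
        using vector_derivative_unique_at has_vector_derivative_cong_nhds[OF tr] by metis
      then have "trace (?D v ** ?D v) = (\<Sum>i\<in>UNIV. \<Sum>k\<in>UNIV. (?D v $ i $ k)\<^sup>2)"
      proof -
        have "?D v $ k $ i = ?D v $ i $ k" for i k
          using arg_cong[OF \<open>transpose (?D v) = ?D v\<close>, of "\<lambda>X. X $ i $ k"] by (simp add: transpose_def)
        then show ?thesis by (simp add: trace_mult_eq power2_eq_square)
      qed
      moreover have "?D v \<noteq> 0"
      proof
        assume 0: "?D v = 0"
        have "inv_into U c u \<in> U" using *(1) by (rule inv_into_into)
        then obtain E where lE: "linear E" and E: "\<And>\<gamma> v. \<gamma> 0 = inv_into U c u \<Longrightarrow>
            (\<gamma> has_vector_derivative v) (at (0::real)) \<Longrightarrow> (\<forall>\<^sub>F s in nhds 0. \<gamma> s \<in> U) \<Longrightarrow>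
            ((\<lambda>s. c (\<gamma> s)) has_vector_derivative E v) (at 0)"
          by (rule smooth_on_curve_derivative[OF submanifold_atlasD(4)[OF U]]) blast
        have "\<forall>\<^sub>F s in nhds 0. ?l u v s \<in> U"
          using ev by eventually_elim (rule inv_into_into)
        from E[OF _ d this] have E2: "((\<lambda>s. c (?l u v s)) has_vector_derivative E (?D v)) (at 0)"
          by simp
        have id: "\<forall>\<^sub>F s in nhds 0. c (?l u v s) = u + s *\<^sub>R v"
          using ev by eventually_elim (simp add: f_inv_into_f)
        have "((\<lambda>s. u + s *\<^sub>R v) has_vector_derivative E (?D v)) (at 0)"
          using E2 has_vector_derivative_cong_nhds[OF id] by simp
        moreover have "((\<lambda>s. u + s *\<^sub>R v) has_vector_derivative v) (at 0)"
          by (auto intro!: derivative_eq_intros)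
        ultimately show False
          using 0 that linear_0[OF lE] vector_derivative_unique_at by metis
      qed
      then obtain i k where "?D v $ i $ k \<noteq> 0" by (metis vec_eq_iff zero_index)
      then have "(\<Sum>i\<in>UNIV. \<Sum>k\<in>UNIV. (?D v $ i $ k)\<^sup>2) > 0"
        by (intro sum_pos2[of UNIV i] sum_pos2[of UNIV k]) (auto intro: sum_nonneg)
      ultimately show ?thesis using G[of v v] *(2) by simp
    qed
    ultimately show "?G u v w = ?G u w v \<and>
      (\<forall>v'\<in>V. \<forall>r. ?G u (r *\<^sub>R v + v') w = r * ?G u v w + ?G u v' w) \<and> (v \<noteq> 0 \<longrightarrow> ?G u v v > 0)"
      by blast
  qed
qed

section \<open>Bijections that match the charts of two atlases\<close>

text \<open>Charts are total functions whose values off their domain are arbitrary, so the atlases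
  cannot be compared by an image of sets; instead charts are carried over in both directions.\<close>

definition atlas_iso ::
  "'p set \<Rightarrow> ('p, 'e::euclidean_space) chart set \<Rightarrow> 'q set \<Rightarrow> ('q, 'e) chart set \<Rightarrow>
    ('p \<Rightarrow> 'q) \<Rightarrow> ('q \<Rightarrow> 'p) \<Rightarrow> bool"
where
  "atlas_iso M A N B f f' \<longleftrightarrow>
     (\<forall>x\<in>M. f x \<in> N \<and> f' (f x) = x) \<and> (\<forall>y\<in>N. f' y \<in> M \<and> f (f' y) = y) \<and>
     (\<forall>(U, c)\<in>A. U \<subseteq> M \<and> (f ` U, c \<circ> f') \<in> B) \<and> (\<forall>(U, c)\<in>B. U \<subseteq> N \<and> (f' ` U, c \<circ> f) \<in> A)"

lemma atlas_iso_sym: "atlas_iso M A N B f f' \<Longrightarrow> atlas_iso N B M A f' f"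
  unfolding atlas_iso_def by (elim conjE, intro conjI)

locale atlas_isomorphism =
  fixes M :: "'p set" and A :: "('p, 'e::euclidean_space) chart set" and N :: "'q set"
    and B :: "('q, 'e) chart set" and f f'
  assumes iso: "atlas_iso M A N B f f'"
begin

lemma f_in: "x \<in> M \<Longrightarrow> f x \<in> N" and f'f: "x \<in> M \<Longrightarrow> f' (f x) = x"
  and f'_in: "y \<in> N \<Longrightarrow> f' y \<in> M" and ff': "y \<in> N \<Longrightarrow> f (f' y) = y"
  using iso unfolding atlas_iso_def by auto

lemma chart_image: "(U, c) \<in> A \<Longrightarrow> (f ` U, c \<circ> f') \<in> B"
  and chart_subset: "(U, c) \<in> A \<Longrightarrow> U \<subseteq> M"
  using iso unfolding atlas_iso_def by auto

lemma chart_preimage: "(U, c) \<in> B \<Longrightarrow> (f' ` U, c \<circ> f) \<in> A"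
  and chart_subset': "(U, c) \<in> B \<Longrightarrow> U \<subseteq> N"
  using iso unfolding atlas_iso_def by auto

lemma bij: "bij_betw f M N"
  by (rule bij_betw_byWitness[of _ f']) (auto simp: f_in f'_in f'f ff')

lemma chart_comp_image: "W \<subseteq> M \<Longrightarrow> (c \<circ> f') ` f ` W = c ` W"
  by (force simp: f'f image_iff)

lemma inj_on_chart:
  assumes "U \<subseteq> M" "inj_on (c \<circ> f') (f ` U)"
  shows "inj_on c U"
proof (rule inj_onI)
  fix x y assume *: "x \<in> U" "y \<in> U" "c x = c y"
  then have "(c \<circ> f') (f x) = (c \<circ> f') (f y)" using assms(1) by (simp add: f'f subset_iff)
  then have "f x = f y" using inj_onD[OF assms(2)] *(1,2) by blast
  then show "x = y" using * assms(1) f'f by (metis subsetD)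
qed

lemma inv_into_chart:
  assumes "U \<subseteq> M" "inj_on c U" "u \<in> c ` U"
  shows "inv_into (f ` U) (c \<circ> f') u = f (inv_into U c u)"
proof (rule inv_into_f_eq)
  have *: "inv_into U c u \<in> U" using assms(3) by (rule inv_into_into)
  then show "f (inv_into U c u) \<in> f ` U" by blast
  show "(c \<circ> f') (f (inv_into U c u)) = u"
    using * assms by (simp add: f'f subset_iff f_inv_into_f)
  show "inj_on (c \<circ> f') (f ` U)"
    using assms(1,2) unfolding inj_on_def by (auto simp: f'f subset_iff)
qed

lemma cover: "\<Union>(fst ` B) = N \<Longrightarrow> \<Union>(fst ` A) = M"
proof (intro equalityI subsetI)
  fix x assume N: "\<Union>(fst ` B) = N" and x: "x \<in> M"
  then obtain U c where "(U, c) \<in> B" "f x \<in> U" using f_in[OF x] by fastforce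
  then have "(f' ` U, c \<circ> f) \<in> A" "x \<in> f' ` U" using chart_preimage f'f[OF x] by (auto intro: image_eqI[of _ f' "f x"])
  then show "x \<in> \<Union>(fst ` A)" by (intro UnionI[of "f' ` U"]) (auto intro!: image_eqI[of _ fst])
next
  fix x assume "x \<in> \<Union>(fst ` A)"
  then obtain U c where "(U, c) \<in> A" "x \<in> U" by auto
  then show "x \<in> M" using chart_subset by blast
qed

text \<open>Corresponding charts have the same image and the same coordinate changes, and the bijection is a
  homeomorphism for the two chart topologies.\<close>

lemma smooth_manifold_pullback:
  assumes "smooth_manifold V N B"
  shows "smooth_manifold V M A"
proof -
  have cov: "\<Union>(fst ` B) = N" and V: "subspace V"
    and inj: "\<And>U c. (U, c) \<in> B \<Longrightarrow> inj_on c U"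
    and op: "\<And>U c. (U, c) \<in> B \<Longrightarrow> openin (top_of_set V) (c ` U)"
    and ov: "\<And>U c U' c'. (U, c) \<in> B \<Longrightarrow> (U', c') \<in> B \<Longrightarrow> openin (top_of_set V) (c ` (U \<inter> U')) \<and>
        smooth_on (c ` (U \<inter> U')) (c' \<circ> inv_into U c)"
    and haus: "Hausdorff_space (atlas_topology V B)" and sec: "second_countable (atlas_topology V B)"
    using assms unfolding smooth_manifold_def by fast+
  have injA: "inj_on c U" if "(U, c) \<in> A" for U c
    using inj[OF chart_image[OF that]] chart_subset[OF that] by (rule inj_on_chart[rotated])
  have int: "f ` (W \<inter> U) = f ` W \<inter> f ` U" if "W \<subseteq> M" "U \<subseteq> M" for W U
    using inj_on_image_Int[OF bij_betw_imp_inj_on[OF bij] that] .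
  have top: "openin (atlas_topology V A) W \<longleftrightarrow> openin (atlas_topology V B) (f ` W)" if W: "W \<subseteq> M" for W
  proof -
    have "(\<forall>(U, c)\<in>A. openin (top_of_set V) (c ` (W \<inter> U))) \<longleftrightarrow>
        (\<forall>(U, c)\<in>B. openin (top_of_set V) (c ` (f ` W \<inter> U)))"
    proof (intro iffI ballI, unfold case_prod_unfold)
      fix x assume *: "\<forall>x\<in>A. openin (top_of_set V) (snd x ` (W \<inter> fst x))" "x \<in> B"
      obtain U c where x: "x = (U, c)" by fastforce
      have "openin (top_of_set V) ((c \<circ> f) ` (W \<inter> f' ` U))"
        using chart_preimage[of U c] * x by force
      moreover have "(c \<circ> f) ` (W \<inter> f' ` U) = c ` (f ` W \<inter> U)"
        using W chart_subset'[of U c] *(2) x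
        by (simp only: image_comp[symmetric]) (subst int; auto simp: ff' f'_in subset_iff image_iff)
      ultimately show "openin (top_of_set V) (snd x ` (f ` W \<inter> fst x))" using x by simp
    next
      fix x assume *: "\<forall>x\<in>B. openin (top_of_set V) (snd x ` (f ` W \<inter> fst x))" "x \<in> A"
      obtain U c where x: "x = (U, c)" by fastforce
      have "openin (top_of_set V) ((c \<circ> f') ` (f ` W \<inter> f ` U))"
        using chart_image[of U c] * x by force
      moreover have "(c \<circ> f') ` (f ` W \<inter> f ` U) = c ` (W \<inter> U)"
        using W chart_subset[of U c] *(2) x int[OF W, of U] chart_comp_image[of "W \<inter> U" c] by auto
      ultimately show "openin (top_of_set V) (snd x ` (W \<inter> fst x))" using x by simp
    qed
    then show ?thesis
      using openin_atlas_topology[of A V W, OF injA] openin_atlas_topology[of B V "f ` W", OF inj]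
        cov cover[OF cov] W f_in by auto
  qed
  have tsp: "topspace (atlas_topology V A) = M" "topspace (atlas_topology V B) = N"
  proof -
    have "topspace (atlas_topology V A) \<subseteq> M"
      using openin_atlas_topology[of A V, OF injA] cover[OF cov] openin_topspace by blast
    moreover have "topspace (atlas_topology V B) \<subseteq> N"
      using openin_atlas_topology[of B V, OF inj] cov openin_topspace by blast
    moreover have "openin (atlas_topology V B) N"
    proof -
      have "N \<inter> U = U" if "(U, c) \<in> B" for U c using chart_subset'[OF that] by blast
      then show ?thesis
        using op openin_atlas_topology[of B V N, OF inj] cov by auto
    qed
    moreover have "openin (atlas_topology V A) M"
      using top[of M] bij calculation(3) by (simp add: bij_betw_def)
    ultimately show "topspace (atlas_topology V A) = M" "topspace (atlas_topology V B) = N"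
      using openin_subset by blast+
  qed
  have "homeomorphic_map (atlas_topology V A) (atlas_topology V B) f"
    unfolding homeomorphic_map_def quotient_map_def tsp
  proof (intro conjI allI impI)
    fix U assume "U \<subseteq> N"
    then have "f ` {x \<in> M. f x \<in> U} = U" using ff' f'_in by (force simp: image_iff)
    then show "openin (atlas_topology V A) {x \<in> M. f x \<in> U} \<longleftrightarrow> openin (atlas_topology V B) U"
      using top[of "{x \<in> M. f x \<in> U}"] by auto
  qed (use bij in \<open>auto simp: bij_betw_def\<close>)
  then have hom: "atlas_topology V A homeomorphic_space atlas_topology V B"
    using homeomorphic_map_imp_homeomorphic_space by blast
  show ?thesis
    unfolding smooth_manifold_def
  proof (intro conjI V cover[OF cov])
    show "Hausdorff_space (atlas_topology V A)" "second_countable (atlas_topology V A)"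
      using hom haus sec homeomorphic_Hausdorff_space homeomorphic_space_second_countability by blast+
    show "\<forall>(U, c)\<in>A. inj_on c U \<and> openin (top_of_set V) (c ` U)"
    proof (clarify, intro conjI)
      fix U c assume U: "(U, c) \<in> A"
      then show "inj_on c U" by (rule injA)
      show "openin (top_of_set V) (c ` U)"
        using op[OF chart_image[OF U]] unfolding chart_comp_image[OF chart_subset[OF U]] .
    qed
    show "\<forall>(U, c)\<in>A. \<forall>(U', c')\<in>A. openin (top_of_set V) (c ` (U \<inter> U')) \<and>
        smooth_on (c ` (U \<inter> U')) (c' \<circ> inv_into U c)"
    proof (clarify)
      fix U c U' c' assume *: "(U, c) \<in> A" "(U', c') \<in> A"
      have "(c \<circ> f') ` (f ` U \<inter> f ` U') = c ` (U \<inter> U')"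
        using int[OF chart_subset[OF *(1)] chart_subset[OF *(2)]] chart_subset[OF *(1)]
          chart_comp_image[of "U \<inter> U'" c] by auto
      then have o: "openin (top_of_set V) (c ` (U \<inter> U'))"
        "smooth_on (c ` (U \<inter> U')) (c' \<circ> f' \<circ> inv_into (f ` U) (c \<circ> f'))"
        using ov[OF chart_image[OF *(1)] chart_image[OF *(2)]] by auto
      have "(c' \<circ> f' \<circ> inv_into (f ` U) (c \<circ> f')) u = (c' \<circ> inv_into U c) u"
        if "u \<in> c ` (U \<inter> U')" for u
      proof -
        have u: "u \<in> c ` U" using that by blast
        then have "inv_into U c u \<in> M" using inv_into_into chart_subset[OF *(1)] by (metis subsetD)
        then show ?thesis
          using inv_into_chart[OF chart_subset[OF *(1)] injA[OF *(1)] u] by (simp add: f'f)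
      qed
      then show "openin (top_of_set V) (c ` (U \<inter> U')) \<and> smooth_on (c ` (U \<inter> U')) (c' \<circ> inv_into U c)"
        using o smooth_on_cong[of "c ` (U \<inter> U')"] by blast
    qed
  qed
qed

lemma smooth_mapping_f:
  assumes "\<And>U c. (U, c) \<in> A \<Longrightarrow> inj_on c U" "\<Union>(fst ` A) = M"
    and "\<And>x. x \<in> M \<Longrightarrow> g x = f x"
  shows "smooth_mapping M A B g"
  unfolding smooth_mapping_def
proof (rule ballI)
  fix x assume "x \<in> M"
  then obtain U c where U: "(U, c) \<in> A" "x \<in> U" using assms(2) by fastforce
  have "(c \<circ> f' \<circ> g \<circ> inv_into U c) u = u" if "u \<in> c ` U" for u
    using inv_into_into[OF that] chart_subset[OF U(1)] that
    by (simp add: assms(3) f'f subset_iff f_inv_into_f)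
  then have "smooth_on (c ` U) (c \<circ> f' \<circ> g \<circ> inv_into U c)"
    using smooth_on_cong[of "c ` U" "c \<circ> f' \<circ> g \<circ> inv_into U c" "\<lambda>u. u"]
      smooth_on_linear[OF linear_ident] by blast
  moreover have "g ` U \<subseteq> f ` U" using assms(3) chart_subset[OF U(1)] by auto
  ultimately show "\<exists>(U, c)\<in>A. \<exists>(U', c')\<in>B. x \<in> U \<and> g ` U \<subseteq> U' \<and>
      smooth_on (c ` U) (c' \<circ> g \<circ> inv_into U c)"
    using U chart_image[OF U(1)] by blast
qed

lemma smooth_curve_image:
  assumes "smooth_curve A \<gamma>"
  shows "smooth_curve B (f \<circ> \<gamma>)"
proof -
  obtain U c e where *: "(U, c) \<in> A" "e > 0" "\<gamma> ` {-e<..<e} \<subseteq> U" "smooth_on {-e<..<e} (c \<circ> \<gamma>)"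
    using assms unfolding smooth_curve_def by blast
  have "(c \<circ> f' \<circ> (f \<circ> \<gamma>)) s = (c \<circ> \<gamma>) s" if "s \<in> {-e<..<e}" for s
    using *(3) that chart_subset[OF *(1)] f'f by (simp add: image_subset_iff subset_iff)
  then have "smooth_on {-e<..<e} (c \<circ> f' \<circ> (f \<circ> \<gamma>))"
    using smooth_on_cong[of "{-e<..<e}" "c \<circ> f' \<circ> (f \<circ> \<gamma>)" "c \<circ> \<gamma>"] *(4) by blast
  moreover have "(f \<circ> \<gamma>) ` {-e<..<e} \<subseteq> f ` U" using *(3) by auto
  ultimately show ?thesis unfolding smooth_curve_def using chart_image[OF *(1)] *(2) by blast
qed

lemma smooth_curve_in: "smooth_curve A \<gamma> \<Longrightarrow> \<forall>\<^sub>F s in nhds 0. \<gamma> s \<in> M"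
  unfolding smooth_curve_def eventually_nhds_0_iff using chart_subset
  by (fastforce simp: image_subset_iff)

lemma same_velocity_image:
  assumes "same_velocity A \<gamma> \<delta>" and \<gamma>: "\<forall>\<^sub>F s in nhds 0. \<gamma> s \<in> M" and \<delta>: "\<forall>\<^sub>F s in nhds 0. \<delta> s \<in> M"
  shows "same_velocity B (f \<circ> \<gamma>) (f \<circ> \<delta>)"
  unfolding same_velocity_def
proof (intro conjI ballI, goal_cases)
  case 1
  show ?case using assms(1) by (simp add: same_velocity_def)
next
  case (2 x)
  obtain U c where x: "x = (U, c)" by fastforce
  note A = chart_preimage[OF 2[unfolded x]]
  have 0: "f' (f (\<gamma> 0)) = \<gamma> 0" using f'f eventually_nhds_x_imp_x[OF \<gamma>] by blast
  have "vector_derivative (c \<circ> f \<circ> \<gamma>) (at 0) = vector_derivative (c \<circ> f \<circ> \<delta>) (at 0)" if "f (\<gamma> 0) \<in> U"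
  proof -
    have "\<gamma> 0 \<in> f' ` U" using 0 that by (metis imageI)
    then show ?thesis using assms(1) A unfolding same_velocity_def by blast
  qed
  then show ?case by (simp add: x o_assoc)
qed

text \<open>The union in the definition of the differential is over a whole velocity class; matching charts make
  all its members equal.\<close>

lemma differential_velocity:
  assumes "smooth_curve A \<gamma>"
  shows "differential B f (velocity A \<gamma>) = velocity B (f \<circ> \<gamma>)"
proof -
  have "velocity B (f \<circ> \<delta>) = velocity B (f \<circ> \<gamma>)" if "\<delta> \<in> velocity A \<gamma>" for \<delta>
    using that assms unfolding velocity_iff
    by (intro same_velocity_imp_velocity_eq same_velocity_image smooth_curve_in)
      (auto intro: same_velocity_sym)
  then show ?thesis
    unfolding differential_def using velocity_refl[OF assms] by blast
qed

end

lemma atlas_isomorphism_sym: "atlas_isomorphism M A N B f f' \<Longrightarrow> atlas_isomorphism N B M A f' f"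
  by (simp add: atlas_isomorphism_def atlas_iso_sym)

context atlas_isomorphism
begin

lemma differential_inverse:
  assumes "v \<in> tangent_space A x"
  shows "differential A f' (differential B f v) = v"
proof -
  obtain \<gamma> where \<gamma>: "smooth_curve A \<gamma>" "v = velocity A \<gamma>" using assms tangent_spaceE by metis
  interpret inv: atlas_isomorphism N B M A f' f
    by (rule atlas_isomorphism_sym) unfold_locales
  have "\<forall>\<^sub>F s in nhds 0. (f' \<circ> (f \<circ> \<gamma>)) s = \<gamma> s"
    using smooth_curve_in[OF \<gamma>(1)] by eventually_elim (simp add: f'f)
  then show ?thesis
    using \<gamma> differential_velocity[OF \<gamma>(1)] inv.differential_velocity[OF smooth_curve_image[OF \<gamma>(1)]]
      same_velocity_imp_velocity_eq[OF same_velocity_cong] by metis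
qed

lemma diffeomorphism_f:
  assumes "smooth_manifold V M A" "smooth_manifold V N B" "\<And>x. x \<in> M \<Longrightarrow> g x = f x"
  shows "diffeomorphism M A N B g"
proof -
  interpret inv: atlas_isomorphism N B M A f' f
    by (rule atlas_isomorphism_sym) unfold_locales
  have g: "bij_betw g M N" using bij bij_betw_cong[of M g f N] assms(3) by blast
  have g': "inv_into M g y = f' y" if "y \<in> N" for y
    by (rule inv_into_f_eq[OF bij_betw_imp_inj_on[OF g]]) (simp_all add: that f'_in assms(3) ff')
  show ?thesis
    unfolding diffeomorphism_def
  proof (intro conjI g)
    show "smooth_mapping M A B g"
      using assms unfolding smooth_manifold_def by (intro smooth_mapping_f) auto
    show "smooth_mapping N B A (inv_into M g)"
      using assms(1,2) g' unfolding smooth_manifold_def by (intro inv.smooth_mapping_f) auto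
  qed
qed

definition pullback_metric :: "'q metric_field \<Rightarrow> 'p metric_field" where
  "pullback_metric h x v w = (if x \<in> M \<and> v \<in> tangent_space A x \<and> w \<in> tangent_space A x
     then h (f x) (differential B f v) (differential B f w) else 0)"

lemma isometric_pullback: "isometric M A (pullback_metric h) B h f"
  unfolding isometric_def pullback_metric_def by simp

text \<open>In corresponding charts the pulled back metric has the same coordinate expression. The lines that
  define coordinate vectors agree only near \<open>0\<close>, where they stay in the domain of the chart, but
  velocities depend on germs only.\<close>

lemma riemannian_metric_pullback:
  assumes N: "smooth_manifold V N B" and h: "riemannian_metric V B h"
  shows "riemannian_metric V A (pullback_metric h)"
proof -
  have M: "smooth_manifold V M A" using N by (rule smooth_manifold_pullback)
  have V: "subspace V" using N unfolding smooth_manifold_def by blast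
  have eq: "coord_metric A (pullback_metric h) (U, c) u v w =
      coord_metric B h (f ` U, c \<circ> f') u v w"
    if U: "(U, c) \<in> A" and uv: "u \<in> c ` U" "v \<in> V" "w \<in> V" for U c u v w
  proof -
    have inj: "inj_on c U" and op: "openin (top_of_set V) (c ` U)"
      using M U unfolding smooth_manifold_def by auto
    have curve: "smooth_curve A (\<lambda>s. inv_into U c (u + s *\<^sub>R v))" if "v \<in> V" for v
      by (rule smooth_curve_chart_line[OF V U op uv(1) that])
    have "differential B f (velocity A (\<lambda>s. inv_into U c (u + s *\<^sub>R v))) =
        velocity B (\<lambda>s. inv_into (f ` U) (c \<circ> f') (u + s *\<^sub>R v))" if "v \<in> V" for v
    proof -
      have "\<forall>\<^sub>F s in nhds (0::real). u + s *\<^sub>R v \<in> c ` U"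
        by (rule openin_subspace_line[OF V op uv(1) that])
      then have "\<forall>\<^sub>F s in nhds 0. (f \<circ> (\<lambda>s. inv_into U c (u + s *\<^sub>R v))) s =
          inv_into (f ` U) (c \<circ> f') (u + s *\<^sub>R v)"
        by eventually_elim (simp add: inv_into_chart[OF chart_subset[OF U] inj])
      then show ?thesis
        unfolding differential_velocity[OF curve[OF that]]
        by (intro same_velocity_imp_velocity_eq same_velocity_cong)
    qed
    moreover have "velocity A (\<lambda>s. inv_into U c (u + s *\<^sub>R v)) \<in> tangent_space A (inv_into U c u)"
      if "v \<in> V" for v
      using velocity_in_tangent_space[OF curve[OF that]] by simp
    moreover have "inv_into U c u \<in> M" using inv_into_into[OF uv(1)] chart_subset[OF U] by blast
    ultimately show ?thesis
      using uv by (simp add: coord_metric_def pullback_metric_def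
          inv_into_chart[OF chart_subset[OF U] inj uv(1)])
  qed
  show ?thesis
    unfolding riemannian_metric_def Let_def
  proof (clarify)
    fix U c assume U: "(U, c) \<in> A"
    let ?H = "coord_metric B h (f ` U, c \<circ> f')"
    have im: "(c \<circ> f') ` f ` U = c ` U" by (rule chart_comp_image[OF chart_subset[OF U]])
    have H: "\<forall>u\<in>c ` U. \<forall>v\<in>V. \<forall>w\<in>V. ?H u v w = ?H u w v \<and>
        (\<forall>v'\<in>V. \<forall>r. ?H u (r *\<^sub>R v + v') w = r * ?H u v w + ?H u v' w) \<and> (v \<noteq> 0 \<longrightarrow> ?H u v v > 0)"
      "\<forall>v\<in>V. \<forall>w\<in>V. smooth_on (c ` U) (\<lambda>u. ?H u v w)"
      using h chart_image[OF U] unfolding riemannian_metric_def Let_def im[symmetric] by blast+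
    have add: "r *\<^sub>R v + v' \<in> V" if "v \<in> V" "v' \<in> V" for r v v'
      using V that by (intro subspace_add subspace_scale)
    let ?G = "coord_metric A (pullback_metric h) (U, c)"
    have "smooth_on (c ` U) (\<lambda>u. ?G u v w)" if "v \<in> V" "w \<in> V" for v w
      using H(2) that smooth_on_cong[of "c ` U" "\<lambda>u. ?G u v w" "\<lambda>u. ?H u v w"] eq[OF U] by blast
    moreover have "?G u v w = ?G u w v \<and>
        (\<forall>v'\<in>V. \<forall>r. ?G u (r *\<^sub>R v + v') w = r * ?G u v w + ?G u v' w) \<and> (v \<noteq> 0 \<longrightarrow> 0 < ?G u v v)"
      if uvw: "u \<in> c ` U" "v \<in> V" "w \<in> V" for u v w
      using H(1)[rule_format, OF uvw] by (simp add: eq[OF U uvw(1)] uvw(2,3) add)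
    ultimately show "(\<forall>u\<in>c ` U. \<forall>v\<in>V. \<forall>w\<in>V. ?G u v w = ?G u w v \<and>
        (\<forall>v'\<in>V. \<forall>r. ?G u (r *\<^sub>R v + v') w = r * ?G u v w + ?G u v' w) \<and> (v \<noteq> 0 \<longrightarrow> 0 < ?G u v v)) \<and>
      (\<forall>v\<in>V. \<forall>w\<in>V. smooth_on (c ` U) (\<lambda>u. ?G u v w))"
      by blast
  qed
qed

end

section \<open>Rotations and the Cayley transform\<close>

lemma bounded_bilinear_matrix_mult:
  "bounded_bilinear ((**) :: real^'m^'l \<Rightarrow> real^'n^'m \<Rightarrow> real^'n^'l)"
  unfolding bilinear_conv_bounded_bilinear[symmetric] bilinear_def
  by (auto simp: linear_iff vec_eq_iff matrix_matrix_mult_def algebra_simps sum.distrib sum_distrib_left)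

lemmas has_derivative_matrix_mult = bounded_bilinear.FDERIV[OF bounded_bilinear_matrix_mult]

lemma SO_iff: "Q \<in> SO \<longleftrightarrow> transpose Q ** Q = mat 1 \<and> det Q = 1"
  by (simp add: SO_def rotation_matrix_def orthogonal_matrix)

lemma SO_mult_transpose: "Q \<in> SO \<Longrightarrow> Q ** transpose Q = mat 1" "Q \<in> SO \<Longrightarrow> transpose Q ** Q = mat 1"
  by (simp_all add: SO_def rotation_matrix_def orthogonal_matrix_def)

lemma SO_id: "mat 1 \<in> SO"
  by (simp add: SO_iff transpose_mat)

lemma SO_transpose: "Q \<in> SO \<Longrightarrow> transpose Q \<in> SO"
  using SO_mult_transpose(1) by (auto simp: SO_iff)

lemma SO_mult: "Q \<in> SO \<Longrightarrow> R \<in> SO \<Longrightarrow> Q ** R \<in> SO"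
  by (simp add: SO_def rotation_matrix_def orthogonal_matrix_mul det_mul)

lemma SO_cancel:
  assumes "Q \<in> SO"
  shows "transpose Q ** (Q ** X) = X" "Q ** (transpose Q ** X) = X"
    "X ** Q ** transpose Q = X" "X ** transpose Q ** Q = X"
proof -
  note SO_mult_transpose[OF assms]
  then show "transpose Q ** (Q ** X) = X" "Q ** (transpose Q ** X) = X"
    by (simp_all add: matrix_mul_assoc)
  show "X ** Q ** transpose Q = X" "X ** transpose Q ** Q = X"
    using \<open>Q ** transpose Q = mat 1\<close> \<open>transpose Q ** Q = mat 1\<close>
    by (simp_all add: matrix_mul_assoc[symmetric])
qed

lemma matrix_inv_mult:
  fixes A :: "real^'n^'n"
  assumes "det A \<noteq> 0"
  shows "A ** matrix_inv A = mat 1" "matrix_inv A ** A = mat 1"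
proof -
  have "\<exists>A'. A ** A' = mat 1 \<and> A' ** A = mat 1"
    using assms invertible_det_nz unfolding invertible_def by blast
  then have "A ** matrix_inv A = mat 1 \<and> matrix_inv A ** A = mat 1"
    unfolding matrix_inv_def by (rule someI_ex)
  then show "A ** matrix_inv A = mat 1" "matrix_inv A ** A = mat 1" by auto
qed

lemma C_on_matrix_inv:
  fixes A :: "'x::euclidean_space \<Rightarrow> real^'m^'m"
  assumes U: "open U" and A: "C_on r U A" and det: "\<And>x. x \<in> U \<Longrightarrow> det (A x) \<noteq> 0"
  shows "C_on r U (\<lambda>x. matrix_inv (A x))"
proof -
  have "C_on r U (\<lambda>x. matrix_inv (A x) *v axis j 1)" for j
  proof (rule C_on_cramer[OF U _ _ det])
    show "C_on r U (\<lambda>x. A x $ i $ k)" for i k by (intro C_on_nth U A)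
    show "C_on r U (\<lambda>x. axis j 1 $ i)" for i by (rule C_on_const)
    show "A x *v (matrix_inv (A x) *v axis j 1) = axis j 1" if "x \<in> U" for x
      using matrix_inv_mult(1)[OF det[OF that]] by (simp add: matrix_vector_mul_assoc)
  qed
  then have "C_on r U (\<lambda>x. (matrix_inv (A x) *v axis j 1) $ i)" for i j
    by (rule C_on_nth[OF U])
  moreover have "(matrix_inv (A x) *v axis j 1) $ i = matrix_inv (A x) $ i $ j" for x i j
    by (simp add: matrix_vector_mult_basis column_def)
  ultimately show ?thesis by (intro C_on_vec U) simp
qed

definition cayley :: "real^'n^'n \<Rightarrow> real^'n^'n" where
  "cayley B = (mat 1 + B) ** matrix_inv (mat 1 - B)"

lemma transpose_add: "transpose (A + B) = transpose A + transpose B"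
  and transpose_diff: "transpose (A - B) = transpose A - transpose B"
  and transpose_scaleR: "transpose (r *\<^sub>R A) = r *\<^sub>R transpose A" for A B :: "real^'n^'m"
  by (simp_all add: linear_add linear_diff linear_cmul linear_transpose)

text \<open>If \<open>x = B x\<close> with \<open>B\<close> skew-symmetric, then \<open>x \<bullet> x = x \<bullet> B x = 0\<close>.\<close>

lemma det_one_minus_skew:
  fixes B :: "real^'n^'n"
  assumes "transpose B = - B"
  shows "det (mat 1 - B) \<noteq> 0"
proof -
  have "x = 0" if "(mat 1 - B) *v x = 0" for x
  proof -
    have x: "x = B *v x" using that by (simp add: matrix_vector_mult_diff_rdistrib)
    have "x \<bullet> (B *v x) = (transpose B *v x) \<bullet> x"
      by (metis dot_lmul_matrix transpose_matrix_vector)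
    also have "\<dots> = - (x \<bullet> (B *v x))"
    proof -
      have "(- B) *v x = - (B *v x)"
        by (simp add: matrix_vector_mult_def vec_eq_iff sum_negf)
      then show ?thesis using assms by (simp add: inner_commute)
    qed
    finally show ?thesis using x by simp
  qed
  then show ?thesis
    using matrix_left_invertible_ker[of "mat 1 - B"] invertible_det_nz[of "mat 1 - B"]
      invertible_left_inverse by blast
qed

text \<open>Transposition exchanges the commuting factors \<open>1 + B\<close> and \<open>1 - B\<close>, so they have equal determinants
  and their quotient is orthogonal.\<close>

lemma cayley_SO:
  assumes "transpose B = - B"
  shows "cayley B \<in> SO"
proof -
  let ?P = "mat 1 + B" and ?M = "mat 1 - B" and ?N = "matrix_inv (mat 1 - B)"
  note N = matrix_inv_mult[OF det_one_minus_skew[OF assms]]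
  have tP: "transpose ?P = ?M" "transpose ?M = ?P"
    using assms by (simp_all add: transpose_add transpose_diff transpose_mat)
  have comm: "?P ** ?M = ?M ** ?P"
    by (simp add: matrix_add_ldistrib bounded_bilinear.add_left[OF bounded_bilinear_matrix_mult]
        bounded_bilinear.diff_left[OF bounded_bilinear_matrix_mult]
        bounded_bilinear.diff_right[OF bounded_bilinear_matrix_mult])
  have tN: "transpose ?N ** ?P = mat 1"
    using arg_cong[OF N(1), of transpose] by (simp add: matrix_transpose_mul transpose_mat tP)
  have "transpose (cayley B) ** cayley B = transpose ?N ** (?M ** ?P) ** ?N"
    by (simp add: cayley_def matrix_transpose_mul tP matrix_mul_assoc)
  also have "\<dots> = (transpose ?N ** ?P) ** (?M ** ?N)"
    by (simp add: comm[symmetric] matrix_mul_assoc)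
  finally have 1: "transpose (cayley B) ** cayley B = mat 1" by (simp add: tN N)
  have "det ?P = det ?M" using tP det_transpose by metis
  then have "det (cayley B) = det (?M ** ?N)" by (simp add: cayley_def det_mul)
  then show ?thesis using 1 N by (simp add: SO_iff)
qed

lemma cayley_0: "cayley 0 = mat 1"
  using matrix_inv_mult[of "mat 1 :: real^'n^'n"] by (simp add: cayley_def)

section \<open>Orbits of diagonal matrices under conjugation\<close>

text \<open>The eigenvalue of each coordinate is given directly by a function \<open>l\<close> on the indices, so that two
  indices lie in the same block iff \<open>l\<close> agrees on them; \<open>off l\<close> is then the space \<open>\<mm>\<close> of
  skew-symmetric matrices with vanishing diagonal blocks.\<close>

definition Lam :: "('n::finite \<Rightarrow> real) \<Rightarrow> 'n sqmat" where
  "Lam l = (\<chi> r s. if r = s then l r else 0)"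

definition off :: "('n::finite \<Rightarrow> real) \<Rightarrow> 'n sqmat set" where
  "off l = {B. transpose B = - B \<and> (\<forall>r s. l r = l s \<longrightarrow> B $ r $ s = 0)}"

definition orbit :: "('n::finite \<Rightarrow> real) \<Rightarrow> 'n sqmat set" where
  "orbit l = {Q ** Lam l ** transpose Q | Q. Q \<in> SO}"

lemma mult_Lam: "(X ** Lam l) $ r $ s = X $ r $ s * l s"
  and Lam_mult: "(Lam l ** X) $ r $ s = l r * X $ r $ s"
  by (simp_all add: Lam_def matrix_matrix_mult_def if_distrib if_distribR sum.delta cong: if_cong)

lemma transpose_Lam: "transpose (Lam l) = Lam l"
  by (simp add: Lam_def transpose_def vec_eq_iff)

lemma orbit_symmetric: "X \<in> orbit l \<Longrightarrow> transpose X = X"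
  by (auto simp: orbit_def matrix_transpose_mul transpose_Lam matrix_mul_assoc)

lemma subspace_off: "subspace (off l)"
  unfolding subspace_def off_def by (auto simp: transpose_add transpose_scaleR transpose_mat[of 0, simplified])

text \<open>A small block diagonal matrix cannot perturb the diagonal matrix within its orbit. The entries of an
  eigenvector outside the block of its eigenvalue are, by the spectral gap, bounded by a
  fraction of the sum of their absolute values, so they vanish; then the perturbation
  annihilates a basis of eigenvectors.\<close>

lemma block_perturbation_in_orbit_eq_0:
  fixes l :: "'n::finite \<Rightarrow> real" and D :: "'n sqmat"
  assumes X: "Lam l + D \<in> orbit l" and D: "\<And>r s. l r \<noteq> l s \<Longrightarrow> D $ r $ s = 0"
    and small: "\<And>r s. \<bar>D $ r $ s\<bar> \<le> \<delta>"
    and gap: "\<And>r s. l r \<noteq> l s \<Longrightarrow> real CARD('n) * \<delta> < \<bar>l s - l r\<bar>"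
  shows "D = 0"
proof -
  obtain Q where Q: "Q \<in> SO" "Lam l + D = Q ** Lam l ** transpose Q" using X unfolding orbit_def by blast
  have "(Lam l + D) ** Q = Q ** Lam l"
    by (simp add: Q(2) SO_cancel[OF Q(1)])
  then have "Lam l ** Q + D ** Q = Q ** Lam l"
    by (simp add: bounded_bilinear.add_left[OF bounded_bilinear_matrix_mult])
  then have DQ: "(D ** Q) $ r $ s = (l s - l r) * Q $ r $ s" for r s
    using mult_Lam[of Q l r s] Lam_mult[of l Q r s]
    by (metis (no_types, lifting) add_diff_cancel_left' left_diff_distrib mult.commute vector_add_component)
  have "Q $ r $ s = 0" if rs: "l r \<noteq> l s" for r s
  proof -
    let ?S = "{t. l t \<noteq> l s}"
    let ?q = "\<Sum>t\<in>?S. \<bar>Q $ t $ s\<bar>"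
    have *: "\<bar>l s - l t\<bar> * \<bar>Q $ t $ s\<bar> \<le> \<delta> * ?q" if t: "t \<in> ?S" for t
    proof -
      have "(D ** Q) $ t $ s = (\<Sum>u\<in>UNIV. D $ t $ u * Q $ u $ s)"
        by (simp add: matrix_matrix_mult_def)
      also have "\<dots> = (\<Sum>u\<in>?S. D $ t $ u * Q $ u $ s)"
        using t D by (intro sum.mono_neutral_right) auto
      finally have "\<bar>l s - l t\<bar> * \<bar>Q $ t $ s\<bar> = \<bar>\<Sum>u\<in>?S. D $ t $ u * Q $ u $ s\<bar>"
        using DQ[of t s] by (metis abs_mult)
      also have "\<dots> \<le> (\<Sum>u\<in>?S. \<bar>D $ t $ u * Q $ u $ s\<bar>)" by (rule sum_abs)
      also have "\<dots> \<le> (\<Sum>u\<in>?S. \<delta> * \<bar>Q $ u $ s\<bar>)"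
        using small by (intro sum_mono) (simp add: abs_mult mult_right_mono)
      finally show ?thesis by (simp add: sum_distrib_left)
    qed
    have q0: "?q \<ge> 0" by (intro sum_nonneg) auto
    have "?q = 0"
    proof (rule ccontr)
      assume "?q \<noteq> 0"
      then have q: "?q > 0" using q0 by linarith
      then obtain t where t: "t \<in> ?S" "\<bar>Q $ t $ s\<bar> \<ge> ?q / CARD('n)"
      proof -
        have "\<not> (\<forall>t\<in>?S. \<bar>Q $ t $ s\<bar> < ?q / CARD('n))"
        proof
          assume a: "\<forall>t\<in>?S. \<bar>Q $ t $ s\<bar> < ?q / CARD('n)"
          have "?q < (\<Sum>t\<in>?S. ?q / CARD('n))" using rs a by (intro sum_strict_mono) auto
          also have "\<dots> = real (card ?S) * (?q / CARD('n))" by simp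
          also have "\<dots> \<le> real CARD('n) * (?q / CARD('n))"
            using q0 by (intro mult_right_mono) (simp_all add: card_mono)
          finally show False by simp
        qed
        then show ?thesis using that by force
      qed
      have "\<delta> * ?q = real CARD('n) * \<delta> * (?q / CARD('n))" by simp
      also have "\<dots> < \<bar>l s - l t\<bar> * (?q / CARD('n))"
        using gap[of t s] t(1) q by (intro mult_strict_right_mono) auto
      also have "\<dots> \<le> \<bar>l s - l t\<bar> * \<bar>Q $ t $ s\<bar>" using t(2) by (intro mult_left_mono) auto
      also have "\<dots> \<le> \<delta> * ?q" using t(1) by (rule *)
      finally show False by simp
    qed
    then show ?thesis using rs by (subst (asm) sum_nonneg_eq_0_iff) auto
  qed
  then have "(D ** Q) $ r $ s = 0" for r s using DQ[of r s] by (cases "l r = l s") auto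
  then have "D ** Q = 0" by (simp add: vec_eq_iff)
  then show ?thesis using SO_cancel(3)[OF Q(1), of D] bounded_bilinear.zero_left[OF bounded_bilinear_matrix_mult]
    by metis
qed


section \<open>A smooth slice through the diagonal matrix\<close>

text \<open>The symmetric part of \<open>T\<close> off the diagonal blocks is tangent to the orbit and is realised by
  rotating along \<open>off_gen l T\<close>; the remaining part \<open>off_rest l T\<close> is transversal to the orbit. The
  normalisation \<open>4 = 2 \<sqdot> 2\<close> undoes the symmetrisation and the factor \<open>2\<close> in the derivative of
  the Cayley transform, so that \<open>slice_map\<close> has derivative the identity at \<open>0\<close>.\<close>

definition off_gen :: "('n::finite \<Rightarrow> real) \<Rightarrow> 'n sqmat \<Rightarrow> 'n sqmat" where
  "off_gen l T = (\<chi> r s. if l r = l s then 0 else (T $ r $ s + T $ s $ r) / (4 * (l s - l r)))"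

definition off_rest :: "('n::finite \<Rightarrow> real) \<Rightarrow> 'n sqmat \<Rightarrow> 'n sqmat" where
  "off_rest l T = (\<chi> r s. if l r = l s then T $ r $ s else (T $ r $ s - T $ s $ r) / 2)"

definition slice_map :: "('n::finite \<Rightarrow> real) \<Rightarrow> 'n sqmat \<Rightarrow> 'n sqmat" where
  "slice_map l T =
     cayley (off_gen l T) ** (Lam l + off_rest l T) ** transpose (cayley (off_gen l T))"

text \<open>The tangent direction \<open>2 [B, Lam l]\<close> generated by \<open>B\<close>.\<close>

definition off_tangent :: "('n::finite \<Rightarrow> real) \<Rightarrow> 'n sqmat \<Rightarrow> 'n sqmat" where
  "off_tangent l B = (\<chi> r s. 2 * (l s - l r) * B $ r $ s)"

lemma linear_off_gen: "linear (off_gen l)"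
  by (simp add: linear_iff off_gen_def vec_eq_iff add_divide_distrib distrib_left)

lemma linear_off_rest: "linear (off_rest l)"
  and linear_off_tangent: "linear (off_tangent l)"
  by (simp_all add: linear_iff off_rest_def off_tangent_def vec_eq_iff field_simps)

lemma offI:
  assumes "\<And>r s. B $ s $ r = - B $ r $ s" "\<And>r s. l r = l s \<Longrightarrow> B $ r $ s = 0"
  shows "B \<in> off l"
  unfolding off_def mem_Collect_eq vec_eq_iff transpose_def vec_lambda_beta uminus_vec_def
  using assms by blast

lemma off_gen_in_off: "off_gen l T \<in> off l"
proof -
  have neg: "(a + b) / (4 * (x - y)) = - ((b + a) / (4 * (y - x)))" for a b x y :: real
    by (metis add.commute minus_diff_eq mult_minus_right minus_divide_right)
  have "off_gen l T $ s $ r = - off_gen l T $ r $ s" for r s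
    using neg[of "T $ s $ r" "T $ r $ s" "l r" "l s"] by (simp only: off_gen_def vec_lambda_beta) auto
  moreover have "off_gen l T $ r $ s = 0" if "l r = l s" for r s
    using that by (simp add: off_gen_def)
  ultimately show ?thesis by (rule offI)
qed

lemma off_skew: "B \<in> off l \<Longrightarrow> B $ s $ r = - B $ r $ s" "B \<in> off l \<Longrightarrow> transpose B = - B"
proof -
  assume B: "B \<in> off l"
  then show t: "transpose B = - B" by (simp add: off_def)
  show "B $ s $ r = - B $ r $ s"
    using arg_cong[OF t, of "\<lambda>X. X $ r $ s"] by (simp add: transpose_def)
qed

lemma off_gen_tangent: "B \<in> off l \<Longrightarrow> off_gen l (off_tangent l B) = B"
proof -
  assume B: "B \<in> off l"
  show ?thesis
  proof (simp add: vec_eq_iff, intro allI)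
    fix r s
    show "off_gen l (off_tangent l B) $ r $ s = B $ r $ s"
      using off_skew(1)[OF B, of s r] B
      by (auto simp: off_gen_def off_tangent_def off_def field_simps)
  qed
qed

lemma off_rest_tangent: "B \<in> off l \<Longrightarrow> off_rest l (off_tangent l B) = 0"
proof -
  assume B: "B \<in> off l"
  show ?thesis
  proof (simp add: vec_eq_iff, intro allI)
    fix r s
    show "off_rest l (off_tangent l B) $ r $ s = 0"
      using off_skew(1)[OF B, of s r] by (auto simp: off_rest_def off_tangent_def field_simps)
  qed
qed

lemma off_decomposition: "off_tangent l (off_gen l T) + off_rest l T = T"
  by (auto simp: vec_eq_iff off_gen_def off_rest_def off_tangent_def field_simps)

lemma C_on_cayley_off_gen: "C_on r UNIV (\<lambda>T. cayley (off_gen l T))"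
proof -
  have "C_on r UNIV (off_gen l)" by (rule C_on_linear[OF linear_off_gen])
  moreover from this have "C_on r UNIV (\<lambda>T. mat 1 + (-1) *\<^sub>R off_gen l T)"
    by (intro C_on_add C_on_const C_on_linear_compose[where L="\<lambda>X. (-1) *\<^sub>R X"] open_UNIV)
      (simp_all add: linear_iff)
  ultimately show ?thesis
    unfolding cayley_def
    by (intro C_on_bilinear[OF open_UNIV bounded_bilinear_matrix_mult] C_on_add C_on_const
        C_on_matrix_inv open_UNIV det_one_minus_skew off_skew(2)[OF off_gen_in_off]) simp_all
qed

lemma C_on_slice_map: "C_on r UNIV (slice_map l)"
  unfolding slice_map_def
  by (intro C_on_bilinear[OF open_UNIV bounded_bilinear_matrix_mult] C_on_add C_on_const
      C_on_cayley_off_gen open_UNIV C_on_linear[OF linear_off_rest]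
      C_on_linear_compose[OF open_UNIV linear_transpose])

text \<open>Differentiating \<open>cayley B (1 - B) = 1 + B\<close> at \<open>B = 0\<close> gives the derivative \<open>2 B\<close>.\<close>

lemma cayley_off_gen_has_derivative:
  "((\<lambda>T. cayley (off_gen l T)) has_derivative (\<lambda>T. 2 *\<^sub>R off_gen l T)) (at 0)"
proof -
  let ?b = "off_gen l" and ?F = "\<lambda>T. cayley (off_gen l T)"
  let ?D = "frechet_derivative ?F (at 0)"
  have b: "(?b has_derivative ?b) (at 0)" by (rule linear_imp_has_derivative[OF linear_off_gen])
  have b0: "?b 0 = 0" by (rule linear_0[OF linear_off_gen])
  have F: "(?F has_derivative ?D) (at 0)"
    by (rule C_on_Suc_derivative[OF C_on_cayley_off_gen]) simp
  have "((\<lambda>T. ?F T ** (mat 1 - ?b T)) has_derivative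
      (\<lambda>T. ?F 0 ** (0 - ?b T) + ?D T ** (mat 1 - ?b 0))) (at 0)"
    by (intro has_derivative_matrix_mult F has_derivative_diff has_derivative_const b)
  moreover have "(\<lambda>T. ?F T ** (mat 1 - ?b T)) = (\<lambda>T. mat 1 + ?b T)"
  proof
    fix T
    have "matrix_inv (mat 1 - ?b T) ** (mat 1 - ?b T) = mat 1"
      by (rule matrix_inv_mult(2)[OF det_one_minus_skew[OF off_skew(2)[OF off_gen_in_off]]])
    then show "?F T ** (mat 1 - ?b T) = mat 1 + ?b T"
      by (simp add: cayley_def matrix_mul_assoc[symmetric])
  qed
  moreover have "((\<lambda>T. mat 1 + ?b T) has_derivative (\<lambda>T. 0 + ?b T)) (at 0)"
    by (intro has_derivative_add has_derivative_const b)
  ultimately have eq: "(\<lambda>T. ?F 0 ** (0 - ?b T) + ?D T ** (mat 1 - ?b 0)) = (\<lambda>T. 0 + ?b T)"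
    by (intro has_derivative_unique) simp_all
  have "?D T - ?b T = ?b T" for T
    using fun_cong[OF eq, of T] by (simp add: b0 cayley_0)
  then have "?D = (\<lambda>T. 2 *\<^sub>R ?b T)"
    by (simp add: fun_eq_iff scaleR_2 diff_eq_eq)
  then show ?thesis using F by simp
qed

lemma slice_map_has_derivative: "(slice_map l has_derivative (\<lambda>T. T)) (at 0)"
proof -
  let ?b = "off_gen l" and ?F = "\<lambda>T. cayley (off_gen l T)" and ?e = "off_rest l"
  have z: "?b 0 = 0" "?e 0 = 0" by (simp_all add: linear_0 linear_off_gen linear_off_rest)
  note F = cayley_off_gen_has_derivative[of l]
  have tF: "((\<lambda>T. transpose (?F T)) has_derivative (\<lambda>T. transpose (2 *\<^sub>R ?b T))) (at 0)"
    using bounded_linear.has_derivative[OF _ F] linear_transpose linear_conv_bounded_linear by blast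
  have e: "((\<lambda>T. Lam l + ?e T) has_derivative (\<lambda>T. 0 + ?e T)) (at 0)"
    by (intro has_derivative_add has_derivative_const linear_imp_has_derivative linear_off_rest)
  have "(slice_map l has_derivative (\<lambda>T. ?F 0 ** (Lam l + ?e 0) ** transpose (2 *\<^sub>R ?b T) +
      (?F 0 ** (0 + ?e T) + 2 *\<^sub>R ?b T ** (Lam l + ?e 0)) ** transpose (?F 0))) (at 0)"
    unfolding slice_map_def by (intro has_derivative_matrix_mult F e tF)
  moreover have "?F 0 ** (Lam l + ?e 0) ** transpose (2 *\<^sub>R ?b T) +
      (?F 0 ** (0 + ?e T) + 2 *\<^sub>R ?b T ** (Lam l + ?e 0)) ** transpose (?F 0) = T" for T
  proof -
    have tb: "transpose (2 *\<^sub>R ?b T) = 2 *\<^sub>R (- ?b T)"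
      unfolding transpose_scaleR off_skew(2)[OF off_gen_in_off[of l T]] ..
    have "Lam l ** (2 *\<^sub>R (- ?b T)) + (?e T + 2 *\<^sub>R ?b T ** Lam l) = off_tangent l (?b T) + ?e T"
      by (simp add: vec_eq_iff mult_Lam Lam_mult off_tangent_def algebra_simps)
    then show ?thesis
      by (simp add: z cayley_0 transpose_mat tb off_decomposition)
  qed
  ultimately show ?thesis by simp
qed

lemma slice_map_0: "slice_map l 0 = Lam l"
  by (simp add: slice_map_def linear_0 linear_off_gen linear_off_rest cayley_0 transpose_mat)

text \<open>Near the diagonal matrix the orbit consists of the points whose transversal coordinate
  vanishes, so the tangential coordinate is a chart of the orbit, and the Cayley transform of that
  coordinate is a smooth choice of a rotation diagonalising the point.\<close>

theorem orbit_chart_with_section_at_Lam: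
  fixes l :: "'n::finite \<Rightarrow> real"
  obtains U c \<sigma> where "(U, c) \<in> submanifold_atlas (off l) (orbit l)" "Lam l \<in> U"
    "smooth_on U \<sigma>" "\<And>X. X \<in> U \<Longrightarrow> \<sigma> X \<in> SO" "\<And>X. X \<in> U \<Longrightarrow> \<sigma> X ** Lam l ** transpose (\<sigma> X) = X"
    "\<sigma> (Lam l) = mat 1"
proof -
  \<comment> \<open>The inverse function theorem needs coordinates indexed by a finite type.\<close>
  define J :: "'n sqmat \<Rightarrow> real^('n \<times> 'n)" where "J T = (\<chi> p. T $ fst p $ snd p)" for T
  define J' :: "real^('n \<times> 'n) \<Rightarrow> 'n sqmat" where "J' z = (\<chi> i j. z $ (i, j))" for z
  have J: "linear J" "linear J'" "\<And>T. J' (J T) = T" "\<And>z. J (J' z) = z"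
    by (simp_all add: J_def J'_def linear_iff vec_eq_iff)
  obtain U' V g where UV: "open U'" "0 \<in> U'" "open V" "Lam l \<in> V" "homeomorphism U' V (slice_map l) g"
    and g: "\<And>r. C_on r V g"
    using smooth_inverse_function[OF open_UNIV UNIV_I C_on_slice_map slice_map_has_derivative J]
    unfolding slice_map_0 by metis
  have gV: "g X \<in> U'" "slice_map l (g X) = X" if "X \<in> V" for X
    using UV(5) that unfolding homeomorphism_def by auto
  have gU: "slice_map l T \<in> V" "g (slice_map l T) = T" if "T \<in> U'" for T
    using UV(5) that unfolding homeomorphism_def by auto
  let ?gaps = "{\<bar>l s - l r\<bar> | r s. l r \<noteq> l s}"
  have fin: "finite ?gaps" by (rule finite_subset[of _ "range (\<lambda>(r, s). \<bar>l s - l r\<bar>)"]) auto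
  \<comment> \<open>The extra element \<open>1\<close> keeps the minimum defined when there is only one eigenvalue.\<close>
  define \<epsilon> where "\<epsilon> = Min (insert 1 ?gaps)"
  have \<epsilon>: "\<epsilon> > 0" "\<And>r s. l r \<noteq> l s \<Longrightarrow> \<epsilon> \<le> \<bar>l s - l r\<bar>"
    using fin by (auto simp: \<epsilon>_def intro!: Min_le)
  define \<delta> where "\<delta> = \<epsilon> / (2 * real CARD('n))"
  have \<delta>: "\<delta> > 0" "real CARD('n) * \<delta> < \<epsilon>" using \<epsilon>(1) by (simp_all add: \<delta>_def)
  define U where "U = U' \<inter> {T. norm (off_rest l T) < \<delta>}"
  have "open {T. norm (off_rest l T) < \<delta>}"
    by (intro open_Collect_less continuous_intros linear_continuous_on)
      (simp add: linear_off_rest linear_conv_bounded_linear[symmetric])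
  then have U: "open U" "0 \<in> U" "U \<subseteq> U'"
    using UV(1,2) \<delta>(1) by (auto simp: U_def linear_0 linear_off_rest)
  define W where "W = V \<inter> g -` U"
  have W: "open W" "Lam l \<in> W"
  proof -
    show "open W"
      unfolding W_def by (rule continuous_open_preimage[OF C_on_imp_continuous[OF g] UV(3) U(1)])
    show "Lam l \<in> W" using UV(4) U gU(2)[of 0] by (auto simp: W_def slice_map_0)
  qed
  let ?c = "\<lambda>X. off_gen l (g X)"
  \<comment> \<open>Rotating a point of the orbit back by its tangential coordinate leaves the diagonal matrix plus
    the transversal coordinate, still a point of the orbit and hence symmetric; so the transversal
    coordinate is block diagonal and the spectral gap applies.\<close>
  have rest: "off_rest l (g X) = 0" if X: "X \<in> orbit l" "X \<in> W" for X
  proof (rule block_perturbation_in_orbit_eq_0)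
    define T where "T = g X"
    define R where "R = cayley (off_gen l T)"
    have R: "R \<in> SO" unfolding R_def by (rule cayley_SO[OF off_skew(2)[OF off_gen_in_off]])
    have XT: "X = R ** (Lam l + off_rest l T) ** transpose R"
      using gV(2)[of X] X(2) by (simp add: W_def slice_map_def R_def T_def)
    have RXR: "transpose R ** X ** R = Lam l + off_rest l T"
      unfolding XT by (simp add: matrix_mul_assoc SO_mult_transpose[OF R] SO_cancel[OF R])
    obtain Q where Q: "Q \<in> SO" "X = Q ** Lam l ** transpose Q" using X(1) unfolding orbit_def by blast
    have "transpose R ** X ** R = (transpose R ** Q) ** Lam l ** transpose (transpose R ** Q)"
      by (simp add: Q(2) matrix_transpose_mul matrix_mul_assoc)
    then have orb: "Lam l + off_rest l T \<in> orbit l"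
      unfolding orbit_def using RXR SO_mult[OF SO_transpose[OF R] Q(1)] by auto
    then show "Lam l + off_rest l (g X) \<in> orbit l" by (simp add: T_def)
    show "off_rest l (g X) $ r $ s = 0" if "l r \<noteq> l s" for r s
    proof -
      have "off_rest l T $ s $ r = off_rest l T $ r $ s"
        using arg_cong[OF orbit_symmetric[OF orb], of "\<lambda>M. M $ r $ s"] that
        by (cases "r = s") (auto simp: transpose_def Lam_def)
      then show ?thesis using that by (simp add: off_rest_def T_def)
    qed
    show "\<bar>off_rest l (g X) $ r $ s\<bar> \<le> \<delta>" for r s
      using X(2) component_le_norm_cart[of "off_rest l (g X) $ r" s] Finite_Cartesian_Product.norm_nth_le[of "off_rest l (g X)" r]
      by (auto simp: W_def U_def)
    show "real CARD('n) * \<delta> < \<bar>l s - l r\<bar>" if "l r \<noteq> l s" for r s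
      using \<delta>(2) \<epsilon>(2)[OF that] by linarith
  qed
  have gX: "g X = off_tangent l (?c X)" if "X \<in> orbit l" "X \<in> W" for X
    using off_decomposition[of l "g X"] rest[OF that] by simp
  have X: "X = cayley (?c X) ** Lam l ** transpose (cayley (?c X))" if "X \<in> orbit l" "X \<in> W" for X
    using gV(2)[of X] that(2) rest[OF that] by (simp add: W_def slice_map_def)
  have slice: "slice_map l (off_tangent l B) \<in> orbit l \<inter> W" "?c (slice_map l (off_tangent l B)) = B"
    if B: "B \<in> off l" "off_tangent l B \<in> U" for B
  proof -
    have "g (slice_map l (off_tangent l B)) = off_tangent l B" "slice_map l (off_tangent l B) \<in> V"
      using gU B(2) U(3) by auto
    moreover have "slice_map l (off_tangent l B) \<in> orbit l"
      using cayley_SO[OF off_skew(2)[OF B(1)]]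
      by (auto simp: slice_map_def off_gen_tangent[OF B(1)] off_rest_tangent[OF B(1)] orbit_def)
    ultimately show "slice_map l (off_tangent l B) \<in> orbit l \<inter> W"
      "?c (slice_map l (off_tangent l B)) = B"
      using B off_gen_tangent by (auto simp: W_def)
  qed
  have im: "?c ` (orbit l \<inter> W) = off l \<inter> off_tangent l -` U"
  proof (intro equalityI subsetI)
    fix B assume "B \<in> off l \<inter> off_tangent l -` U"
    then show "B \<in> ?c ` (orbit l \<inter> W)" using slice by (metis Int_iff image_eqI vimageE)
  qed (use off_gen_in_off gX in \<open>auto simp: W_def\<close>)
  have inj: "inj_on ?c (orbit l \<inter> W)"
    using X by (intro inj_onI) (metis IntD1 IntD2)
  have inv: "inv_into (orbit l \<inter> W) ?c B = slice_map l (off_tangent l B)" if "B \<in> ?c ` (orbit l \<inter> W)" for B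
    using that slice unfolding im by (intro inv_into_f_eq[OF inj]) auto
  have smooth_c: "smooth_on (orbit l \<inter> W) ?c"
    using W(1) g by (intro C_on_imp_smooth_on[OF W(1)] C_on_linear_compose[OF W(1) linear_off_gen])
      (auto simp: W_def intro: C_on_subset)
  have "smooth_on (?c ` (orbit l \<inter> W)) (\<lambda>B. slice_map l (off_tangent l B))"
    by (intro smooth_on_compose[OF smooth_on_linear[OF linear_off_tangent]
          C_on_imp_smooth_on[OF open_UNIV subset_UNIV C_on_slice_map]]) auto
  then have smooth_inv: "smooth_on (?c ` (orbit l \<inter> W)) (inv_into (orbit l \<inter> W) ?c)"
    by (subst smooth_on_cong[OF inv])
  have "open (off_tangent l -` U)"
    using U(1) linear_off_tangent[of l]
    by (intro open_vimage linear_continuous_on) (simp_all add: linear_conv_bounded_linear[symmetric])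
  then have "(orbit l \<inter> W, ?c) \<in> submanifold_atlas (off l) (orbit l)"
    unfolding submanifold_atlas_def using W(1) inj smooth_c smooth_inv
    by (auto simp: im openin_open)
  moreover have "Lam l \<in> orbit l \<inter> W"
    using W(2) SO_id unfolding orbit_def by (auto intro!: exI[of _ "mat 1"] simp: transpose_mat)
  moreover have "smooth_on (orbit l \<inter> W) (\<lambda>X. cayley (off_gen l (g X)))"
    by (rule smooth_on_compose[OF _ C_on_imp_smooth_on[OF open_UNIV subset_UNIV C_on_cayley_off_gen]])
      (auto intro!: C_on_imp_smooth_on[OF W(1)] C_on_subset[OF g] simp: W_def)
  moreover have "cayley (off_gen l (g (Lam l))) = mat 1"
    using gU(2)[of 0] UV(2) by (simp add: slice_map_0 linear_0[OF linear_off_gen] cayley_0)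
  moreover have "cayley (?c X) \<in> SO" for X
    by (rule cayley_SO[OF off_skew(2)[OF off_gen_in_off]])
  ultimately show thesis using that[of "orbit l \<inter> W" ?c "\<lambda>X. cayley (off_gen l (g X))"] X by auto
qed

section \<open>Charts and local sections along an orbit\<close>

lemma atlas_iso_submanifold_linear:
  fixes L :: "'x::euclidean_space \<Rightarrow> 'y::euclidean_space" and V :: "'e::euclidean_space set"
  assumes L: "linear L" "linear L'" "\<And>x. L' (L x) = x" "\<And>y. L (L' y) = y" and S: "L ` S = S'"
  shows "atlas_iso S (submanifold_atlas V S) S' (submanifold_atlas V S') L L'"
proof -
  have chart: "(L ` U, c \<circ> L') \<in> submanifold_atlas V S'"
    if L: "linear L" "linear L'" "\<And>x. L' (L x) = x" "\<And>y. L (L' y) = y" and S: "L ` S = S'"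
      and U: "(U, c) \<in> submanifold_atlas V S"
    for L :: "'u::euclidean_space \<Rightarrow> 'w::euclidean_space" and L' S S' U and c :: "'u \<Rightarrow> 'e"
  proof -
    note c = submanifold_atlasD[OF U]
    have im: "(c \<circ> L') ` L ` U = c ` U" by (simp add: image_image L(3))
    have inj: "inj_on (c \<circ> L') (L ` U)" using c(3) by (auto simp: inj_on_def L(3))
    obtain T where T: "open T" "U = S \<inter> T" using c(1) openin_open by metis
    have "L ` U = S' \<inter> L' -` T" unfolding T(2) S[symmetric] using L(3,4) by (auto simp: image_iff)
    moreover have "open (L' -` T)"
      using T(1) L(2) by (intro open_vimage linear_continuous_on) (simp_all add: linear_conv_bounded_linear)
    ultimately have "openin (top_of_set S') (L ` U)" using openin_open by metis
    moreover have "smooth_on (L ` U) (c \<circ> L')"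
      using smooth_on_compose[OF smooth_on_linear[OF L(2)] c(4), of "L ` U"] L(3)
      by (auto simp: o_def image_image)
    moreover have "smooth_on (c ` U) (inv_into (L ` U) (c \<circ> L'))"
    proof (subst smooth_on_cong)
      show "smooth_on (c ` U) (\<lambda>u. L (inv_into U c u))"
        by (rule smooth_on_compose[OF c(5) smooth_on_linear[OF L(1)] subset_UNIV])
      show "inv_into (L ` U) (c \<circ> L') u = L (inv_into U c u)" if "u \<in> c ` U" for u
        using inv_into_into[OF that] f_inv_into_f[OF that] by (intro inv_into_f_eq[OF inj]) (auto simp: L(3))
    qed
    ultimately show ?thesis using c(2) inj unfolding submanifold_atlas_def by (simp only: im mem_Collect_eq case_prod_conv)
  qed
  have S': "L' ` S' = S" unfolding S[symmetric] by (simp add: image_image L(3))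
  show ?thesis
    unfolding atlas_iso_def
  proof (intro conjI ballI)
    show "L x \<in> S'" "L' (L x) = x" if "x \<in> S" for x using that S L(3) by auto
    show "L' y \<in> S" "L (L' y) = y" if "y \<in> S'" for y using that S' L(4) by auto
    show "case ch of (U, c) \<Rightarrow> U \<subseteq> S \<and> (L ` U, c \<circ> L') \<in> submanifold_atlas V S'"
      if "ch \<in> submanifold_atlas V S" for ch
      using that chart[OF L S, of "fst ch" "snd ch"] submanifold_atlasD(6)[of "fst ch" "snd ch" V S]
      by (simp add: case_prod_unfold)
    show "case ch of (U, c) \<Rightarrow> U \<subseteq> S' \<and> (L' ` U, c \<circ> L) \<in> submanifold_atlas V S"
      if "ch \<in> submanifold_atlas V S'" for ch
      using that chart[OF L(2,1,4,3) S', of "fst ch" "snd ch"]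
        submanifold_atlasD(6)[of "fst ch" "snd ch" V S'] by (simp add: case_prod_unfold)
  qed
qed

lemma atlas_iso_comp:
  assumes f: "atlas_iso M A N B f f'" and g: "atlas_iso N B K C g g'"
  shows "atlas_iso M A K C (g \<circ> f) (f' \<circ> g')"
proof -
  interpret f: atlas_isomorphism M A N B f f' using f by (simp add: atlas_isomorphism_def)
  interpret g: atlas_isomorphism N B K C g g' using g by (simp add: atlas_isomorphism_def)
  have "((g \<circ> f) ` U, c \<circ> (f' \<circ> g')) \<in> C" if "(U, c) \<in> A" for U c
    using g.chart_image[OF f.chart_image[OF that]] by (simp add: image_comp o_assoc)
  moreover have "((f' \<circ> g') ` U, c \<circ> (g \<circ> f)) \<in> A" if "(U, c) \<in> C" for U c
    using f.chart_preimage[OF g.chart_preimage[OF that]] by (simp add: image_comp o_assoc)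
  ultimately show ?thesis
    unfolding atlas_iso_def
    using f.f_in g.f_in f.f'f g.f'f f.f'_in g.f'_in f.ff' g.ff' f.chart_subset[THEN subsetD]
      g.chart_subset'[THEN subsetD]
    by (intro conjI ballI) (auto simp del: image_comp)
qed

definition conj_by :: "'n::finite sqmat \<Rightarrow> 'n sqmat \<Rightarrow> 'n sqmat" where
  "conj_by Q X = Q ** X ** transpose Q"

lemma linear_conj_by: "linear (conj_by Q)"
  unfolding conj_by_def
  by (intro linear_compose[of "\<lambda>X. Q ** X" "\<lambda>X. X ** transpose Q", unfolded o_def]
      bounded_linear.linear bounded_bilinear.bounded_linear_left[OF bounded_bilinear_matrix_mult]
      bounded_bilinear.bounded_linear_right[OF bounded_bilinear_matrix_mult])

lemma conj_by_inverse:
  assumes "Q \<in> SO"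
  shows "conj_by (transpose Q) (conj_by Q X) = X" "conj_by Q (conj_by (transpose Q) X) = X"
  by (simp_all add: conj_by_def matrix_mul_assoc SO_mult_transpose[OF assms] SO_cancel[OF assms])

lemma conj_by_mult: "conj_by Q (conj_by R X) = conj_by (Q ** R) X"
  by (simp add: conj_by_def matrix_transpose_mul matrix_mul_assoc)

lemma conj_by_id: "conj_by (mat 1) X = X"
  by (simp add: conj_by_def transpose_mat)

lemma orbit_eq: "orbit l = (\<lambda>Q. conj_by Q (Lam l)) ` SO"
  by (auto simp: orbit_def conj_by_def)

lemma conj_by_orbit:
  assumes "Q \<in> SO"
  shows "conj_by Q ` orbit l = orbit l"
proof (intro equalityI subsetI)
  fix X assume "X \<in> orbit l"
  then obtain R where R: "R \<in> SO" "X = conj_by R (Lam l)" unfolding orbit_eq by blast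
  have "conj_by (transpose Q) X \<in> orbit l"
    unfolding orbit_eq R(2) conj_by_mult using SO_mult[OF SO_transpose[OF assms] R(1)] by blast
  then show "X \<in> conj_by Q ` orbit l" using conj_by_inverse(2)[OF assms, of X] by (metis imageI)
qed (use SO_mult[OF assms] in \<open>auto simp: orbit_eq conj_by_mult\<close>)

abbreviation orbit_atlas :: "('n::finite \<Rightarrow> real) \<Rightarrow> ('n sqmat, 'n sqmat) chart set" where
  "orbit_atlas l \<equiv> submanifold_atlas (off l) (orbit l)"

lemma atlas_iso_conj_by:
  assumes "Q \<in> SO"
  shows "atlas_iso (orbit l) (orbit_atlas l) (orbit l) (orbit_atlas l)
    (conj_by Q) (conj_by (transpose Q))"
  by (rule atlas_iso_submanifold_linear[OF linear_conj_by linear_conj_by conj_by_inverse[OF assms]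
        conj_by_orbit[OF assms]])

text \<open>Conjugation by a rotation moves the slice at the diagonal matrix to any other point of the orbit.\<close>

theorem orbit_chart_with_section:
  fixes l :: "'n::finite \<Rightarrow> real"
  assumes Q: "Q \<in> SO"
  obtains U c \<sigma> where "(U, c) \<in> orbit_atlas l" "conj_by Q (Lam l) \<in> U"
    "smooth_on U \<sigma>" "\<And>X. X \<in> U \<Longrightarrow> \<sigma> X \<in> SO" "\<And>X. X \<in> U \<Longrightarrow> conj_by (\<sigma> X) (Lam l) = X"
    "\<sigma> (conj_by Q (Lam l)) = Q"
proof -
  obtain U c \<sigma> where U: "(U, c) \<in> orbit_atlas l" "Lam l \<in> U" "smooth_on U \<sigma>"
    "\<And>X. X \<in> U \<Longrightarrow> \<sigma> X \<in> SO" "\<And>X. X \<in> U \<Longrightarrow> conj_by (\<sigma> X) (Lam l) = X" "\<sigma> (Lam l) = mat 1"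
    using orbit_chart_with_section_at_Lam[of l] unfolding conj_by_def by metis
  interpret atlas_isomorphism "orbit l" "orbit_atlas l" "orbit l" "orbit_atlas l"
    "conj_by Q" "conj_by (transpose Q)"
    using atlas_iso_conj_by[OF Q] by (simp add: atlas_isomorphism_def)
  let ?\<sigma> = "\<lambda>X. Q ** \<sigma> (conj_by (transpose Q) X)"
  have inv: "conj_by (transpose Q) X \<in> U" if "X \<in> conj_by Q ` U" for X
    using that by (auto simp: conj_by_inverse[OF Q])
  have "linear (\<lambda>X. Q ** X)"
    by (intro bounded_linear.linear bounded_bilinear.bounded_linear_right[OF bounded_bilinear_matrix_mult])
  then have "smooth_on (conj_by Q ` U) ?\<sigma>"
    by (intro smooth_on_compose[OF smooth_on_compose[OF smooth_on_linear[OF linear_conj_by] U(3)]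
          smooth_on_linear[of "\<lambda>X. Q ** X"] subset_UNIV]) (auto simp: inv)
  moreover have "conj_by (?\<sigma> X) (Lam l) = X" if "X \<in> conj_by Q ` U" for X
    using U(5)[OF inv[OF that]] by (simp add: conj_by_mult[symmetric] conj_by_inverse[OF Q])
  ultimately show thesis
    using that[of "conj_by Q ` U" "c \<circ> conj_by (transpose Q)" ?\<sigma>] chart_image[OF U(1)] U(2,4,6) inv
      SO_mult[OF Q] by (simp add: conj_by_inverse[OF Q])
qed

lemma orbit_cover: "\<Union>(fst ` orbit_atlas l) = orbit l"
proof (intro equalityI subsetI)
  fix X assume "X \<in> orbit l"
  then obtain Q where "Q \<in> SO" "X = conj_by Q (Lam l)" unfolding orbit_eq by blast
  then obtain U c where "(U, c) \<in> orbit_atlas l" "X \<in> U" using orbit_chart_with_section by metis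
  then show "X \<in> \<Union>(fst ` orbit_atlas l)" by force
qed (use submanifold_atlasD(6) in fastforce)

lemmas smooth_manifold_orbit = smooth_manifold_submanifold[OF subspace_off orbit_cover]

lemma riemannian_metric_orbit: "riemannian_metric (off l) (orbit_atlas l) isospectral_metric"
  by (rule riemannian_metric_trace[OF subspace_off orbit_cover orbit_symmetric])

section \<open>Velocities in the orbit\<close>

text \<open>The orbit map has differential \<open>B \<mapsto> [B, \<Lambda>]\<close> at the identity.\<close>

lemma conj_by_Lam_has_vector_derivative:
  assumes "(E has_vector_derivative B) (at 0)" "E 0 = mat 1" "transpose B = - B"
  shows "((\<lambda>s. conj_by (E s) (Lam l)) has_vector_derivative B ** Lam l - Lam l ** B) (at 0)"
proof -
  have tE: "((\<lambda>s. transpose (E s)) has_vector_derivative transpose B) (at 0)"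
    using bounded_linear.has_vector_derivative[OF _ assms(1)] linear_transpose linear_conv_bounded_linear
    by blast
  have "((\<lambda>s. E s ** Lam l) has_vector_derivative E 0 ** 0 + B ** Lam l) (at 0)"
    by (intro bounded_bilinear.has_vector_derivative[OF bounded_bilinear_matrix_mult] assms(1)
        has_vector_derivative_const)
  from bounded_bilinear.has_vector_derivative[OF bounded_bilinear_matrix_mult this tE]
  show ?thesis
    using assms(2,3) bounded_bilinear.minus_right[OF bounded_bilinear_matrix_mult, of "Lam l" B]
      bounded_bilinear.zero_right[OF bounded_bilinear_matrix_mult]
    by (simp add: conj_by_def)
qed

lemma C_on_cayley_curve:
  assumes "B \<in> off l"
  shows "C_on r UNIV (\<lambda>s::real. cayley ((s / 2) *\<^sub>R B))"
    and "((\<lambda>s::real. cayley ((s / 2) *\<^sub>R B)) has_vector_derivative B) (at 0)"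
proof -
  let ?T = "off_tangent l B"
  have "off_gen l (s *\<^sub>R ((1 / 2) *\<^sub>R ?T)) = (s / 2) *\<^sub>R B" for s
    by (simp add: linear_cmul[OF linear_off_gen] off_gen_tangent[OF assms])
  then have eq: "(\<lambda>s. cayley ((s / 2) *\<^sub>R B)) = (\<lambda>s. cayley (off_gen l (s *\<^sub>R ((1 / 2) *\<^sub>R ?T))))"
    by simp
  have lin: "linear (\<lambda>s::real. s *\<^sub>R ((1 / 2) *\<^sub>R ?T))"
    by (simp add: linear_iff scaleR_add_left[symmetric] add_divide_distrib)
  show "C_on r UNIV (\<lambda>s::real. cayley ((s / 2) *\<^sub>R B))"
    unfolding eq
    by (rule C_on_compose[OF open_UNIV open_UNIV subset_UNIV C_on_linear[OF lin] C_on_cayley_off_gen])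
  have "((\<lambda>T. cayley (off_gen l T)) \<circ> (\<lambda>s::real. s *\<^sub>R ((1 / 2) *\<^sub>R ?T)) has_derivative
      (\<lambda>T. 2 *\<^sub>R off_gen l T) \<circ> (\<lambda>s. s *\<^sub>R ((1 / 2) *\<^sub>R ?T))) (at 0)"
    using cayley_off_gen_has_derivative linear_imp_has_derivative[OF lin]
    by (intro diff_chain_at) simp_all
  then show "((\<lambda>s::real. cayley ((s / 2) *\<^sub>R B)) has_vector_derivative B) (at 0)"
    unfolding eq has_vector_derivative_def
    by (simp add: o_def linear_cmul[OF linear_off_gen] off_gen_tangent[OF assms])
qed

section \<open>The quotient and the orbit have the same charts\<close>

text \<open>The cosets \<open>QH\<close> are the fibres of the conjugation map \<open>Q \<mapsto> Q \<Lambda> Q\<^sup>T\<close>, since \<open>H\<close> consists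
  of the rotations commuting with the diagonal matrix. The locale records what the block structure
  contributes to the geometry.\<close>

locale flag_blocks =
  fixes p :: nat and k :: "nat \<Rightarrow> nat" and a :: "nat \<Rightarrow> real" and l :: "'n::{finite,linorder} \<Rightarrow> real"
  assumes blocks_eq: "SO_blocks p k = {X \<in> SO. X ** Lam l = Lam l ** X}"
    and m_eq: "flag_m p k = off l"
    and Lambda_eq: "flag_Lambda p k a = Lam l"
    and inner_eq: "\<And>B C. B \<in> off l \<Longrightarrow> C \<in> off l \<Longrightarrow> flag_m_inner p k a B C =
      trace ((B ** Lam l - Lam l ** B) ** (C ** Lam l - Lam l ** C))"
begin

abbreviation "coset \<equiv> flag_coset p k :: 'n sqmat \<Rightarrow> 'n sqmat set"
abbreviation "Quot \<equiv> flag_quotient p k :: 'n sqmat set set"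
abbreviation "quot_atlas \<equiv> flag_quotient_atlas p k :: ('n sqmat set, 'n sqmat) chart set"
abbreviation "\<phi> \<equiv> flag_map p k a :: 'n sqmat set \<Rightarrow> 'n sqmat"

definition fibre :: "'n sqmat \<Rightarrow> 'n sqmat set" where
  "fibre X = {R \<in> SO. conj_by R (Lam l) = X}"

lemma isospectral_eq: "isospectral_flag p k a = orbit l"
  by (simp add: isospectral_flag_def orbit_def Lambda_eq)

lemma isospectral_atlas_eq: "isospectral_atlas p k a = orbit_atlas l"
  by (simp add: isospectral_atlas_def isospectral_eq m_eq)

lemma coset_eq_fibre:
  assumes Q: "Q \<in> SO"
  shows "coset Q = fibre (conj_by Q (Lam l))"
proof (intro equalityI subsetI)
  fix R assume "R \<in> coset Q"
  then obtain h where h: "h \<in> SO" "h ** Lam l = Lam l ** h" "R = Q ** h"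
    unfolding flag_coset_def blocks_eq by blast
  have "conj_by h (Lam l) = Lam l" unfolding conj_by_def h(2) by (rule SO_cancel[OF h(1)])
  then show "R \<in> fibre (conj_by Q (Lam l))"
    using h SO_mult[OF Q h(1)] by (simp add: fibre_def conj_by_mult[symmetric])
next
  fix R assume "R \<in> fibre (conj_by Q (Lam l))"
  then have R: "R \<in> SO" "conj_by R (Lam l) = conj_by Q (Lam l)" by (auto simp: fibre_def)
  let ?h = "transpose Q ** R"
  have h: "?h \<in> SO" by (rule SO_mult[OF SO_transpose[OF Q] R(1)])
  have "conj_by ?h (Lam l) = Lam l"
    using R(2) by (simp add: conj_by_mult[symmetric] conj_by_inverse[OF Q])
  then have "?h ** Lam l = Lam l ** ?h"
    unfolding conj_by_def using SO_cancel(4)[OF h] by metis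
  moreover have "R = Q ** ?h" by (simp add: SO_cancel[OF Q])
  ultimately show "R \<in> coset Q" unfolding flag_coset_def blocks_eq using h by blast
qed

lemma mem_coset: "Q \<in> SO \<Longrightarrow> Q \<in> coset Q"
  by (simp add: coset_eq_fibre fibre_def)

lemma coset_in_Quot: "Q \<in> SO \<Longrightarrow> coset Q \<in> Quot"
  by (simp add: flag_quotient_def)

lemma QuotE:
  assumes "x \<in> Quot"
  obtains Q where "Q \<in> SO" "x = coset Q"
  using assms by (auto simp: flag_quotient_def)

lemma flag_map_coset:
  assumes "Q \<in> SO"
  shows "\<phi> (coset Q) = conj_by Q (Lam l)"
  unfolding flag_map_def Lambda_eq
proof (rule the_equality)
  show "\<exists>R\<in>SO. coset Q = coset R \<and> conj_by Q (Lam l) = R ** Lam l ** transpose R"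
    using assms by (auto simp: conj_by_def)
  fix X assume "\<exists>R\<in>SO. coset Q = coset R \<and> X = R ** Lam l ** transpose R"
  then obtain R where R: "R \<in> SO" "coset Q = coset R" "X = conj_by R (Lam l)"
    by (auto simp: conj_by_def)
  have "R \<in> coset Q" using R(2) mem_coset[OF R(1)] by simp
  then show "X = conj_by Q (Lam l)" unfolding coset_eq_fibre[OF assms] R(3) by (simp add: fibre_def)
qed

lemma fibre_conj: "Q \<in> SO \<Longrightarrow> fibre (conj_by Q (Lam l)) = coset Q"
  by (simp add: coset_eq_fibre)

lemma mem_Union_iff:
  assumes "U \<subseteq> Quot"
  shows "R \<in> \<Union>U \<longleftrightarrow> R \<in> SO \<and> coset R \<in> U"
proof
  assume "R \<in> \<Union>U"
  then obtain x where x: "x \<in> U" "R \<in> x" by blast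
  then obtain Q where Q: "Q \<in> SO" "x = coset Q" using assms QuotE by blast
  then have R: "R \<in> SO" "conj_by R (Lam l) = conj_by Q (Lam l)"
    using x(2) by (auto simp: coset_eq_fibre fibre_def)
  then have "coset R = x" using Q by (simp add: coset_eq_fibre)
  then show "R \<in> SO \<and> coset R \<in> U" using R x by simp
qed (use mem_coset in blast)

lemma smooth_on_conj_Lam: "smooth_on S (\<lambda>Q. conj_by Q (Lam l))"
  unfolding conj_by_def
  by (intro smooth_on_bilinear[OF bounded_bilinear_matrix_mult] smooth_on_linear linear_transpose
      bounded_linear.linear bounded_bilinear.bounded_linear_left[OF bounded_bilinear_matrix_mult])

text \<open>A chart of the quotient is characterised by its smoothness on the rotation group and by smooth
  local lifts of its inverse. Composed with a smooth local section of \<open>Q \<mapsto> Q \<Lambda> Q\<^sup>T\<close> the former says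
  that the chart is smooth on the orbit; composed with the conjugation map the latter says
  that its inverse is smooth into the matrices. The same sections provide the lifts for a chart
  of the orbit.\<close>

theorem atlas_iso_flag_map: "atlas_iso Quot quot_atlas (orbit l) (orbit_atlas l) \<phi> fibre"
  unfolding atlas_iso_def
proof (intro conjI ballI)
  fix x assume "x \<in> Quot"
  then obtain Q where Q: "Q \<in> SO" "x = coset Q" using QuotE by blast
  show "\<phi> x \<in> orbit l" "fibre (\<phi> x) = x"
    using Q by (auto simp: flag_map_coset fibre_conj orbit_eq)
next
  fix X assume "X \<in> orbit l"
  then obtain Q where Q: "Q \<in> SO" "X = conj_by Q (Lam l)" unfolding orbit_eq by blast
  show "fibre X \<in> Quot" "\<phi> (fibre X) = X"
    using Q by (auto simp: flag_map_coset fibre_conj coset_in_Quot)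
next
  fix ch assume ch: "ch \<in> quot_atlas"
  obtain U c where Uc: "ch = (U, c)" by fastforce
  have U: "U \<subseteq> Quot" "openin (top_of_set SO) (\<Union>U)" "inj_on c U" "openin (top_of_set (off l)) (c ` U)"
    "smooth_on (\<Union>U) (\<lambda>Q. c (coset Q))"
    and sec: "\<And>x. x \<in> U \<Longrightarrow> \<exists>W \<tau>. openin (top_of_set (off l)) W \<and> c x \<in> W \<and> W \<subseteq> c ` U \<and>
        smooth_on W \<tau> \<and> (\<forall>w\<in>W. \<tau> w \<in> \<Union>U \<and> c (coset (\<tau> w)) = w)"
    using ch unfolding Uc flag_quotient_atlas_def m_eq by auto
  have fib: "fibre (\<phi> x) = x" if "x \<in> U" for x
    using U(1) that QuotE[of x] by (metis flag_map_coset fibre_conj subsetD)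
  have im: "(c \<circ> fibre) ` \<phi> ` U = c ` U" by (force simp: fib image_iff)
  have inj: "inj_on (c \<circ> fibre) (\<phi> ` U)" using U(3) by (auto simp: inj_on_def fib)
  \<comment> \<open>Near each of its points the image of \<open>U\<close> carries a smooth section with values over \<open>U\<close>; the section
    takes the value \<open>Q\<close> at the point, which lies over \<open>U\<close>, hence so do the nearby values.\<close>
  have loc: "\<exists>N \<sigma>. openin (top_of_set (orbit l)) N \<and> X \<in> N \<and> N \<subseteq> \<phi> ` U \<and> smooth_on N \<sigma> \<and>
      (\<forall>Y\<in>N. \<sigma> Y \<in> \<Union>U \<and> fibre Y = coset (\<sigma> Y))" if "X \<in> \<phi> ` U" for X
  proof -
    obtain Q where Q: "Q \<in> SO" "coset Q \<in> U" "X = conj_by Q (Lam l)"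
    proof -
      obtain x where x: "x \<in> U" "X = \<phi> x" using \<open>X \<in> \<phi> ` U\<close> by blast
      moreover obtain Q where "Q \<in> SO" "x = coset Q" using U(1) x(1) by (blast elim: QuotE)
      ultimately show ?thesis using flag_map_coset that by simp
    qed
    obtain U1 c1 \<sigma> where 1: "(U1, c1) \<in> orbit_atlas l" "X \<in> U1" "smooth_on U1 \<sigma>"
      "\<And>X. X \<in> U1 \<Longrightarrow> \<sigma> X \<in> SO" "\<And>X. X \<in> U1 \<Longrightarrow> conj_by (\<sigma> X) (Lam l) = X" "\<sigma> X = Q"
      using orbit_chart_with_section[OF Q(1), of l] unfolding Q(3) by metis
    let ?N = "U1 \<inter> \<sigma> -` \<Union>U"
    have "openin (top_of_set U1) ?N"
      using smooth_on_imp_continuous[OF 1(3)] U(2) 1(4) by (intro continuous_openin_preimage) auto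
    then have "openin (top_of_set (orbit l)) ?N"
      using submanifold_atlasD(1)[OF 1(1)] openin_trans by blast
    moreover have "X \<in> ?N" using 1(2,6) mem_coset[OF Q(1)] Q(2) by auto
    moreover have "fibre Y = coset (\<sigma> Y) \<and> Y \<in> \<phi> ` U" if "Y \<in> ?N" for Y
    proof -
      have s: "\<sigma> Y \<in> SO" "conj_by (\<sigma> Y) (Lam l) = Y" using 1 that by auto
      have "coset (\<sigma> Y) \<in> U" using that mem_Union_iff[OF U(1)] by auto
      then show ?thesis using s fibre_conj[OF s(1)] flag_map_coset[OF s(1)] by (metis imageI)
    qed
    moreover have "smooth_on ?N \<sigma>" using 1(3) by (rule smooth_on_subset) auto
    ultimately show ?thesis by (intro exI[of _ ?N] exI[of _ \<sigma>]) auto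
  qed
  have op: "openin (top_of_set (orbit l)) (\<phi> ` U)"
  proof (rule openin_subopen[THEN iffD2], rule ballI)
    fix X assume "X \<in> \<phi> ` U"
    from loc[OF this] show "\<exists>N. openin (top_of_set (orbit l)) N \<and> X \<in> N \<and> N \<subseteq> \<phi> ` U"
      by (elim exE conjE, intro exI conjI)
  qed
  have "smooth_on (\<phi> ` U) (c \<circ> fibre)"
  proof (rule smooth_on_local)
    fix X assume "X \<in> \<phi> ` U"
    then obtain N \<sigma> where N: "openin (top_of_set (orbit l)) N" "X \<in> N" "N \<subseteq> \<phi> ` U" "smooth_on N \<sigma>"
      "\<And>Y. Y \<in> N \<Longrightarrow> \<sigma> Y \<in> \<Union>U \<and> fibre Y = coset (\<sigma> Y)" using loc by metis
    have "smooth_on N (\<lambda>Y. c (coset (\<sigma> Y)))"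
      using N(5) by (intro smooth_on_compose[OF N(4) U(5)]) auto
    then have "smooth_on N (c \<circ> fibre)"
      by (subst smooth_on_cong[of N _ "\<lambda>Y. c (coset (\<sigma> Y))"]) (simp_all add: N(5))
    moreover have "openin (top_of_set (\<phi> ` U)) N"
      by (rule openin_subset_trans[OF N(1,3) openin_imp_subset[OF op]])
    ultimately show "\<exists>N. openin (top_of_set (\<phi> ` U)) N \<and> X \<in> N \<and> smooth_on N (c \<circ> fibre)"
      using N(2) by blast
  qed
  moreover have "smooth_on (c ` U) (inv_into (\<phi> ` U) (c \<circ> fibre))"
  proof (rule smooth_on_local)
    fix w assume "w \<in> c ` U"
    then obtain x where x: "x \<in> U" "w = c x" by blast
    obtain W \<tau> where W: "openin (top_of_set (off l)) W" "w \<in> W" "W \<subseteq> c ` U" "smooth_on W \<tau>"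
      "\<And>w. w \<in> W \<Longrightarrow> \<tau> w \<in> \<Union>U \<and> c (coset (\<tau> w)) = w"
      using sec[OF x(1)] by (elim exE conjE) (rule that, auto simp: x(2))
    have "inv_into (\<phi> ` U) (c \<circ> fibre) w = conj_by (\<tau> w) (Lam l)" if "w \<in> W" for w
    proof (rule inv_into_f_eq[OF inj])
      have t: "\<tau> w \<in> SO" "coset (\<tau> w) \<in> U" using W(5)[OF that] mem_Union_iff[OF U(1)] by auto
      show "conj_by (\<tau> w) (Lam l) \<in> \<phi> ` U" using t flag_map_coset by (metis imageI)
      show "(c \<circ> fibre) (conj_by (\<tau> w) (Lam l)) = w" using t W(5)[OF that] by (simp add: fibre_conj)
    qed
    moreover have "smooth_on W (\<lambda>w. conj_by (\<tau> w) (Lam l))"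
      by (rule smooth_on_compose[OF W(4) smooth_on_conj_Lam[of UNIV] subset_UNIV])
    ultimately have "smooth_on W (inv_into (\<phi> ` U) (c \<circ> fibre))"
      by (subst smooth_on_cong[of W _ "\<lambda>w. conj_by (\<tau> w) (Lam l)"]) simp_all
    moreover have "openin (top_of_set (c ` U)) W"
      by (rule openin_subset_trans[OF W(1,3) openin_imp_subset[OF U(4)]])
    ultimately show "\<exists>W. openin (top_of_set (c ` U)) W \<and> w \<in> W \<and> smooth_on W (inv_into (\<phi> ` U) (c \<circ> fibre))"
      using W(2) by blast
  qed
  ultimately show "case ch of (U, c) \<Rightarrow> U \<subseteq> Quot \<and> (\<phi> ` U, c \<circ> fibre) \<in> orbit_atlas l"
    using U op inj unfolding Uc submanifold_atlas_def by (simp only: im mem_Collect_eq case_prod_conv)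
next
  fix ch assume ch: "ch \<in> orbit_atlas l"
  obtain U c where Uc: "ch = (U, c)" by fastforce
  note U = submanifold_atlasD[OF ch[unfolded Uc]]
  have fib: "\<phi> (fibre X) = X" "fibre X \<in> Quot" if X: "X \<in> U" for X
  proof -
    obtain Q where Q: "Q \<in> SO" "X = conj_by Q (Lam l)" using U(6) X unfolding orbit_eq by blast
    then show "\<phi> (fibre X) = X" "fibre X \<in> Quot"
      by (simp_all add: flag_map_coset fibre_conj coset_in_Quot)
  qed
  have sub: "fibre ` U \<subseteq> Quot" using fib(2) by blast
  have im: "(c \<circ> \<phi>) ` fibre ` U = c ` U" by (force simp: fib image_iff)
  have inj: "inj_on (c \<circ> \<phi>) (fibre ` U)" using U(3) by (auto simp: inj_on_def fib)
  have Un: "\<Union>(fibre ` U) = SO \<inter> (\<lambda>Q. conj_by Q (Lam l)) -` U"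
    by (auto simp: fibre_def)
  have "openin (top_of_set SO) (\<Union>(fibre ` U))"
    unfolding Un using smooth_on_imp_continuous[OF smooth_on_conj_Lam]
    by (intro continuous_openin_preimage[OF _ _ U(1)]) (auto simp: orbit_eq)
  moreover have "smooth_on (\<Union>(fibre ` U)) (\<lambda>Q. (c \<circ> \<phi>) (coset Q))"
  proof (subst smooth_on_cong)
    show "smooth_on (\<Union>(fibre ` U)) (\<lambda>Q. c (conj_by Q (Lam l)))"
      by (rule smooth_on_compose[OF smooth_on_conj_Lam U(4)]) (auto simp: Un)
    show "(c \<circ> \<phi>) (coset Q) = c (conj_by Q (Lam l))" if "Q \<in> \<Union>(fibre ` U)" for Q
      using that unfolding Un by (simp add: flag_map_coset)
  qed
  moreover have "\<exists>W \<tau>. openin (top_of_set (off l)) W \<and> (c \<circ> \<phi>) x \<in> W \<and> W \<subseteq> (c \<circ> \<phi>) ` fibre ` U \<and>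
        smooth_on W \<tau> \<and> (\<forall>w\<in>W. \<tau> w \<in> \<Union>(fibre ` U) \<and> (c \<circ> \<phi>) (coset (\<tau> w)) = w)"
    if "x \<in> fibre ` U" for x
  proof -
    obtain X where X: "X \<in> U" "x = fibre X" using \<open>x \<in> fibre ` U\<close> by blast
    obtain Q where Q: "Q \<in> SO" "X = conj_by Q (Lam l)" using U(6) X unfolding orbit_eq by blast
    obtain U1 c1 \<sigma> where 1: "(U1, c1) \<in> orbit_atlas l" "X \<in> U1" "smooth_on U1 \<sigma>"
      "\<And>X. X \<in> U1 \<Longrightarrow> \<sigma> X \<in> SO" "\<And>X. X \<in> U1 \<Longrightarrow> conj_by (\<sigma> X) (Lam l) = X"
      using orbit_chart_with_section[OF Q(1), of l] unfolding Q(2) by metis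
    let ?W = "c ` (U \<inter> U1)" and ?\<tau> = "\<lambda>w. \<sigma> (inv_into U c w)"
    have inv: "inv_into U c (c Y) = Y" if "Y \<in> U" for Y using U(3) that by simp
    have "openin (top_of_set (off l)) ?W"
      using smooth_manifold_orbit[of l] 1(1) ch[unfolded Uc] unfolding smooth_manifold_def by blast
    moreover have "(c \<circ> \<phi>) x \<in> ?W" using X 1(2) by (simp add: fib)
    moreover have "smooth_on ?W ?\<tau>"
      using inv by (intro smooth_on_compose[OF smooth_on_subset[OF U(5)] 1(3)]) auto
    moreover have "?\<tau> w \<in> \<Union>(fibre ` U) \<and> (c \<circ> \<phi>) (coset (?\<tau> w)) = w" if "w \<in> ?W" for w
      using that 1(4,5) inv by (auto simp: Un flag_map_coset)
    ultimately show ?thesis unfolding im by (intro exI[of _ ?W] exI[of _ ?\<tau>]) auto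
  qed
  ultimately show "case ch of (U, c) \<Rightarrow> U \<subseteq> orbit l \<and> (fibre ` U, c \<circ> \<phi>) \<in> quot_atlas"
    using U(2,6) sub inj unfolding Uc flag_quotient_atlas_def m_eq mem_Collect_eq case_prod_conv im
    by blast
qed

end

section \<open>The matrix exponential\<close>

abbreviation mat_pow :: "'n::finite sqmat \<Rightarrow> nat \<Rightarrow> 'n sqmat" where
  "mat_pow B m \<equiv> ((**) B ^^ m) (mat 1)"

lemma mat_pow_scaleR: "mat_pow (s *\<^sub>R B) m = s ^ m *\<^sub>R mat_pow B m"
  by (induction m) (simp_all add: bounded_bilinear.scaleR_left[OF bounded_bilinear_matrix_mult]
      bounded_bilinear.scaleR_right[OF bounded_bilinear_matrix_mult] mult.commute)

lemma mat_pow_entry_bound: "\<bar>mat_pow B m $ i $ j\<bar> \<le> (\<Sum>i\<in>UNIV. \<Sum>k\<in>UNIV. \<bar>B $ i $ k\<bar>) ^ m"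
proof (induction m arbitrary: i)
  case 0
  show ?case by (simp add: mat_def)
next
  case (Suc m)
  let ?b = "\<Sum>i\<in>UNIV. \<Sum>k\<in>UNIV. \<bar>B $ i $ k\<bar>"
  have row: "(\<Sum>k\<in>UNIV. \<bar>B $ i $ k\<bar>) \<le> ?b"
    by (rule member_le_sum) (auto intro: sum_nonneg)
  have "\<bar>mat_pow B (Suc m) $ i $ j\<bar> = \<bar>\<Sum>k\<in>UNIV. B $ i $ k * mat_pow B m $ k $ j\<bar>"
    by (simp add: matrix_matrix_mult_def)
  also have "\<dots> \<le> (\<Sum>k\<in>UNIV. \<bar>B $ i $ k * mat_pow B m $ k $ j\<bar>)" by (rule sum_abs)
  also have "\<dots> \<le> (\<Sum>k\<in>UNIV. \<bar>B $ i $ k\<bar> * ?b ^ m)"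
    using Suc.IH by (intro sum_mono) (simp add: abs_mult mult_left_mono)
  also have "\<dots> = (\<Sum>k\<in>UNIV. \<bar>B $ i $ k\<bar>) * ?b ^ m" by (simp add: sum_distrib_right)
  also have "\<dots> \<le> ?b * ?b ^ m"
    using row by (intro mult_right_mono zero_le_power) (auto intro!: sum_nonneg)
  finally show ?case by simp
qed

text \<open>Entrywise the exponential of \<open>s B\<close> is an everywhere convergent power series in \<open>s\<close>.\<close>

abbreviation exp_coeff :: "'n::finite sqmat \<Rightarrow> 'n \<Rightarrow> 'n \<Rightarrow> nat \<Rightarrow> real" where
  "exp_coeff B i j m \<equiv> mat_pow B m $ i $ j / fact m"

lemma summable_exp_coeff: "summable (\<lambda>m. exp_coeff B i j m * s ^ m)"
proof (rule summable_comparison_test)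
  let ?b = "\<Sum>i\<in>UNIV. \<Sum>k\<in>UNIV. \<bar>B $ i $ k\<bar>"
  have "norm (exp_coeff B i j m * s ^ m) \<le> inverse (fact m) * (?b * \<bar>s\<bar>) ^ m" for m
    using mat_pow_entry_bound[where B = B and m = m and i = i and j = j]
    by (simp add: abs_mult power_mult_distrib power_abs field_simps mult_left_mono)
  then show "\<exists>N. \<forall>m\<ge>N. norm (exp_coeff B i j m * s ^ m) \<le> inverse (fact m) * (?b * \<bar>s\<bar>) ^ m"
    by blast
  show "summable (\<lambda>m. inverse (fact m) * (?b * \<bar>s\<bar>) ^ m)" by (rule summable_exp)
qed

lemma matrix_exp_entry: "matrix_exp (s *\<^sub>R B) $ i $ j = (\<Sum>m. exp_coeff B i j m * s ^ m)"
proof -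
  let ?f = "\<lambda>m. (1 / fact m) *\<^sub>R mat_pow (s *\<^sub>R B) m"
  let ?S = "\<chi> i j. \<Sum>m. exp_coeff B i j m * s ^ m"
  have entry: "?f m $ i $ j = exp_coeff B i j m * s ^ m" for m i j
    by (simp add: mat_pow_scaleR)
  have "?f sums ?S"
    unfolding sums_def
  proof (intro vec_tendstoI)
    fix i j
    have "(\<lambda>n. \<Sum>m<n. exp_coeff B i j m * s ^ m) \<longlonglongrightarrow> (\<Sum>m. exp_coeff B i j m * s ^ m)"
      using summable_LIMSEQ[OF summable_exp_coeff] .
    then show "(\<lambda>n. (\<Sum>m<n. ?f m) $ i $ j) \<longlonglongrightarrow> ?S $ i $ j"
      by (simp add: entry sum_component del: vector_scaleR_component)
  qed
  then have "matrix_exp (s *\<^sub>R B) = ?S" unfolding matrix_exp_def by (rule sums_unique[symmetric])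
  then show ?thesis by simp
qed

lemma matrix_exp_0: "matrix_exp (0 *\<^sub>R B) = mat 1"
proof -
  have "matrix_exp (0 *\<^sub>R B) $ i $ j = mat 1 $ i $ j" for i j
    unfolding matrix_exp_entry powser_zero by simp
  then show ?thesis by (simp add: vec_eq_iff)
qed

lemma matrix_exp_has_vector_derivative:
  "((\<lambda>s. matrix_exp (s *\<^sub>R B)) has_vector_derivative B ** matrix_exp (s *\<^sub>R B)) (at s)"
proof -
  have entry: "((\<lambda>s. matrix_exp (s *\<^sub>R B) $ i $ j) has_vector_derivative
      (B ** matrix_exp (s *\<^sub>R B)) $ i $ j) (at s)" for i j
  proof -
    have "diffs (exp_coeff B i j) m = (\<Sum>k\<in>UNIV. B $ i $ k * exp_coeff B k j m)" for m
      by (simp add: diffs_def matrix_matrix_mult_def sum_divide_distrib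
          sum_distrib_left del: of_nat_Suc)
    then have "(\<Sum>m. diffs (exp_coeff B i j) m * s ^ m)
        = (\<Sum>m. \<Sum>k\<in>UNIV. B $ i $ k * (exp_coeff B k j m * s ^ m))"
      by (simp add: sum_distrib_right mult.assoc)
    also have "\<dots> = (\<Sum>k\<in>UNIV. B $ i $ k * (\<Sum>m. exp_coeff B k j m * s ^ m))"
      by (subst suminf_sum) (auto intro!: summable_mult summable_exp_coeff
          simp only: suminf_mult[OF summable_exp_coeff])
    also have "\<dots> = (B ** matrix_exp (s *\<^sub>R B)) $ i $ j"
      by (simp add: matrix_matrix_mult_def matrix_exp_entry)
    finally have eq: "(\<Sum>m. diffs (exp_coeff B i j) m * s ^ m) = (B ** matrix_exp (s *\<^sub>R B)) $ i $ j" .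
    have "((\<lambda>s. \<Sum>m. exp_coeff B i j m * s ^ m) has_field_derivative
        (B ** matrix_exp (s *\<^sub>R B)) $ i $ j) (at s)"
      unfolding eq[symmetric]
      by (rule termdiffs_strong_converges_everywhere[OF summable_exp_coeff])
    then show ?thesis
      by (simp add: matrix_exp_entry has_real_derivative_iff_has_vector_derivative)
  qed
  show ?thesis
    unfolding has_vector_derivative_def
  proof (rule has_derivative_componentwise_within[THEN iffD2], rule ballI)
    fix b :: "real^'a^'a" assume "b \<in> Basis"
    then obtain i j where b: "b = axis i (axis j 1)" by (auto simp: Basis_vec_def)
    show "((\<lambda>x. matrix_exp (x *\<^sub>R B) \<bullet> b) has_derivative
        (\<lambda>x. x *\<^sub>R (B ** matrix_exp (s *\<^sub>R B)) \<bullet> b)) (at s)"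
      using entry[of i j] unfolding has_vector_derivative_def by (simp add: b inner_axis)
  qed
qed

text \<open>The derivative \<open>E\<^sup>T (B\<^sup>T + B) E\<close> of \<open>E\<^sup>T E\<close> vanishes along the one-parameter group.\<close>

lemma matrix_exp_orthogonal:
  assumes "transpose B = - B"
  shows "transpose (matrix_exp (s *\<^sub>R B)) ** matrix_exp (s *\<^sub>R B) = mat 1"
proof -
  let ?E = "\<lambda>s. matrix_exp (s *\<^sub>R B)"
  have "((\<lambda>s. transpose (?E s) ** ?E s) has_vector_derivative 0) (at s)" for s
  proof -
    note E = matrix_exp_has_vector_derivative[of B s]
    have tE: "((\<lambda>s. transpose (?E s)) has_vector_derivative transpose (B ** ?E s)) (at s)"
      using bounded_linear.has_vector_derivative[OF _ E] linear_transpose linear_conv_bounded_linear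
      by blast
    have "transpose (?E s) ** (B ** ?E s) + transpose (B ** ?E s) ** ?E s =
        transpose (?E s) ** (B + transpose B) ** ?E s"
      by (simp add: matrix_transpose_mul matrix_mul_assoc matrix_add_ldistrib
          bounded_bilinear.add_left[OF bounded_bilinear_matrix_mult])
    also have "\<dots> = 0"
      using assms by (simp add: bounded_bilinear.zero_left[OF bounded_bilinear_matrix_mult]
          bounded_bilinear.zero_right[OF bounded_bilinear_matrix_mult])
    finally show ?thesis
      using bounded_bilinear.has_vector_derivative[OF bounded_bilinear_matrix_mult tE E] by simp
  qed
  then obtain c where "\<And>s. transpose (?E s) ** ?E s = c"
    using has_vector_derivative_zero_constant[OF convex_UNIV, of "\<lambda>s. transpose (?E s) ** ?E s"] by auto
  then show ?thesis using matrix_exp_0[of B] by (metis matrix_mul_lid transpose_mat)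
qed

text \<open>An orthogonal matrix has determinant \<open>\<plusminus>1\<close>, and the determinant of the exponential is
  continuous with value \<open>1\<close> at \<open>0\<close>.\<close>

lemma eventually_matrix_exp_SO:
  assumes "transpose B = - B"
  shows "\<forall>\<^sub>F s in nhds 0. matrix_exp (s *\<^sub>R B) \<in> SO"
proof -
  let ?E = "\<lambda>s. matrix_exp (s *\<^sub>R B)"
  have "isCont ?E 0" using matrix_exp_has_vector_derivative has_vector_derivative_continuous by blast
  moreover have "C_on 0 UNIV (det :: 'a sqmat \<Rightarrow> real)"
    by (intro C_on_det C_on_nth C_on_id open_UNIV)
  then have "isCont (det :: 'a sqmat \<Rightarrow> real) (?E 0)"
    by (simp add: continuous_on_eq_continuous_at)
  ultimately have "isCont (\<lambda>s. det (?E s)) 0" by (rule isCont_o2)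
  then have "((\<lambda>s. det (?E s)) \<longlongrightarrow> det (?E 0)) (nhds 0)"
    using tendsto_at_iff_tendsto_nhds continuous_at by metis
  moreover have "det (?E 0) > 0" by (simp only: matrix_exp_0 det_I zero_less_one)
  ultimately have "\<forall>\<^sub>F s in nhds 0. det (?E s) > 0" by (rule order_tendstoD)
  then show ?thesis
  proof eventually_elim
    case (elim s)
    note orth = matrix_exp_orthogonal[OF assms, of s]
    then have "det (?E s) = 1 \<or> det (?E s) = - 1"
      by (intro det_orthogonal_matrix) (simp add: orthogonal_matrix)
    then show ?case using elim orth by (auto simp: SO_iff)
  qed
qed

section \<open>The invariant metric on the quotient\<close>

lemma trace_conj_by:
  assumes "Q \<in> SO"
  shows "trace (conj_by Q X ** conj_by Q Y) = trace (X ** Y)"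
proof -
  have "conj_by Q X ** conj_by Q Y = Q ** (X ** Y) ** transpose Q"
    by (simp add: conj_by_def matrix_mul_assoc SO_cancel[OF assms])
  then have "trace (conj_by Q X ** conj_by Q Y) = trace (transpose Q ** (Q ** (X ** Y)))"
    by (metis trace_mul_sym)
  then show ?thesis by (simp add: SO_cancel[OF assms])
qed

context flag_blocks
begin

sublocale iso: atlas_isomorphism Quot quot_atlas "orbit l" "orbit_atlas l" \<phi> fibre
  by unfold_locales (rule atlas_iso_flag_map)

text \<open>Left translation, written as a composite of maps that match charts. It agrees with the actual
  translation of cosets only on the quotient, not on arbitrary sets of matrices.\<close>

abbreviation (input) act :: "'n sqmat \<Rightarrow> 'n sqmat set \<Rightarrow> 'n sqmat set" where
  "act Q \<equiv> fibre \<circ> (conj_by Q \<circ> \<phi>)"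

lemma translate_coset:
  assumes "Q \<in> SO" "R \<in> SO"
  shows "(**) Q ` coset R = coset (Q ** R)"
  unfolding flag_coset_def by (simp add: image_image matrix_mul_assoc)

lemma act_eq_translate:
  assumes "Q \<in> SO" "x \<in> Quot"
  shows "act Q x = (**) Q ` x"
proof -
  obtain R where R: "R \<in> SO" "x = coset R" using QuotE[OF assms(2)] by blast
  then show ?thesis
    using assms(1) SO_mult[OF assms(1) R(1)]
    by (simp add: flag_map_coset conj_by_mult fibre_conj translate_coset)
qed

lemma atlas_iso_act:
  assumes "Q \<in> SO"
  shows "atlas_isomorphism Quot quot_atlas Quot quot_atlas (act Q)
    ((fibre \<circ> conj_by (transpose Q)) \<circ> \<phi>)"
  unfolding atlas_isomorphism_def
  by (rule atlas_iso_comp[OF atlas_iso_comp[OF atlas_iso_flag_map atlas_iso_conj_by[OF assms]]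
        atlas_iso_sym[OF atlas_iso_flag_map]])

lemma differential_translate:
  assumes Q: "Q \<in> SO" and \<gamma>: "smooth_curve quot_atlas \<gamma>"
  shows "differential quot_atlas ((`) ((**) Q)) (velocity quot_atlas \<gamma>) =
    velocity quot_atlas (act Q \<circ> \<gamma>)"
proof -
  interpret act: atlas_isomorphism Quot quot_atlas Quot quot_atlas "act Q"
    "(fibre \<circ> conj_by (transpose Q)) \<circ> \<phi>"
    by (rule atlas_iso_act[OF Q])
  have "velocity quot_atlas ((`) ((**) Q) \<circ> \<delta>) = velocity quot_atlas (act Q \<circ> \<delta>)"
    if "\<delta> \<in> velocity quot_atlas \<gamma>" for \<delta>
  proof (intro same_velocity_imp_velocity_eq same_velocity_cong)
    have "\<forall>\<^sub>F s in nhds 0. \<delta> s \<in> Quot"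
      using that act.smooth_curve_in unfolding velocity_iff by blast
    then show "\<forall>\<^sub>F s in nhds 0. ((`) ((**) Q) \<circ> \<delta>) s = (act Q \<circ> \<delta>) s"
      by eventually_elim (use act_eq_translate[OF Q] in simp)
  qed
  then have "differential quot_atlas ((`) ((**) Q)) (velocity quot_atlas \<gamma>) =
      differential quot_atlas (act Q) (velocity quot_atlas \<gamma>)"
    unfolding differential_def by simp
  then show ?thesis using act.differential_velocity[OF \<gamma>] by simp
qed

text \<open>Velocities in the quotient are compared in the orbit, where they are ambient derivatives.\<close>

lemma same_velocity_coset:
  assumes B: "transpose B = - B"
    and E: "\<forall>\<^sub>F s in nhds 0. E s \<in> SO" "E 0 = mat 1" "(E has_vector_derivative B) (at 0)"
    and K: "\<forall>\<^sub>F s in nhds 0. K s \<in> SO" "K 0 = mat 1" "(K has_vector_derivative B) (at 0)"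
  shows "same_velocity quot_atlas (\<lambda>s. coset (E s)) (\<lambda>s. coset (K s))"
proof -
  interpret inv: atlas_isomorphism "orbit l" "orbit_atlas l" Quot quot_atlas fibre \<phi>
    by (rule atlas_isomorphism_sym) unfold_locales
  have in_orbit: "\<forall>\<^sub>F s in nhds 0. conj_by (F s) (Lam l) \<in> orbit l"
    and cong: "same_velocity quot_atlas (\<lambda>s. coset (F s)) (fibre \<circ> (\<lambda>s. conj_by (F s) (Lam l)))"
    if "\<forall>\<^sub>F s in nhds 0. F s \<in> SO" for F :: "real \<Rightarrow> 'n sqmat"
  proof -
    show "\<forall>\<^sub>F s in nhds 0. conj_by (F s) (Lam l) \<in> orbit l"
      using that by eventually_elim (simp add: orbit_eq)
    have "\<forall>\<^sub>F s in nhds 0. coset (F s) = (fibre \<circ> (\<lambda>s. conj_by (F s) (Lam l))) s"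
      using that by eventually_elim (simp add: fibre_conj)
    then show "same_velocity quot_atlas (\<lambda>s. coset (F s)) (fibre \<circ> (\<lambda>s. conj_by (F s) (Lam l)))"
      by (rule same_velocity_cong)
  qed
  have "same_velocity (orbit_atlas l) (\<lambda>s. conj_by (E s) (Lam l)) (\<lambda>s. conj_by (K s) (Lam l))"
    by (rule same_velocity_submanifoldI[OF _ conj_by_Lam_has_vector_derivative[OF E(3,2) B]
          conj_by_Lam_has_vector_derivative[OF K(3,2) B] in_orbit[OF E(1)] in_orbit[OF K(1)]])
      (simp add: E(2) K(2))
  then have "same_velocity quot_atlas (fibre \<circ> (\<lambda>s. conj_by (E s) (Lam l)))
      (fibre \<circ> (\<lambda>s. conj_by (K s) (Lam l)))"
    by (rule inv.same_velocity_image[OF _ in_orbit[OF E(1)] in_orbit[OF K(1)]])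
  then show ?thesis
    using cong[OF E(1)] same_velocity_sym[OF cong[OF K(1)]] same_velocity_trans by blast
qed

text \<open>This curve has the same velocity \<open>B\<close> as the one-parameter group and is visibly smooth.\<close>

abbreviation cayley_curve :: "'n sqmat \<Rightarrow> real \<Rightarrow> 'n sqmat" where
  "cayley_curve B s \<equiv> cayley ((s / 2) *\<^sub>R B)"

lemma cayley_curve_SO: "B \<in> off l \<Longrightarrow> cayley_curve B s \<in> SO"
  by (rule cayley_SO) (simp add: transpose_scaleR off_skew(2))

lemma velocity_exp_eq_cayley:
  assumes "B \<in> off l"
  shows "velocity quot_atlas (\<lambda>s. coset (matrix_exp (s *\<^sub>R B))) =
    velocity quot_atlas (\<lambda>s. coset (cayley_curve B s))"
proof (intro same_velocity_imp_velocity_eq same_velocity_coset[OF off_skew(2)[OF assms]])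
  show "\<forall>\<^sub>F s in nhds 0. matrix_exp (s *\<^sub>R B) \<in> SO"
    by (rule eventually_matrix_exp_SO[OF off_skew(2)[OF assms]])
  show "matrix_exp (0 *\<^sub>R B) = mat 1" by (rule matrix_exp_0)
  show "((\<lambda>s. matrix_exp (s *\<^sub>R B)) has_vector_derivative B) (at 0)"
    using matrix_exp_has_vector_derivative[of B 0] by (simp only: matrix_exp_0 matrix_mul_rid)
  show "\<forall>\<^sub>F s in nhds 0. cayley_curve B s \<in> SO" using cayley_curve_SO[OF assms] by simp
  show "cayley_curve B 0 = mat 1" by (simp add: cayley_0)
  show "(cayley_curve B has_vector_derivative B) (at 0)" by (rule C_on_cayley_curve(2)[OF assms])
qed

lemma smooth_curve_cayley:
  assumes B: "B \<in> off l"
  shows "smooth_curve quot_atlas (\<lambda>s. coset (cayley_curve B s))"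
proof -
  interpret inv: atlas_isomorphism "orbit l" "orbit_atlas l" Quot quot_atlas fibre \<phi>
    by (rule atlas_isomorphism_sym) unfold_locales
  have "smooth_on {-1<..<1} (cayley_curve B)"
    by (rule C_on_imp_smooth_on[OF open_UNIV subset_UNIV C_on_cayley_curve(1)[OF B]])
  then have "smooth_on {-1<..<1} (\<lambda>s. conj_by (cayley_curve B s) (Lam l))"
    by (rule smooth_on_compose[OF _ smooth_on_conj_Lam subset_UNIV])
  then have 1: "smooth_curve (orbit_atlas l) (\<lambda>s. conj_by (cayley_curve B s) (Lam l))"
    by (rule smooth_curve_submanifoldI[OF _ _ _ orbit_cover]) (auto simp: orbit_eq cayley_curve_SO[OF B])
  show "smooth_curve quot_atlas (\<lambda>s. coset (cayley_curve B s))"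
    using inv.smooth_curve_image[OF 1] by (simp add: o_def fibre_conj[OF cayley_curve_SO[OF B]])
qed

text \<open>A curve in the orbit through the diagonal matrix lifts to a curve of rotations through the
  identity. Its velocity is skew-symmetric, and the diagonal blocks of the velocity do not
  move the diagonal matrix.\<close>

lemma tangent_space_base:
  assumes v: "v \<in> tangent_space quot_atlas (coset (mat 1))"
  obtains B where "B \<in> off l" "v = velocity quot_atlas (\<lambda>s. coset (matrix_exp (s *\<^sub>R B)))"
proof -
  obtain \<gamma> where \<gamma>: "smooth_curve quot_atlas \<gamma>" "\<gamma> 0 = coset (mat 1)" "v = velocity quot_atlas \<gamma>"
    using v tangent_spaceE by metis
  define X where "X = \<phi> \<circ> \<gamma>"
  have X0: "X 0 = Lam l" using \<gamma>(2) by (simp add: X_def flag_map_coset[OF SO_id] conj_by_id)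
  obtain e where e: "e > 0" "smooth_on {-e<..<e} X" "X ` {-e<..<e} \<subseteq> orbit l"
    using smooth_curve_submanifoldD[OF iso.smooth_curve_image[OF \<gamma>(1)]] unfolding X_def by metis
  note dX = smooth_on_has_vector_derivative[OF e(2,1)]
  obtain U c \<sigma> where U: "(U, c) \<in> orbit_atlas l" "Lam l \<in> U" "smooth_on U \<sigma>"
    "\<And>Y. Y \<in> U \<Longrightarrow> \<sigma> Y \<in> SO" "\<And>Y. Y \<in> U \<Longrightarrow> conj_by (\<sigma> Y) (Lam l) = Y" "\<sigma> (Lam l) = mat 1"
    using orbit_chart_with_section[OF SO_id, of l] unfolding conj_by_id by metis
  have orb: "\<forall>\<^sub>F s in nhds 0. X s \<in> orbit l"
    using e(1,3) by (auto simp: eventually_nhds_0_iff)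
  have ev: "\<forall>\<^sub>F s in nhds 0. X s \<in> U"
    using X0 U(2) orb has_vector_derivative_continuous[OF dX]
    by (intro eventually_in_relatively_open[where \<gamma> = X, OF submanifold_atlasD(1)[OF U(1)]]) auto
  obtain D where dS: "((\<lambda>s. \<sigma> (X s)) has_vector_derivative D) (at 0)"
    by (rule smooth_on_curve_derivative[OF U(3,2)]) (use X0 dX ev that in blast)
  have tS: "((\<lambda>s. transpose (\<sigma> (X s))) has_vector_derivative transpose D) (at 0)"
    using bounded_linear.has_vector_derivative[OF _ dS] linear_transpose linear_conv_bounded_linear
    by blast
  have "((\<lambda>s. transpose (\<sigma> (X s)) ** \<sigma> (X s)) has_vector_derivative
      transpose (\<sigma> (X 0)) ** D + transpose D ** \<sigma> (X 0)) (at 0)"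
    by (rule bounded_bilinear.has_vector_derivative[OF bounded_bilinear_matrix_mult tS dS])
  moreover have one: "\<forall>\<^sub>F s in nhds 0. transpose (\<sigma> (X s)) ** \<sigma> (X s) = mat 1"
    using ev by eventually_elim (simp add: SO_mult_transpose U(4))
  ultimately have "((\<lambda>s. mat 1) has_vector_derivative D + transpose D) (at (0::real))"
    using has_vector_derivative_cong_nhds[OF one] by (simp add: X0 U(6) transpose_mat)
  then have skew: "transpose D = - D"
    using vector_derivative_unique_at[OF has_vector_derivative_const] by (metis add_eq_0_iff)
  define B where "B = (\<chi> r s. if l r = l s then 0 else D $ r $ s)"
  have B: "B \<in> off l"
  proof (rule offI)
    show "B $ s $ r = - B $ r $ s" for r s
      using arg_cong[OF skew, of "\<lambda>M. M $ r $ s"] by (auto simp: B_def transpose_def)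
  qed (simp add: B_def)
  have comm: "D ** Lam l - Lam l ** D = B ** Lam l - Lam l ** B"
    by (simp add: vec_eq_iff mult_Lam Lam_mult B_def)
  have id: "\<forall>\<^sub>F s in nhds 0. conj_by (\<sigma> (X s)) (Lam l) = X s"
    using ev by eventually_elim (simp add: U(5))
  have "((\<lambda>s. conj_by (\<sigma> (X s)) (Lam l)) has_vector_derivative B ** Lam l - Lam l ** B) (at 0)"
    unfolding comm[symmetric]
    by (rule conj_by_Lam_has_vector_derivative[OF dS _ skew]) (simp add: X0 U(6))
  then have dX': "(X has_vector_derivative B ** Lam l - Lam l ** B) (at 0)"
    using has_vector_derivative_cong_nhds[OF id] by simp
  have K0: "cayley_curve B 0 = mat 1" by (simp add: cayley_0)
  have "same_velocity (orbit_atlas l) X (\<lambda>s. conj_by (cayley_curve B s) (Lam l))"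
    by (rule same_velocity_submanifoldI[OF _ dX'
          conj_by_Lam_has_vector_derivative[OF C_on_cayley_curve(2)[OF B] K0 off_skew(2)[OF B]] orb])
      (simp_all add: X0 cayley_0 conj_by_id orbit_eq cayley_curve_SO[OF B])
  moreover have "(\<lambda>s. conj_by (cayley_curve B s) (Lam l)) = \<phi> \<circ> (\<lambda>s. coset (cayley_curve B s))"
    by (simp add: o_def flag_map_coset[OF cayley_curve_SO[OF B]])
  ultimately have "velocity (orbit_atlas l) (\<phi> \<circ> \<gamma>) =
      velocity (orbit_atlas l) (\<phi> \<circ> (\<lambda>s. coset (cayley_curve B s)))"
    unfolding X_def by (metis same_velocity_imp_velocity_eq)
  then have "differential (orbit_atlas l) \<phi> v =
      differential (orbit_atlas l) \<phi> (velocity quot_atlas (\<lambda>s. coset (cayley_curve B s)))"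
    by (simp add: \<gamma>(3) iso.differential_velocity[OF \<gamma>(1)]
        iso.differential_velocity[OF smooth_curve_cayley[OF B]])
  then have "v = velocity quot_atlas (\<lambda>s. coset (cayley_curve B s))"
    using iso.differential_inverse[OF v]
      iso.differential_inverse[OF velocity_in_tangent_space[OF smooth_curve_cayley[OF B]]] by metis
  then show thesis using that[OF B] velocity_exp_eq_cayley[OF B] by simp
qed

text \<open>The invariant metric is constructed as the pullback of the trace metric along the bijection with
  the orbit.\<close>

abbreviation "quot_metric \<equiv> iso.pullback_metric isospectral_metric"

lemma quot_metric_velocity:
  assumes "smooth_curve quot_atlas \<gamma>" "smooth_curve quot_atlas \<delta>" "\<gamma> 0 = \<delta> 0"
  shows "quot_metric (\<gamma> 0) (velocity quot_atlas \<gamma>) (velocity quot_atlas \<delta>) =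
    trace (vector_derivative (\<phi> \<circ> \<gamma>) (at 0) ** vector_derivative (\<phi> \<circ> \<delta>) (at 0))"
proof -
  have "\<gamma> 0 \<in> Quot" using eventually_nhds_x_imp_x[OF iso.smooth_curve_in[OF assms(1)]] .
  moreover have "velocity quot_atlas \<gamma> \<in> tangent_space quot_atlas (\<gamma> 0)"
    "velocity quot_atlas \<delta> \<in> tangent_space quot_atlas (\<gamma> 0)"
    using velocity_in_tangent_space assms by metis+
  ultimately show ?thesis
    by (simp add: iso.pullback_metric_def iso.differential_velocity assms(1,2)
        isospectral_metric_velocity[OF orbit_cover] iso.smooth_curve_image)
qed

text \<open>Under the bijection, translation by \<open>Q\<close> becomes conjugation by \<open>Q\<close>, which is linear and
  preserves the trace form.\<close>

lemma isometric_translate: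
  assumes Q: "Q \<in> SO"
  shows "isometric Quot quot_atlas quot_metric quot_atlas quot_metric ((`) ((**) Q))"
  unfolding isometric_def
proof (intro ballI)
  interpret act: atlas_isomorphism Quot quot_atlas Quot quot_atlas "act Q"
    "(fibre \<circ> conj_by (transpose Q)) \<circ> \<phi>"
    by (rule atlas_iso_act[OF Q])
  fix x v w
  assume x: "x \<in> Quot" and vw: "v \<in> tangent_space quot_atlas x" "w \<in> tangent_space quot_atlas x"
  obtain \<gamma> where \<gamma>: "smooth_curve quot_atlas \<gamma>" "\<gamma> 0 = x" "v = velocity quot_atlas \<gamma>"
    using vw(1) tangent_spaceE by metis
  obtain \<delta> where \<delta>: "smooth_curve quot_atlas \<delta>" "\<delta> 0 = x" "w = velocity quot_atlas \<delta>"
    using vw(2) tangent_spaceE by metis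
  have vd: "vector_derivative (\<phi> \<circ> (act Q \<circ> \<epsilon>)) (at 0) = conj_by Q (vector_derivative (\<phi> \<circ> \<epsilon>) (at 0))"
    if eps: "smooth_curve quot_atlas \<epsilon>" for \<epsilon>
  proof -
    obtain e where "e > 0" "smooth_on {-e<..<e} (\<phi> \<circ> \<epsilon>)"
      using smooth_curve_submanifoldD[OF iso.smooth_curve_image[OF eps]] by metis
    then have "((\<phi> \<circ> \<epsilon>) has_vector_derivative vector_derivative (\<phi> \<circ> \<epsilon>) (at 0)) (at 0)"
      using smooth_on_has_vector_derivative by blast
    then have "((\<lambda>s. conj_by Q ((\<phi> \<circ> \<epsilon>) s)) has_vector_derivative
        conj_by Q (vector_derivative (\<phi> \<circ> \<epsilon>) (at 0))) (at 0)"
      using bounded_linear.has_vector_derivative linear_conj_by linear_conv_bounded_linear by blast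
    moreover have ev: "\<forall>\<^sub>F s in nhds 0. (\<phi> \<circ> (act Q \<circ> \<epsilon>)) s = conj_by Q ((\<phi> \<circ> \<epsilon>) s)"
      using iso.smooth_curve_in[OF eps]
    proof eventually_elim
      case (elim s)
      then have "conj_by Q (\<phi> (\<epsilon> s)) \<in> orbit l"
        using iso.f_in[OF elim] conj_by_orbit[OF Q, of l] by blast
      then show ?case by (simp add: iso.ff')
    qed
    ultimately show ?thesis
      using vector_derivative_cong_nhds[OF ev] vector_derivative_at by metis
  qed
  have "quot_metric ((**) Q ` x) (velocity quot_atlas (act Q \<circ> \<gamma>)) (velocity quot_atlas (act Q \<circ> \<delta>)) =
      trace (conj_by Q (vector_derivative (\<phi> \<circ> \<gamma>) (at 0)) ** conj_by Q (vector_derivative (\<phi> \<circ> \<delta>) (at 0)))"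
    using quot_metric_velocity[OF act.smooth_curve_image[OF \<gamma>(1)] act.smooth_curve_image[OF \<delta>(1)]]
      \<gamma>(2) \<delta>(2) act_eq_translate[OF Q x] vd[OF \<gamma>(1)] vd[OF \<delta>(1)] by simp
  also have "\<dots> = quot_metric x v w"
    using quot_metric_velocity[OF \<gamma>(1) \<delta>(1)] \<gamma> \<delta> by (simp add: trace_conj_by[OF Q])
  finally show "quot_metric ((**) Q ` x) (differential quot_atlas ((`) ((**) Q)) v)
      (differential quot_atlas ((`) ((**) Q)) w) = quot_metric x v w"
    using differential_translate[OF Q] \<gamma>(1,3) \<delta>(1,3) by simp
qed

lemma quot_metric_base:
  assumes "B \<in> off l" "C \<in> off l"
  shows "quot_metric (coset (mat 1)) (velocity quot_atlas (\<lambda>s. coset (matrix_exp (s *\<^sub>R B))))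
    (velocity quot_atlas (\<lambda>s. coset (matrix_exp (s *\<^sub>R C)))) = flag_m_inner p k a B C"
proof -
  have vd: "vector_derivative (\<phi> \<circ> (\<lambda>s. coset (cayley_curve B s))) (at 0) = B ** Lam l - Lam l ** B"
    if "B \<in> off l" for B
  proof -
    have "\<phi> \<circ> (\<lambda>s. coset (cayley_curve B s)) = (\<lambda>s. conj_by (cayley_curve B s) (Lam l))"
      by (simp add: o_def flag_map_coset[OF cayley_curve_SO[OF that]])
    then show ?thesis
      using conj_by_Lam_has_vector_derivative[OF C_on_cayley_curve(2)[OF that] _ off_skew(2)[OF that], of l]
      by (simp add: cayley_0 vector_derivative_at)
  qed
  have "quot_metric (coset (mat 1)) (velocity quot_atlas (\<lambda>s. coset (cayley_curve B s)))
    (velocity quot_atlas (\<lambda>s. coset (cayley_curve C s))) = flag_m_inner p k a B C"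
    using quot_metric_velocity[OF smooth_curve_cayley[OF assms(1)] smooth_curve_cayley[OF assms(2)]]
    by (simp add: vd assms cayley_0 inner_eq)
  then show ?thesis by (simp add: velocity_exp_eq_cayley assms)
qed

lemmas smooth_manifold_quot = iso.smooth_manifold_pullback[OF smooth_manifold_orbit]

lemmas riemannian_metric_quot =
  iso.riemannian_metric_pullback[OF smooth_manifold_orbit riemannian_metric_orbit]

text \<open>Invariance reduces the value of a metric on two tangent vectors to its value on tangent vectors
  at the base point, all of which are velocities of one-parameter groups.\<close>

lemma flag_quotient_metric_eq: "flag_quotient_metric p k a = quot_metric"
  unfolding flag_quotient_metric_def Let_def m_eq
proof -
  let ?P = "\<lambda>g :: 'n sqmat set metric_field. (\<forall>x v w. \<not> (x \<in> Quot \<and> v \<in> tangent_space quot_atlas x \<and> w \<in> tangent_space quot_atlas x) \<longrightarrow>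
       g x v w = 0) \<and> riemannian_metric (off l) quot_atlas g \<and>
     (\<forall>Q\<in>SO. isometric Quot quot_atlas g quot_atlas g ((`) ((**) Q))) \<and>
     (\<forall>B\<in>off l. \<forall>C\<in>off l. g (coset (mat 1))
       (velocity quot_atlas (\<lambda>s. coset (matrix_exp (s *\<^sub>R B))))
       (velocity quot_atlas (\<lambda>s. coset (matrix_exp (s *\<^sub>R C)))) = flag_m_inner p k a B C)"
  show "The ?P = quot_metric"
  proof (rule the_equality)
    show "?P quot_metric"
      using riemannian_metric_quot isometric_translate quot_metric_base
      by (auto simp: iso.pullback_metric_def)
  next
    fix g
    assume *: "?P g"
    show "g = quot_metric"
    proof (intro ext)
      fix x v w
      show "g x v w = quot_metric x v w"
      proof (cases "x \<in> Quot \<and> v \<in> tangent_space quot_atlas x \<and> w \<in> tangent_space quot_atlas x")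
        case False
        then show ?thesis using * by (auto simp: iso.pullback_metric_def)
      next
        case True
        then obtain R where R: "R \<in> SO" "x = coset R" using QuotE by blast
        define Q where "Q = transpose R"
        have Q: "Q \<in> SO" unfolding Q_def by (rule SO_transpose[OF R(1)])
        have Qx: "(**) Q ` x = coset (mat 1)"
          using translate_coset[OF Q R(1)] by (simp add: R(2) Q_def SO_mult_transpose[OF R(1)])
        let ?d = "differential quot_atlas ((`) ((**) Q))"
        interpret act: atlas_isomorphism Quot quot_atlas Quot quot_atlas "act Q"
          "(fibre \<circ> conj_by (transpose Q)) \<circ> \<phi>"
          by (rule atlas_iso_act[OF Q])
        have d: "\<exists>B\<in>off l. ?d u = velocity quot_atlas (\<lambda>s. coset (matrix_exp (s *\<^sub>R B)))"
          if u: "u \<in> tangent_space quot_atlas x" for u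
        proof -
          obtain \<gamma> where \<gamma>: "smooth_curve quot_atlas \<gamma>" "\<gamma> 0 = x" "u = velocity quot_atlas \<gamma>"
            using u tangent_spaceE by metis
          have "?d u \<in> tangent_space quot_atlas ((act Q \<circ> \<gamma>) 0)"
            using velocity_in_tangent_space[OF act.smooth_curve_image[OF \<gamma>(1)]]
              differential_translate[OF Q \<gamma>(1)] \<gamma>(3) by simp
          moreover have "(act Q \<circ> \<gamma>) 0 = coset (mat 1)"
            using act_eq_translate[OF Q] True Qx \<gamma>(2) by simp
          ultimately show ?thesis using tangent_space_base by metis
        qed
        obtain B C where BC: "B \<in> off l" "C \<in> off l"
          "?d v = velocity quot_atlas (\<lambda>s. coset (matrix_exp (s *\<^sub>R B)))"
          "?d w = velocity quot_atlas (\<lambda>s. coset (matrix_exp (s *\<^sub>R C)))"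
          using d True by metis
        have "h x v w = h (coset (mat 1)) (?d v) (?d w)"
          if "isometric Quot quot_atlas h quot_atlas h ((`) ((**) Q))" for h
          using that True unfolding isometric_def Qx[symmetric] by metis
        then have "g x v w = g (coset (mat 1)) (?d v) (?d w)"
          "quot_metric x v w = quot_metric (coset (mat 1)) (?d v) (?d w)"
          using * Q isometric_translate[OF Q] by blast+
        then show ?thesis using * BC quot_metric_base by simp
      qed
    qed
  qed
qed

end

section \<open>Block matrices in terms of eigenvalues\<close>

lemma sum_swap3:
  "(\<Sum>i\<in>A. \<Sum>s\<in>B. \<Sum>r\<in>C. h i s r) = (\<Sum>s\<in>B. \<Sum>r\<in>C. \<Sum>i\<in>A. h i s r)"
proof -
  have "(\<Sum>i\<in>A. \<Sum>s\<in>B. \<Sum>r\<in>C. h i s r) = (\<Sum>s\<in>B. \<Sum>i\<in>A. \<Sum>r\<in>C. h i s r)"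
    by (rule sum.swap)
  also have "\<dots> = (\<Sum>s\<in>B. \<Sum>r\<in>C. \<Sum>i\<in>A. h i s r)" by (intro sum.cong refl) (rule sum.swap)
  finally show ?thesis .
qed

context
  fixes p :: nat and k :: "nat \<Rightarrow> nat" and a :: "nat \<Rightarrow> real"
  assumes k0: "k 0 = 0" and k_mono: "\<forall>i\<le>p. k i < k (i + 1)"
    and k_top: "k (p + 1) = CARD('n::{finite,linorder})" and inj_a: "inj_on a {1..p+1}"
begin

lemma k_le: "i \<le> j \<Longrightarrow> j \<le> p + 1 \<Longrightarrow> k i \<le> k j"
proof (induction j rule: dec_induct)
  case (step j)
  then show ?case using k_mono by (metis Suc_eq_plus1 Suc_leD Suc_le_mono le_trans less_imp_le_nat)
qed simp

definition block_index :: "'n \<Rightarrow> nat" where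
  "block_index r = (LEAST i. card {..<r} < k i)"

lemma position_less: "card {..<r::'n} < k (p + 1)"
  unfolding k_top by (intro psubset_card_mono) auto

lemma block_index_bounds: "block_index r \<in> {1..p+1}" "card {..<r} < k (block_index r)"
  "k (block_index r - 1) \<le> card {..<r}"
proof -
  show less: "card {..<r} < k (block_index r)"
    unfolding block_index_def using position_less by (rule LeastI)
  have "block_index r \<noteq> 0" using less k0 by (intro notI) simp
  moreover have "block_index r \<le> p + 1"
    unfolding block_index_def using position_less by (rule Least_le)
  ultimately show "block_index r \<in> {1..p+1}" by simp
  have "\<not> card {..<r} < k (block_index r - 1)"
    using \<open>block_index r \<noteq> 0\<close> not_less_Least[of "block_index r - 1" "\<lambda>i. card {..<r} < k i"]
    unfolding block_index_def by simp
  then show "k (block_index r - 1) \<le> card {..<r}" by simp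
qed

lemma mem_block_iff: "i \<in> {1..p+1} \<Longrightarrow> r \<in> block k i \<longleftrightarrow> block_index r = i" for r :: 'n
proof
  assume i: "i \<in> {1..p+1}" "r \<in> block k i"
  then have c: "k (i - 1) \<le> card {..<r}" "card {..<r} < k i" by (auto simp: block_def)
  have "block_index r \<le> i" unfolding block_index_def using c(2) by (rule Least_le)
  moreover have "\<not> block_index r \<le> i - 1"
    using k_le[of "block_index r" "i - 1"] block_index_bounds(2)[of r] c(1) i(1) by fastforce
  ultimately show "block_index r = i" by simp
next
  assume "block_index r = i"
  then show "r \<in> block k i" using block_index_bounds[of r] by (auto simp: block_def)
qed

lemma block_part_entry: "i \<in> {1..p+1} \<Longrightarrow> j \<in> {1..p+1} \<Longrightarrow>
    block_part k i j B $ r $ s = (if block_index r = i \<and> block_index s = j then B $ r $ s else 0)"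
  for B :: "'n sqmat"
  by (simp add: block_part_def mem_block_iff)

definition eigenvalue :: "'n \<Rightarrow> real" where "eigenvalue r = a (block_index r)"

lemma eigenvalue_eq_iff: "eigenvalue r = eigenvalue s \<longleftrightarrow> block_index r = block_index s"
  unfolding eigenvalue_def by (rule inj_on_eq_iff[OF inj_a block_index_bounds(1) block_index_bounds(1)])

lemma flag_Lambda_eq: "flag_Lambda p k a = Lam eigenvalue"
proof -
  have "flag_Lambda p k a $ r $ s = Lam eigenvalue $ r $ s" for r s :: 'n
  proof -
    have "flag_Lambda p k a $ r $ s = (\<Sum>i\<in>{1..p+1}. a i * block_part k i i (mat 1) $ r $ s)"
      by (simp only: flag_Lambda_def sum_component vector_scaleR_component real_scaleR_def)
    also have "\<dots> = (\<Sum>i\<in>{1..p+1}. if block_index r = i then (if r = s then a i else 0) else 0)"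
      by (intro sum.cong refl) (simp add: block_part_entry mat_def)
    also have "\<dots> = (if r = s then eigenvalue r else 0)"
      using block_index_bounds(1)[of r] by (subst sum.delta') (auto simp: eigenvalue_def)
    finally show ?thesis by (simp add: Lam_def)
  qed
  then show ?thesis by (simp add: vec_eq_iff)
qed

lemma flag_m_eq: "flag_m p k = off eigenvalue"
proof -
  have "(\<forall>i\<in>{1..p+1}. block_part k i i B = 0) \<longleftrightarrow>
      (\<forall>r s. eigenvalue r = eigenvalue s \<longrightarrow> B $ r $ s = 0)" for B :: "'n sqmat"
  proof
    assume *: "\<forall>i\<in>{1..p+1}. block_part k i i B = 0"
    show "\<forall>r s. eigenvalue r = eigenvalue s \<longrightarrow> B $ r $ s = 0"
    proof (intro allI impI)
      fix r s assume "eigenvalue r = eigenvalue s"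
      then have "block_index r = block_index s" by (simp add: eigenvalue_eq_iff)
      then have "B $ r $ s = block_part k (block_index r) (block_index r) B $ r $ s"
        using block_index_bounds(1) by (simp add: block_part_entry del: atLeastAtMost_iff)
      then show "B $ r $ s = 0" using * block_index_bounds(1)[of r] by simp
    qed
  qed (simp add: vec_eq_iff block_part_entry eigenvalue_eq_iff)
  then show ?thesis unfolding flag_m_def off_def by blast
qed

text \<open>Installing the diagonal blocks one after the other into the identity matrix factors a block
  diagonal matrix into the matrices whose determinants are the block determinants.\<close>

lemma det_block_diagonal:
  fixes X :: "'n sqmat"
  assumes X: "\<And>r s. block_index r \<noteq> block_index s \<Longrightarrow> X $ r $ s = 0"
  shows "det X = (\<Prod>i\<in>{1..p+1}. block_det k i X)"
proof -
  define N :: "nat \<Rightarrow> 'n sqmat" where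
    "N j = (\<chi> r s. if block_index r \<le> j \<and> block_index s \<le> j then X $ r $ s else mat 1 $ r $ s)" for j
  define M :: "nat \<Rightarrow> 'n sqmat" where
    "M i = block_part k i i X + (mat 1 - block_part k i i (mat 1))" for i
  have M: "M i $ r $ s = (if block_index r = i \<and> block_index s = i then X $ r $ s else mat 1 $ r $ s)"
    if "i \<in> {1..p+1}" for i r s
    using that by (simp add: M_def block_part_entry)
  have step: "N (Suc j) = N j ** M (Suc j)" if "Suc j \<in> {1..p+1}" for j
  proof -
    have "(N j ** M (Suc j)) $ r $ s = N (Suc j) $ r $ s" for r s
    proof (cases "block_index s = Suc j")
      case True
      have "(N j ** M (Suc j)) $ r $ s = (\<Sum>t\<in>UNIV. N j $ r $ t * M (Suc j) $ t $ s)"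
        by (simp add: matrix_matrix_mult_def)
      also have "\<dots> = (\<Sum>t\<in>UNIV. if t = r then (if block_index r = Suc j then X $ r $ s else 0) else 0)"
        using True that by (intro sum.cong refl) (auto simp: M N_def mat_def X)
      also have "\<dots> = N (Suc j) $ r $ s"
        using True X[of r s] by (auto simp: N_def mat_def)
      finally show ?thesis .
    next
      case False
      have "(N j ** M (Suc j)) $ r $ s = (\<Sum>t\<in>UNIV. N j $ r $ t * M (Suc j) $ t $ s)"
        by (simp add: matrix_matrix_mult_def)
      also have "\<dots> = (\<Sum>t\<in>UNIV. if t = s then N j $ r $ s else 0)"
        using False that by (intro sum.cong refl) (auto simp: M mat_def)
      also have "\<dots> = N (Suc j) $ r $ s"
        using False X[of r s] by (auto simp: N_def mat_def le_Suc_eq)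
      finally show ?thesis .
    qed
    then show ?thesis by (simp add: vec_eq_iff)
  qed
  have "det (N j) = (\<Prod>i\<in>{1..j}. det (M i))" if "j \<le> p + 1" for j
    using that
  proof (induction j)
    case 0
    have pos: "block_index r \<noteq> 0" for r using block_index_bounds(1)[of r] by simp
    have "N 0 = mat 1" by (simp add: N_def vec_eq_iff pos)
    then show ?case by simp
  next
    case (Suc j)
    then show ?case using step[of j] by (simp add: det_mul)
  qed
  from this[of "p + 1"] have "det (N (p + 1)) = (\<Prod>i\<in>{1..p+1}. block_det k i X)"
    by (simp add: block_det_def M_def)
  moreover have "N (p + 1) = X" using block_index_bounds(1) by (auto simp: N_def vec_eq_iff)
  ultimately show ?thesis by simp
qed

text \<open>Commuting with a diagonal matrix means being block diagonal, since distinct blocks have distinct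
  eigenvalues.\<close>

lemma commute_Lam_iff:
  "X ** Lam eigenvalue = Lam eigenvalue ** X \<longleftrightarrow>
    (\<forall>r s. block_index r \<noteq> block_index s \<longrightarrow> X $ r $ s = 0)"
proof -
  have "X ** Lam eigenvalue = Lam eigenvalue ** X \<longleftrightarrow>
      (\<forall>r s. X $ r $ s * eigenvalue s = eigenvalue r * X $ r $ s)"
    by (simp add: vec_eq_iff mult_Lam Lam_mult)
  also have "\<dots> \<longleftrightarrow> (\<forall>r s. eigenvalue r \<noteq> eigenvalue s \<longrightarrow> X $ r $ s = 0)"
  proof -
    have "x * u = v * x \<longleftrightarrow> (v \<noteq> u \<longrightarrow> x = 0)" for x u v :: real by auto
    then show ?thesis by simp
  qed
  finally show ?thesis by (simp add: eigenvalue_eq_iff)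
qed

lemma SO_blocks_eq:
  "SO_blocks p k = {X \<in> SO. X ** Lam eigenvalue = Lam eigenvalue ** X}"
proof -
  have off: "(\<forall>i\<in>{1..p+1}. \<forall>j\<in>{1..p+1}. i \<noteq> j \<longrightarrow> block_part k i j X = 0) \<longleftrightarrow>
      X ** Lam eigenvalue = Lam eigenvalue ** X" for X
    unfolding commute_Lam_iff
  proof
    assume *: "\<forall>i\<in>{1..p+1}. \<forall>j\<in>{1..p+1}. i \<noteq> j \<longrightarrow> block_part k i j X = 0"
    show "\<forall>r s. block_index r \<noteq> block_index s \<longrightarrow> X $ r $ s = 0"
    proof (intro allI impI)
      fix r s assume "block_index r \<noteq> block_index s"
      then have "block_part k (block_index r) (block_index s) X = 0"
        using * block_index_bounds(1) by blast
      then show "X $ r $ s = 0"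
        using block_part_entry[OF block_index_bounds(1)[of r] block_index_bounds(1)[of s], of X r s] by simp
    qed
  qed (simp add: vec_eq_iff block_part_entry)
  have orth: "(\<forall>i\<in>{1..p+1}. transpose (block_part k i i X) ** block_part k i i X =
      block_part k i i (mat 1)) \<longleftrightarrow> transpose X ** X = mat 1"
    if X: "\<And>r s. block_index r \<noteq> block_index s \<Longrightarrow> X $ r $ s = 0" for X
  proof -
    have entry: "(transpose (block_part k i i X) ** block_part k i i X) $ r $ s =
        (if block_index r = i \<and> block_index s = i then (transpose X ** X) $ r $ s else 0)"
      if i: "i \<in> {1..p+1}" for i r s
    proof -
      have "(transpose (block_part k i i X) ** block_part k i i X) $ r $ s =
          (\<Sum>t\<in>UNIV. (if block_index t = i \<and> block_index r = i then X $ t $ r else 0) *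
            (if block_index t = i \<and> block_index s = i then X $ t $ s else 0))"
        by (simp add: matrix_matrix_mult_def transpose_def block_part_entry[OF i i])
      also have "\<dots> = (\<Sum>t\<in>UNIV. if block_index r = i \<and> block_index s = i then X $ t $ r * X $ t $ s else 0)"
        using X by (intro sum.cong refl) auto
      also have "\<dots> = (if block_index r = i \<and> block_index s = i then (transpose X ** X) $ r $ s else 0)"
        by (cases "block_index r = i \<and> block_index s = i")
          (simp_all only: simp_thms if_True if_False sum.neutral_const
            matrix_matrix_mult_def transpose_def vec_lambda_beta)
      finally show ?thesis .
    qed
    have off: "(transpose X ** X) $ r $ s = mat 1 $ r $ s" if "block_index r \<noteq> block_index s" for r s
    proof -
      have prod0: "X $ t $ r * X $ t $ s = 0" for t
        using X[of t r] X[of t s] that by (metis mult_eq_0_iff)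
      have "(transpose X ** X) $ r $ s = 0"
        by (simp only: matrix_matrix_mult_def transpose_def vec_lambda_beta prod0 sum.neutral_const)
      then show ?thesis using that by (auto simp: mat_def)
    qed
    show ?thesis
    proof
      assume *: "\<forall>i\<in>{1..p+1}. transpose (block_part k i i X) ** block_part k i i X = block_part k i i (mat 1)"
      have "(transpose X ** X) $ r $ s = mat 1 $ r $ s" for r s
      proof (cases "block_index r = block_index s")
        case True
        note i = block_index_bounds(1)[of r]
        show ?thesis
          using bspec[OF * i] entry[OF i, of r s] block_part_entry[OF i i, of "mat 1" r s] True by simp
      qed (rule off)
      then show "transpose X ** X = mat 1" by (simp add: vec_eq_iff)
    qed (simp add: vec_eq_iff entry block_part_entry)
  qed
  show ?thesis
    unfolding SO_blocks_def
  proof (rule Collect_cong)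
    fix X
    show "(\<forall>i\<in>{1..p+1}. \<forall>j\<in>{1..p+1}. i \<noteq> j \<longrightarrow> block_part k i j X = 0) \<and>
        (\<forall>i\<in>{1..p+1}. transpose (block_part k i i X) ** block_part k i i X = block_part k i i (mat 1)) \<and>
        (\<Prod>i\<in>{1..p+1}. block_det k i X) = 1 \<longleftrightarrow>
      X \<in> SO \<and> X ** Lam eigenvalue = Lam eigenvalue ** X"
    proof (cases "X ** Lam eigenvalue = Lam eigenvalue ** X")
      case True
      then have X: "X $ r $ s = 0" if "block_index r \<noteq> block_index s" for r s
        using that unfolding commute_Lam_iff by blast
      have "(\<forall>i\<in>{1..p+1}. transpose (block_part k i i X) ** block_part k i i X =
          block_part k i i (mat 1)) \<longleftrightarrow> transpose X ** X = mat 1"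
        by (rule orth) (rule X)
      moreover have "det X = (\<Prod>i\<in>{1..p+1}. block_det k i X)"
        by (rule det_block_diagonal) (rule X)
      ultimately show ?thesis unfolding off SO_iff using True by presburger
    next
      case False
      then show ?thesis unfolding off by blast
    qed
  qed
qed

text \<open>The entries of \<open>[B, \<Lambda>]\<close> are \<open>(l\<^sub>s - l\<^sub>r) B\<^sub>r\<^sub>s\<close>. For skew-symmetric \<open>B\<close> and \<open>C\<close> the trace is therefore a
  sum of terms \<open>(l\<^sub>r - l\<^sub>s)\<^sup>2 B\<^sub>r\<^sub>s C\<^sub>r\<^sub>s\<close> symmetric in \<open>r\<close> and \<open>s\<close>; the entries above and below the diagonal
  blocks contribute equally, which is the factor \<open>2\<close>.\<close>

lemma flag_m_inner_eq:
  assumes B: "B \<in> off eigenvalue" and C: "C \<in> off eigenvalue"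
  shows "flag_m_inner p k a B C = trace ((B ** Lam eigenvalue - Lam eigenvalue ** B) **
    (C ** Lam eigenvalue - Lam eigenvalue ** C))"
proof -
  let ?b = block_index
  define F where "F r s = (eigenvalue r - eigenvalue s)\<^sup>2 * (B $ r $ s * C $ r $ s)" for r s
  have sym: "F s r = F r s" for r s
  proof -
    have "B $ s $ r * C $ s $ r = B $ r $ s * C $ r $ s"
      using off_skew(1)[OF B, of s r] off_skew(1)[OF C, of s r] by simp
    then show ?thesis by (simp add: F_def power2_commute)
  qed
  have "trace ((B ** Lam eigenvalue - Lam eigenvalue ** B) **
      (C ** Lam eigenvalue - Lam eigenvalue ** C)) = (\<Sum>r\<in>UNIV. \<Sum>s\<in>UNIV. F r s)"
  proof -
    have "((B ** Lam eigenvalue - Lam eigenvalue ** B) $ r $ s) *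
      ((C ** Lam eigenvalue - Lam eigenvalue ** C) $ s $ r) = F r s" for r s
    proof -
      have "(C ** Lam eigenvalue - Lam eigenvalue ** C) $ s $ r = - C $ r $ s * (eigenvalue r - eigenvalue s)"
        using off_skew(1)[OF C, of s r] by (simp add: mult_Lam Lam_mult algebra_simps)
      moreover have "(B ** Lam eigenvalue - Lam eigenvalue ** B) $ r $ s = B $ r $ s * (eigenvalue s - eigenvalue r)"
        by (simp add: mult_Lam Lam_mult algebra_simps)
      ultimately show ?thesis by (simp only: F_def power2_eq_square) (simp add: algebra_simps)
    qed
    then show ?thesis by (simp add: trace_mult_eq)
  qed
  also have "\<dots> = (\<Sum>r\<in>UNIV. \<Sum>s\<in>UNIV. (if ?b r < ?b s then F r s else 0) + (if ?b s < ?b r then F r s else 0))"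
  proof (intro sum.cong refl)
    fix r s
    have "F r s = 0" if "?b r = ?b s" using that by (simp add: F_def eigenvalue_def)
    then show "F r s = (if ?b r < ?b s then F r s else 0) + (if ?b s < ?b r then F r s else 0)"
      by (cases "?b r" "?b s" rule: linorder_cases) auto
  qed
  also have "\<dots> = (\<Sum>r\<in>UNIV. \<Sum>s\<in>UNIV. if ?b r < ?b s then F r s else 0) +
      (\<Sum>s\<in>UNIV. \<Sum>r\<in>UNIV. if ?b s < ?b r then F r s else 0)"
    by (simp add: sum.distrib sum.swap[of "\<lambda>r s. if ?b s < ?b r then F r s else 0"])
  also have "(\<Sum>s\<in>UNIV. \<Sum>r\<in>UNIV. if ?b s < ?b r then F r s else 0) =
      (\<Sum>r\<in>UNIV. \<Sum>s\<in>UNIV. if ?b r < ?b s then F r s else 0)"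
    by (intro sum.cong refl if_cong sym)
  finally have tr: "trace ((B ** Lam eigenvalue - Lam eigenvalue ** B) **
      (C ** Lam eigenvalue - Lam eigenvalue ** C)) =
      2 * (\<Sum>r\<in>UNIV. \<Sum>s\<in>UNIV. if ?b r < ?b s then F r s else 0)"
    by simp
  let ?G = "\<lambda>i j r s. if ?b r = i \<and> ?b s = j then F r s else 0"
  have "(a i - a j)^2 * trace (transpose (block_part k i j B) ** block_part k i j C) =
      (\<Sum>s\<in>UNIV. \<Sum>r\<in>UNIV. ?G i j r s)" if ij: "i \<in> {1..p+1}" "j \<in> {1..p+1}" for i j
    by (auto simp: trace_mult_eq transpose_def block_part_entry[OF ij] sum_distrib_left F_def
        eigenvalue_def intro!: sum.cong)
  then have "flag_m_inner p k a B C = 2 * (\<Sum>j\<in>{1..p+1}. \<Sum>i\<in>{1..<j}. \<Sum>s\<in>UNIV. \<Sum>r\<in>UNIV. ?G i j r s)"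
    unfolding flag_m_inner_def by (intro arg_cong[of _ _ "\<lambda>x. 2 * x"] sum.cong refl) auto
  also have "\<dots> = 2 * (\<Sum>j\<in>{1..p+1}. \<Sum>s\<in>UNIV. \<Sum>r\<in>UNIV. \<Sum>i\<in>{1..<j}. ?G i j r s)"
    by (intro arg_cong[of _ _ "\<lambda>x. 2 * x"] sum.cong refl sum_swap3)
  also have "\<dots> = 2 * (\<Sum>s\<in>UNIV. \<Sum>r\<in>UNIV. \<Sum>j\<in>{1..p+1}. \<Sum>i\<in>{1..<j}. ?G i j r s)"
    by (intro arg_cong[of _ _ "\<lambda>x. 2 * x"] sum_swap3)
  also have "\<dots> = 2 * (\<Sum>s\<in>UNIV. \<Sum>r\<in>UNIV. if ?b r < ?b s then F r s else 0)"
  proof (intro arg_cong[of _ _ "\<lambda>x. 2 * x"] sum.cong refl)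
    fix r s
    have "(\<Sum>i\<in>{1..<j}. ?G i j r s) = (if ?b s = j then (if ?b r < j then F r s else 0) else 0)" for j
    proof (cases "?b s = j")
      case True
      have "(\<Sum>i\<in>{1..<j}. ?G i j r s) = (\<Sum>i\<in>{1..<j}. if ?b r = i then F r s else 0)"
        using True by (intro sum.cong) auto
      then show ?thesis using True block_index_bounds(1)[of r] by (simp add: sum.delta')
    qed simp
    then show "(\<Sum>j\<in>{1..p+1}. \<Sum>i\<in>{1..<j}. ?G i j r s) = (if ?b r < ?b s then F r s else 0)"
      using block_index_bounds(1)[of s] by (simp add: sum.delta' del: sum.cl_ivl_Suc)
  qed
  also have "\<dots> = 2 * (\<Sum>r\<in>UNIV. \<Sum>s\<in>UNIV. if ?b r < ?b s then F r s else 0)"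
    by (subst sum.swap) simp
  finally show ?thesis using tr by simp
qed

lemma flag_blocks_eigenvalue: "flag_blocks p k a eigenvalue"
  by unfold_locales (rule SO_blocks_eq flag_m_eq flag_Lambda_eq flag_m_inner_eq; assumption?)+

end

section \<open>The isometry\<close>

theorem proposition7p4:
  fixes p :: nat and k :: "nat \<Rightarrow> nat" and a :: "nat \<Rightarrow> real"
  assumes "p \<ge> 1"
    and "k 0 = 0"
    and "\<forall>i\<le>p. k i < k (i + 1)"
    and "k (p + 1) = CARD('n::{finite,linorder})"
    and "inj_on a {1..p+1}"
  shows
    "riemannian_manifold (flag_m p k)
       (flag_quotient p k :: 'n sqmat set set) (flag_quotient_atlas p k)
       (flag_quotient_metric p k a) \<and>
     riemannian_manifold (flag_m p k)
       (isospectral_flag p k a :: 'n sqmat set) (isospectral_atlas p k a)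
       isospectral_metric \<and>
     (\<forall>Q\<in>SO :: 'n sqmat set.
        flag_map p k a (flag_coset p k Q) = Q ** flag_Lambda p k a ** transpose Q) \<and>
     diffeomorphism
       (flag_quotient p k :: 'n sqmat set set) (flag_quotient_atlas p k)
       (isospectral_flag p k a) (isospectral_atlas p k a)
       (flag_map p k a) \<and>
     isometric
       (flag_quotient p k :: 'n sqmat set set) (flag_quotient_atlas p k)
       (flag_quotient_metric p k a)
       (isospectral_atlas p k a) isospectral_metric
       (flag_map p k a) \<and>
     (\<forall>Q\<in>SO. \<forall>x\<in>flag_quotient p k :: 'n sqmat set set.
        flag_map p k a ((**) Q ` x) = Q ** flag_map p k a x ** transpose Q)"
proof -
  let ?l = "eigenvalue k a :: 'n \<Rightarrow> real"
  interpret flag_blocks p k a ?l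
    by (rule flag_blocks_eigenvalue[OF assms(2-5)])
  have "\<phi> ((**) Q ` x) = Q ** \<phi> x ** transpose Q" if Q: "Q \<in> SO" and x: "x \<in> Quot" for Q x
  proof -
    obtain R where R: "R \<in> SO" "x = coset R" using QuotE[OF x] by blast
    have "\<phi> ((**) Q ` x) = conj_by Q (\<phi> x)"
      unfolding R(2) translate_coset[OF Q R(1)] flag_map_coset[OF SO_mult[OF Q R(1)]]
        flag_map_coset[OF R(1)] conj_by_mult ..
    then show ?thesis by (simp add: conj_by_def)
  qed
  moreover have "\<phi> (coset Q) = Q ** flag_Lambda p k a ** transpose Q" if "Q \<in> SO" for Q
    using flag_map_coset[OF that] by (simp add: conj_by_def Lambda_eq)
  ultimately show ?thesis
    unfolding riemannian_manifold_def flag_quotient_metric_eq isospectral_atlas_eq isospectral_eq m_eq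
    using smooth_manifold_quot riemannian_metric_quot smooth_manifold_orbit riemannian_metric_orbit
      iso.isometric_pullback
      iso.diffeomorphism_f[OF smooth_manifold_quot smooth_manifold_orbit refl]
    by blast
qed

end
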